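(* Let $B$ be a finite multipermutational skew brace. Then there exists a unique Carter subgroup of $(B,\cdot)$ that is a subbrace of $B$. Furthermore, this subgroup is a Carter subbrace of $B$ and contains the idealiser $\mathrm{I}_B(\Sigma_B)$ of the Sylow system $\Sigma_B$ of $B$.
   Context: A skew (left) brace is a set $B$ with two group operations $(B,+)$ and $(B,\cdot)$ (neither assumed commutative) such that $a(b+c)=ab-a+ac$ for all $a,b,c\in B$; the two groups share the same identity $0$. The lambda map is $\lambda\colon (B,\cdot)\to\mathrm{Aut}(B,+)$, $\lambda_a(b)=-a+ab$. A subbrace of $B$ is a subset that is a subgroup of both $(B,+)$ and $(B,\cdot)$. An ideal of $B$ is a subbrace $I$ with $\lambda_b(I)\subseteq I$ for all $b\in B$ that is normal in both $(B,+)$ and $(B,\cdot)$; one can form the quotient skew brace by an ideal. $\mathrm{Soc}(B)=\ker\lambda\cap Z(B,+)$ and $Z(B)=\mathrm{Soc}(B)\cap Z(B,\cdot)$ are ideals of $B$. Put $\mathrm{Soc}_1(B)=\mathrm{Soc}(B)$, $\mathrm{Soc}_{n+1}(B)/\mathrm{Soc}_n(B)=\mathrm{Soc}(B/\mathrm{Soc}_n(B))$, and $Z_1(B)=Z(B)$, $Z_{n+1}(B)/Z_n(B)=Z(B/Z_n(B))$. $B$ is multipermutational if $\mathrm{Soc}_n(B)=B$ for some $n\ge 1$, and centrally nilpotent if $Z_n(B)=B$ for some $n\ge1$. A Carter subgroup of a finite soluble group is a nilpotent self-normalising subgroup. It is known that $(B,\cdot)$ is soluble when $B$ is finite multipermutational.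 A subbrace $C$ of $B$ is self-idealising in $B$ if it is not an ideal of any subbrace of $B$ strictly containing $C$. A Carter subbrace of $B$ is a centrally nilpotent, self-idealising subbrace of $B$. If $B$ is multipermutational then $(B,+)$ is nilpotent. For a finite skew brace $B$ with $(B,+)$ nilpotent, the Sylow system $\Sigma_B$ of $B$ is the set of Sylow subgroups of $(B,+)$ (one for each prime dividing $|B|$); it is known that its members are subbraces and that $\Sigma_B$ is also a Sylow system of $(B,\cdot)$, i.e. a set consisting of one Sylow $p$-subgroup of $(B,\cdot)$ for each prime $p$ dividing $|B|$, pairwise permutable. The idealiser of $\Sigma_B$ is $\mathrm{I}_B(\Sigma_B)=\bigcap_{P\in\Sigma_B}\mathrm{I}_B(P)=\bigcap_{P\in\Sigma_B}\mathrm{N}_{(B,\cdot)}(P,\cdot)$, where $\mathrm{I}_B(P)=\mathrm{N}_{(B,+)}(P,+)\cap \mathrm{N}_{(B,\cdot)}(P,\cdot)$; it is a subbrace of $B$. *)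

theory Defs
  imports "HOL-Computational_Algebra.Primes" "HOL-Algebra.Group_Action" "HOL-Algebra.AbelCoset"
begin

section \<open>Groups\<close>

definition group_center :: "('a, 'b) monoid_scheme \<Rightarrow> 'a set"
  where "group_center G = {z \<in> carrier G. \<forall>g \<in> carrier G. z \<otimes>\<^bsub>G\<^esub> g = g \<otimes>\<^bsub>G\<^esub> z}"

primrec upper_central_series :: "('a, 'b) monoid_scheme \<Rightarrow> nat \<Rightarrow> 'a set"
  where
    "upper_central_series G 0 = {\<one>\<^bsub>G\<^esub>}"
  | "upper_central_series G (Suc n) =
       {g \<in> carrier G. upper_central_series G n #>\<^bsub>G\<^esub> g
                         \<in> group_center (G Mod upper_central_series G n)}"

definition nilpotent_group :: "('a, 'b) monoid_scheme \<Rightarrow> bool"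
  where "nilpotent_group G \<longleftrightarrow> group G \<and> (\<exists>n. upper_central_series G n = carrier G)"

text \<open>Intended for finite soluble groups.\<close>

definition carter_subgroup :: "'a set \<Rightarrow> ('a, 'b) monoid_scheme \<Rightarrow> bool"
  where "carter_subgroup C G \<longleftrightarrow>
    subgroup C G \<and> nilpotent_group (G\<lparr>carrier := C\<rparr>) \<and> normalizer G C = C"

definition sylow_subgroup :: "nat \<Rightarrow> 'a set \<Rightarrow> ('a, 'b) monoid_scheme \<Rightarrow> bool"
  where "sylow_subgroup p P G \<longleftrightarrow> subgroup P G \<and> card P = p ^ multiplicity p (order G)"


section \<open>Skew braces\<close>

text \<open>
  The record type of rings is used only as a carrier with two operations. Viewed as a monoid
  record, \<open>B\<close> is the multiplicative group of the brace; \<open>add_monoid B\<close> is its additive group, which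
  need not be commutative. That \<open>\<zero> = \<one>\<close> follows from the brace law at \<open>b = c = \<zero>\<close>.
\<close>

locale skew_brace =
  fixes B :: "('a, 'b) ring_scheme" (structure)
  assumes add_group: "group (add_monoid B)"
    and mult_group: "group B"
    and brace_law: "\<lbrakk>a \<in> carrier B; b \<in> carrier B; c \<in> carrier B\<rbrakk>
      \<Longrightarrow> a \<otimes> (b \<oplus> c) = ((a \<otimes> b) \<ominus> a) \<oplus> (a \<otimes> c)"

text \<open>The map \<open>\<lambda>\<^sub>a\<close> is made extensional so as to be an element of \<open>AutoGroup (add_monoid B)\<close>.\<close>

definition lambda_map :: "('a, 'b) ring_scheme \<Rightarrow> 'a \<Rightarrow> 'a \<Rightarrow> 'a"
  where "lambda_map B a = (\<lambda>b \<in> carrier B. (\<ominus>\<^bsub>B\<^esub> a) \<oplus>\<^bsub>B\<^esub> (a \<otimes>\<^bsub>B\<^esub> b))"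

definition subbrace :: "'a set \<Rightarrow> ('a, 'b) ring_scheme \<Rightarrow> bool"
  where "subbrace C B \<longleftrightarrow> subgroup C (add_monoid B) \<and> subgroup C B"

definition brace_ideal :: "'a set \<Rightarrow> ('a, 'b) ring_scheme \<Rightarrow> bool"
  where "brace_ideal I B \<longleftrightarrow>
    subbrace I B \<and> (\<forall>b \<in> carrier B. lambda_map B b ` I \<subseteq> I) \<and>
    normal I (add_monoid B) \<and> normal I B"

text \<open>
  For an ideal \<open>I\<close> the additive and multiplicative cosets agree
  (\<open>a I = a + \<lambda>\<^sub>a(I) = a + I\<close>), so the carrier may be taken from either factor group.
\<close>

definition brace_quotient :: "('a, 'b) ring_scheme \<Rightarrow> 'a set \<Rightarrow> 'a set ring"
  where "brace_quotient B I =
    \<lparr>carrier = rcosets\<^bsub>B\<^esub> I, mult = set_mult B, one = I, zero = I, add = set_add B\<rparr>"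

definition brace_socle :: "('a, 'b) ring_scheme \<Rightarrow> 'a set"
  where "brace_socle B =
    kernel B (AutoGroup (add_monoid B)) (lambda_map B) \<inter> group_center (add_monoid B)"

definition brace_center :: "('a, 'b) ring_scheme \<Rightarrow> 'a set"
  where "brace_center B = brace_socle B \<inter> group_center B"

text \<open>The two series start at index 1; the entry at index 0 is never used.\<close>

fun socle_series :: "('a, 'b) ring_scheme \<Rightarrow> nat \<Rightarrow> 'a set"
  where
    "socle_series B 0 = {\<zero>\<^bsub>B\<^esub>}"
  | "socle_series B (Suc 0) = brace_socle B"
  | "socle_series B (Suc (Suc n)) =
       {b \<in> carrier B. socle_series B (Suc n) #>\<^bsub>B\<^esub> b
                         \<in> brace_socle (brace_quotient B (socle_series B (Suc n)))}"

fun center_series :: "('a, 'b) ring_scheme \<Rightarrow> nat \<Rightarrow> 'a set"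
  where
    "center_series B 0 = {\<zero>\<^bsub>B\<^esub>}"
  | "center_series B (Suc 0) = brace_center B"
  | "center_series B (Suc (Suc n)) =
       {b \<in> carrier B. center_series B (Suc n) #>\<^bsub>B\<^esub> b
                         \<in> brace_center (brace_quotient B (center_series B (Suc n)))}"

definition multipermutational :: "('a, 'b) ring_scheme \<Rightarrow> bool"
  where "multipermutational B \<longleftrightarrow> (\<exists>n \<ge> 1. socle_series B n = carrier B)"

definition centrally_nilpotent :: "('a, 'b) ring_scheme \<Rightarrow> bool"
  where "centrally_nilpotent B \<longleftrightarrow> (\<exists>n \<ge> 1. center_series B n = carrier B)"

definition self_idealising :: "'a set \<Rightarrow> ('a, 'b) ring_scheme \<Rightarrow> bool"
  where "self_idealising C B \<longleftrightarrow>
    \<not> (\<exists>D. subbrace D B \<and> C \<subset> D \<and> brace_ideal C (B\<lparr>carrier := D\<rparr>))"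

definition carter_subbrace :: "'a set \<Rightarrow> ('a, 'b) ring_scheme \<Rightarrow> bool"
  where "carter_subbrace C B \<longleftrightarrow>
    subbrace C B \<and> centrally_nilpotent (B\<lparr>carrier := C\<rparr>) \<and> self_idealising C B"

definition sylow_system :: "('a, 'b) ring_scheme \<Rightarrow> 'a set set"
  where "sylow_system B =
    {P. \<exists>p. prime p \<and> p dvd order B \<and> sylow_subgroup p P (add_monoid B)}"

definition idealiser :: "('a, 'b) ring_scheme \<Rightarrow> 'a set \<Rightarrow> 'a set"
  where "idealiser B P = normalizer (add_monoid B) P \<inter> normalizer B P"

text \<open>Intersecting with the carrier only matters for the trivial brace, whose Sylow system is empty.\<close>

definition sylow_idealiser :: "('a, 'b) ring_scheme \<Rightarrow> 'a set"
  where "sylow_idealiser B = carrier B \<inter> (\<Inter>P \<in> sylow_system B. idealiser B P)"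

end

theory Submission
  imports Defs "HOL-Algebra.Sylow" "HOL-Algebra.Multiplicative_Group"
begin

text \<open>
  The proof is an induction on \<open>|B|\<close> along quotients by pieces of the socle.

  A multipermutational \<open>B\<close> has nilpotent additive group, so for every set \<open>S\<close> of primes there is an
  additive Hall subgroup \<open>B\<^sub>S\<close>. These are characteristic, hence \<open>\<lambda>\<close>-invariant, hence subbraces; and
  since only cardinalities matter, they are Hall subgroups of the multiplicative group too. If \<open>C\<close> is
  a subbrace with nilpotent multiplicative group, then \<open>C \<inter> B\<^sub>S\<close> and \<open>C \<inter> B\<^sub>T\<close> commute for disjoint
  \<open>S\<close> and \<open>T\<close>, and comparing \<open>u v\<close> with \<open>v u\<close> in the additive group shows that they act trivially
  on each other through \<open>\<lambda>\<close> (\<open>nilpotent_subbrace_parts\<close>).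

  Let \<open>B\<close> be nontrivial and let \<open>A\<close> be a nontrivial Sylow \<open>p\<close>-subgroup of \<open>Soc(B)\<close>, an ideal. On the
  socle both operations agree and conjugation by \<open>b\<close> is \<open>\<lambda>\<^sub>b\<close>. For a multiplicatively nilpotent
  subbrace \<open>E\<close> of \<open>B / A\<close> let \<open>D\<close> be its preimage (\<open>lift\<close>) and \<open>H = D \<inter> B\<^sub>p\<^sub>'\<close> (\<open>hall\<close>). The \<open>p\<close>-part of
  \<open>D\<close> fixes \<open>H\<close> pointwise under \<open>\<lambda>\<close>, and from this one computes that the multiplicative normaliser \<open>N\<close>
  of \<open>H\<close> in \<open>D\<close> (\<open>hall_norm\<close>) equals \<open>P H = P + H\<close>, where \<open>P\<close> (\<open>fixed\<close>) consists of the \<open>H\<close>-fixed points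
  in the \<open>p\<close>-part of \<open>D\<close>. This is the crucial point: a normaliser, a purely multiplicative object, turns
  out to be additively closed. Moreover \<open>N\<close> is nilpotent, being the product of the commuting nilpotent
  groups \<open>P\<close> and \<open>H\<close>.

  The claim is that \<open>E \<mapsto> N\<close> is a bijection from the subbraces of \<open>B / A\<close> that are Carter subgroups of
  the multiplicative group to those of \<open>B\<close>, with inverse \<open>X \<mapsto> X A / A\<close>. Both directions rest on one
  averaging argument, the triviality of cocycles \<open>H \<rightarrow> A\<close> for \<open>|H|\<close> prime to \<open>p\<close>
  (\<open>cocycle_is_coboundary\<close>). In one direction it yields \<open>N A = D\<close> (\<open>f_hall_norm\<close>), from which \<open>N\<close>
  inherits being self-normalising from \<open>E\<close>. In the other it yields the conjugacy under \<open>A\<close> of the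
  relevant complements of \<open>A\<close> in \<open>A H\<close>, from which the image of such a subbrace \<open>X\<close> of \<open>B\<close> inherits being
  self-normalising (\<open>self_normalising_descends\<close>); and \<open>X = N\<close>, because \<open>X\<close> is contained in the nilpotent
  group \<open>N\<close> and is self-normalising (\<open>carter_image\<close>).

  The idealiser of the Sylow system maps into the idealiser of the Sylow system of \<open>B / A\<close>, so by
  induction it is contained in \<open>D\<close>. It normalises \<open>B\<^sub>p\<^sub>'\<close>, hence \<open>H\<close>, so it is contained in \<open>N\<close>.

  Finally, the Carter subgroup \<open>C\<close> found is, as a subbrace, itself multipermutational, and a
  multipermutational skew brace with nilpotent multiplicative group is centrally nilpotent
  (\<open>multipermutational_nilpotent_imp_centrally_nilpotent\<close>). It is self-idealising because a subbrace
  in which \<open>C\<close> is an ideal normalises \<open>C\<close>.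
\<close>

section \<open>Conjugation, commutators, normalisers\<close>

definition conjugate :: "('a, 'b) monoid_scheme \<Rightarrow> 'a \<Rightarrow> 'a \<Rightarrow> 'a"
  where "conjugate G g h = g \<otimes>\<^bsub>G\<^esub> h \<otimes>\<^bsub>G\<^esub> inv\<^bsub>G\<^esub> g"

definition commutator :: "('a, 'b) monoid_scheme \<Rightarrow> 'a \<Rightarrow> 'a \<Rightarrow> 'a"
  where "commutator G g h = g \<otimes>\<^bsub>G\<^esub> h \<otimes>\<^bsub>G\<^esub> inv\<^bsub>G\<^esub> g \<otimes>\<^bsub>G\<^esub> inv\<^bsub>G\<^esub> h"

context group
begin

lemma l_inv_cancel [simp]: "\<lbrakk>x \<in> carrier G; y \<in> carrier G\<rbrakk> \<Longrightarrow> inv x \<otimes> (x \<otimes> y) = y"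
  by (simp flip: m_assoc)

lemma r_inv_cancel [simp]: "\<lbrakk>x \<in> carrier G; y \<in> carrier G\<rbrakk> \<Longrightarrow> x \<otimes> (inv x \<otimes> y) = y"
  by (simp flip: m_assoc)

lemma conjugate_closed [simp]:
  "\<lbrakk>x \<in> carrier G; y \<in> carrier G\<rbrakk> \<Longrightarrow> conjugate G x y \<in> carrier G"
  by (simp add: conjugate_def)

lemma conjugate_mult:
  "\<lbrakk>x \<in> carrier G; y \<in> carrier G; z \<in> carrier G\<rbrakk>
    \<Longrightarrow> conjugate G x (y \<otimes> z) = conjugate G x y \<otimes> conjugate G x z"
  by (simp add: conjugate_def m_assoc)

lemma conjugate_conjugate:
  "\<lbrakk>x \<in> carrier G; y \<in> carrier G; z \<in> carrier G\<rbrakk>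
    \<Longrightarrow> conjugate G (x \<otimes> y) z = conjugate G x (conjugate G y z)"
  by (simp add: conjugate_def m_assoc inv_mult_group)

lemma conjugate_one [simp]: "x \<in> carrier G \<Longrightarrow> conjugate G x \<one> = \<one>"
  by (simp add: conjugate_def)

lemma conjugate_by_one [simp]: "x \<in> carrier G \<Longrightarrow> conjugate G \<one> x = x"
  by (simp add: conjugate_def)

lemma conjugate_pow:
  "\<lbrakk>x \<in> carrier G; y \<in> carrier G\<rbrakk>
    \<Longrightarrow> conjugate G x (y [^] (n::nat)) = conjugate G x y [^] n"
  by (induction n) (simp_all add: conjugate_mult)

lemma conjugate_inj:
  "\<lbrakk>x \<in> carrier G; y \<in> carrier G; z \<in> carrier G; conjugate G x y = conjugate G x z\<rbrakk> \<Longrightarrow> y = z"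
  by (simp add: conjugate_def)

lemma conjugate_eq_iff_commute:
  "\<lbrakk>x \<in> carrier G; y \<in> carrier G\<rbrakk> \<Longrightarrow> conjugate G x y = y \<longleftrightarrow> x \<otimes> y = y \<otimes> x"
  by (metis conjugate_def inv_solve_right' m_closed)

lemma commutator_closed [simp]:
  "\<lbrakk>x \<in> carrier G; y \<in> carrier G\<rbrakk> \<Longrightarrow> commutator G x y \<in> carrier G"
  by (simp add: commutator_def)

lemma commutator_mult:
  "\<lbrakk>x \<in> carrier G; y \<in> carrier G\<rbrakk> \<Longrightarrow> x \<otimes> y = commutator G x y \<otimes> y \<otimes> x"
  by (simp add: commutator_def m_assoc)

lemma commutator_eq_one_iff:
  "\<lbrakk>x \<in> carrier G; y \<in> carrier G\<rbrakk> \<Longrightarrow> commutator G x y = \<one> \<longleftrightarrow> x \<otimes> y = y \<otimes> x"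
  by (metis commutator_mult commutator_def inv_mult_group l_one m_assoc m_closed inv_closed r_inv)

text \<open>
  Conjugation is injective, so on a finite set an inclusion \<open>x H x\<inverse> \<subseteq> H\<close> is already an equality.
\<close>

lemma normalizer_iff:
  assumes "finite (carrier G)" "H \<subseteq> carrier G"
  shows "x \<in> normalizer G H \<longleftrightarrow> x \<in> carrier G \<and> (\<forall>h\<in>H. conjugate G x h \<in> H)"
proof -
  have *: "l_coset G x H #> inv x = conjugate G x ` H" if "x \<in> carrier G"
    using assms(2) that by (auto simp: l_coset_def r_coset_def conjugate_def)
  have "conjugate G x ` H = H" if x: "x \<in> carrier G" and "\<forall>h\<in>H. conjugate G x h \<in> H"
  proof (rule endo_inj_surj)
    show "finite H" using assms finite_subset by blast
    show "conjugate G x ` H \<subseteq> H" using that by blast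
    show "inj_on (conjugate G x) H"
      using conjugate_inj[OF x] assms(2) by (meson inj_onI subsetD)
  qed
  then show ?thesis
    using assms(2) * by (auto simp: normalizer_def stabilizer_def)
qed

lemma subgroup_normalizer:
  assumes "finite (carrier G)" "H \<subseteq> carrier G"
  shows "subgroup (normalizer G H) G"
proof (rule subgroupI)
  show "normalizer G H \<subseteq> carrier G" using normalizer_iff[OF assms] by blast
  have "\<one> \<in> normalizer G H"
    using subsetD[OF assms(2)] by (simp add: normalizer_iff[OF assms])
  then show "normalizer G H \<noteq> {}" by blast
next
  fix x assume x: "x \<in> normalizer G H"
  then have xc: "x \<in> carrier G" by (simp add: normalizer_iff[OF assms])
  have "conjugate G (x [^] n) h \<in> H" if "h \<in> H" for h and n :: nat
    using that
  proof (induction n arbitrary: h)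
    case 0 then show ?case using assms(2) by auto
  next
    case (Suc n)
    have "conjugate G (x [^] n \<otimes> x) h = conjugate G (x [^] n) (conjugate G x h)"
      using Suc.prems assms(2) xc by (intro conjugate_conjugate) auto
    then show ?case
      using Suc x by (simp add: normalizer_iff[OF assms])
  qed
  \<comment> \<open>In a finite group the inverse of an element is one of its powers.\<close>
  moreover have "inv x = x [^] (order G - 1)"
  proof -
    have "order G > 0" using assms(1) by (simp add: order_gt_0_iff_finite)
    then have "x [^] (order G - 1) \<otimes> x = x [^] order G"
      using nat_pow_Suc[of x "order G - 1"] by simp
    then have "x [^] (order G - 1) \<otimes> x = \<one>" using pow_order_eq_1[OF xc] by simp
    then show ?thesis using xc by (simp add: inv_equality)
  qed
  ultimately show "inv x \<in> normalizer G H"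
    using xc by (simp add: normalizer_iff[OF assms])
next
  fix x y assume "x \<in> normalizer G H" "y \<in> normalizer G H"
  then have xy: "x \<in> carrier G" "y \<in> carrier G"
    and c: "\<And>h. h \<in> H \<Longrightarrow> conjugate G x (conjugate G y h) \<in> H"
    by (simp_all add: normalizer_iff[OF assms])
  have "conjugate G (x \<otimes> y) h \<in> H" if "h \<in> H" for h
    using c[OF that] conjugate_conjugate[OF xy, of h] subsetD[OF assms(2) that] by simp
  then show "x \<otimes> y \<in> normalizer G H"
    using xy by (simp add: normalizer_iff[OF assms])
qed

lemma subgroup_carrier_update:
  assumes "subgroup H G"
  shows "group (G\<lparr>carrier := H\<rparr>)"
    and "\<And>x. x \<in> H \<Longrightarrow> inv\<^bsub>G\<lparr>carrier := H\<rparr>\<^esub> x = inv x"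
    and "\<And>x y. \<lbrakk>x \<in> H; y \<in> H\<rbrakk> \<Longrightarrow> conjugate (G\<lparr>carrier := H\<rparr>) x y = conjugate G x y"
    and "\<And>x y. \<lbrakk>x \<in> H; y \<in> H\<rbrakk> \<Longrightarrow> commutator (G\<lparr>carrier := H\<rparr>) x y = commutator G x y"
  using m_inv_consistent[OF assms]
  by (simp_all only: subgroup_imp_group[OF assms] conjugate_def commutator_def monoid.simps)
    simp_all

lemma subgroup_conjugate:
  "\<lbrakk>subgroup H G; x \<in> H; y \<in> H\<rbrakk> \<Longrightarrow> conjugate G x y \<in> H"
  by (simp add: conjugate_def subgroup.m_closed subgroup.m_inv_closed)

lemma subgroup_commutator:
  "\<lbrakk>subgroup H G; x \<in> H; y \<in> H\<rbrakk> \<Longrightarrow> commutator G x y \<in> H"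
  by (simp add: commutator_def subgroup.m_closed subgroup.m_inv_closed)

lemma pow_coprime_eq_one:
  assumes "x \<in> carrier G" "x [^] (n::nat) = \<one>" "x [^] (m::nat) = \<one>" "coprime n m"
  shows "x = \<one>"
  using assms by (metis coprime_def nat_dvd_1_iff_1 ord_eq_1 pow_eq_id)

lemma commute_inv:
  "\<lbrakk>x \<in> carrier G; y \<in> carrier G; x \<otimes> y = y \<otimes> x\<rbrakk> \<Longrightarrow> inv x \<otimes> y = y \<otimes> inv x"
  by (metis inv_closed inv_solve_left' inv_solve_right m_assoc m_closed)

lemma r_coset_eq_iff:
  assumes "subgroup H G" "x \<in> carrier G" "y \<in> carrier G"
  shows "H #> x = H #> y \<longleftrightarrow> x \<otimes> inv y \<in> H"
proof
  assume "H #> x = H #> y"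
  then have "x \<in> H #> y" using rcos_self[OF assms(2,1)] by simp
  then show "x \<otimes> inv y \<in> H"
    using subgroup.rcos_module_imp[OF assms(1) group_axioms assms(3)] by blast
next
  assume "x \<otimes> inv y \<in> H"
  then have "x \<in> H #> y"
    using subgroup.rcos_module_rev[OF assms(1) group_axioms assms(3,2)] by blast
  then show "H #> x = H #> y" using repr_independence[OF _ assms(3,1)] by simp
qed

section \<open>Nilpotent groups\<close>

text \<open>
  Trading the cosets in the recursion for commutators lets the series be compared with chains in
  subgroups and homomorphic images. Normality and the recursion are proved side by side: a coset of
  a term commutes with all others exactly when commutators fall into that term, but this reading
  presupposes that the term is normal.
\<close>

lemma upper_central_series_properties:
  shows upper_central_series_normal: "upper_central_series G n \<lhd> G"
    and upper_central_series_Suc_eq: "upper_central_series G (Suc n) =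
      {g \<in> carrier G. \<forall>h\<in>carrier G. commutator G g h \<in> upper_central_series G n}"
proof -
  have step: "upper_central_series G (Suc n) =
      {g \<in> carrier G. \<forall>h\<in>carrier G. commutator G g h \<in> upper_central_series G n}"
    if "upper_central_series G n \<lhd> G" for n
  proof -
    define U where "U = upper_central_series G n"
    interpret U: normal U G using that by (simp add: U_def)
    have *: "U #> g \<otimes> h = U #> h \<otimes> g \<longleftrightarrow> commutator G g h \<in> U"
      if "g \<in> carrier G" "h \<in> carrier G" for g h
    proof -
      have "U #> g \<otimes> h = U #> h \<otimes> g \<longleftrightarrow> (g \<otimes> h) \<otimes> inv (h \<otimes> g) \<in> U"
        using that by (intro r_coset_eq_iff[OF U.subgroup_axioms]) simp_all
      then show ?thesis using that by (simp add: commutator_def m_assoc inv_mult_group)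
    qed
    have "U #> g \<in> group_center (G Mod U) \<longleftrightarrow> (\<forall>h\<in>carrier G. commutator G g h \<in> U)"
      if g: "g \<in> carrier G" for g
    proof -
      have "U #> g \<in> group_center (G Mod U) \<longleftrightarrow>
          (\<forall>h\<in>carrier G. (U #> g) <#> (U #> h) = (U #> h) <#> (U #> g))"
        using g by (auto simp: group_center_def FactGroup_def RCOSETS_def)
      also have "\<dots> \<longleftrightarrow> (\<forall>h\<in>carrier G. U #> g \<otimes> h = U #> h \<otimes> g)"
        using g by (simp add: U.rcos_sum)
      also have "\<dots> \<longleftrightarrow> (\<forall>h\<in>carrier G. commutator G g h \<in> U)"
        using g * by blast
      finally show ?thesis .
    qed
    then show ?thesis
      unfolding upper_central_series.simps(2) U_def[symmetric] by blast
  qed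
  show normal: "upper_central_series G n \<lhd> G" for n
  proof (induction n)
    case 0 then show ?case by (simp add: one_is_normal)
  next
    case (Suc n)
    define U where "U = upper_central_series G n"
    interpret U: normal U G using Suc by (simp add: U_def)
    define V where "V = upper_central_series G (Suc n)"
    have V: "V = {g \<in> carrier G. \<forall>h\<in>carrier G. commutator G g h \<in> U}"
      using step[OF Suc] by (simp add: U_def V_def)
    have conj: "conjugate G g u \<in> U" if "g \<in> carrier G" "u \<in> U" for g u
      using U.inv_op_closed2 that by (simp add: conjugate_def)
    have comm_inv: "commutator G (inv g) h \<in> U"
      if "g \<in> carrier G" "h \<in> carrier G" "commutator G g h \<in> U" for g h
    proof -
      have "commutator G (inv g) h = conjugate G (inv g) (inv (commutator G g h))"
        using that by (simp add: commutator_def conjugate_def m_assoc inv_mult_group)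
      then show ?thesis using conj that by simp
    qed
    have comm_mult: "commutator G (g \<otimes> g') h \<in> U"
      if "g \<in> carrier G" "g' \<in> carrier G" "h \<in> carrier G" "commutator G g h \<in> U" "commutator G g' h \<in> U"
      for g g' h
    proof -
      have "commutator G (g \<otimes> g') h = conjugate G g (commutator G g' h) \<otimes> commutator G g h"
        using that(1-3) by (simp add: commutator_def conjugate_def m_assoc inv_mult_group)
      then show ?thesis using conj that by simp
    qed
    have comm_conj: "commutator G (conjugate G x g) h \<in> U"
      if "x \<in> carrier G" "g \<in> carrier G" "h \<in> carrier G" "\<forall>h\<in>carrier G. commutator G g h \<in> U" for x g h
    proof -
      have "commutator G (conjugate G x g) h = conjugate G x (commutator G g (conjugate G (inv x) h))"
        using that(1-3) by (simp add: commutator_def conjugate_def m_assoc inv_mult_group)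
      then show ?thesis using conj that by simp
    qed
    have "commutator G \<one> h \<in> U" if "h \<in> carrier G" for h using that by (simp add: commutator_def)
    then have "subgroup V G"
      unfolding V by (intro subgroupI) (use comm_inv comm_mult in auto)
    then show ?case
      unfolding V_def[symmetric] normal_inv_iff
      using comm_conj by (auto simp: V conjugate_def)
  qed
  show "upper_central_series G (Suc n) =
      {g \<in> carrier G. \<forall>h\<in>carrier G. commutator G g h \<in> upper_central_series G n}"
    using step normal by blast
qed

text \<open>
  A chain \<open>K\<close> whose steps are lowered by commutation lies below the upper central series term by
  term. This is the test for nilpotency used throughout.
\<close>

lemma nilpotent_groupI:
  assumes "K 0 \<subseteq> {\<one>}"
    and comm: "\<And>i g h. \<lbrakk>g \<in> K (Suc i); h \<in> carrier G\<rbrakk> \<Longrightarrow> commutator G g h \<in> K i"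
    and "carrier G \<subseteq> K n"
  shows "nilpotent_group G"
proof -
  have "carrier G \<inter> K i \<subseteq> upper_central_series G i" for i
  proof (induction i)
    case 0 then show ?case using assms(1) by auto
  next
    case (Suc i)
    then show ?case
      using comm[of _ i] by (auto simp del: upper_central_series.simps simp: upper_central_series_Suc_eq)
  qed
  moreover have "upper_central_series G n \<subseteq> carrier G"
    using normal_imp_subgroup[OF upper_central_series_normal] by (rule subgroup.subset)
  ultimately have "upper_central_series G n = carrier G" using assms(3) by blast
  then show ?thesis unfolding nilpotent_group_def by auto
qed

lemma upper_central_series_mono:
  "upper_central_series G i \<subseteq> upper_central_series G (Suc i)"
proof
  fix g assume g: "g \<in> upper_central_series G i"
  interpret U: normal "upper_central_series G i" G by (rule upper_central_series_normal)
  have "commutator G g h \<in> upper_central_series G i" if h: "h \<in> carrier G" for h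
  proof -
    have "commutator G g h = g \<otimes> conjugate G h (inv g)"
      using g h U.mem_carrier by (simp add: commutator_def conjugate_def m_assoc)
    moreover have "conjugate G h (inv g) \<in> upper_central_series G i"
      unfolding conjugate_def using U.inv_op_closed2[OF h] g by simp
    ultimately show ?thesis using g by simp
  qed
  then show "g \<in> upper_central_series G (Suc i)"
    using U.mem_carrier[OF g] unfolding upper_central_series_Suc_eq by blast
qed

lemma nilpotent_groupE:
  assumes "nilpotent_group G"
  obtains K n where "K 0 = {\<one>}" "K n = carrier G" "\<And>i. subgroup (K i) G"
    "\<And>i. K i \<subseteq> K (Suc i)"
    "\<And>i g h. \<lbrakk>g \<in> K (Suc i); h \<in> carrier G\<rbrakk> \<Longrightarrow> commutator G g h \<in> K i"
proof -
  let ?Z = "upper_central_series G"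
  obtain n where n: "?Z n = carrier G"
    using assms by (auto simp: nilpotent_group_def)
  have normal: "?Z i \<lhd> G" for i by (rule upper_central_series_normal)
  show thesis
  proof (rule that)
    show "?Z 0 = {\<one>}" by simp
    show "subgroup (?Z i) G" for i using normal by (rule normal_imp_subgroup)
    show "commutator G g h \<in> ?Z i"
      if "g \<in> ?Z (Suc i)" "h \<in> carrier G" for g h i
      using that unfolding upper_central_series_Suc_eq by blast
    show "?Z i \<subseteq> ?Z (Suc i)" for i
      by (rule upper_central_series_mono)
  qed (rule n)
qed

text \<open>
  The same test, and its converse, for a subgroup, phrased with the operations of the ambient group.
\<close>

lemma nilpotent_subgroupI:
  assumes "subgroup H G" "K 0 \<subseteq> {\<one>}"
    and "\<And>i g h. \<lbrakk>g \<in> K (Suc i); g \<in> H; h \<in> H\<rbrakk> \<Longrightarrow> commutator G g h \<in> K i"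
    and "H \<subseteq> K n"
  shows "nilpotent_group (G\<lparr>carrier := H\<rparr>)"
proof -
  interpret H: group "G\<lparr>carrier := H\<rparr>" by (rule subgroup_carrier_update[OF assms(1)])
  show ?thesis
  proof (rule H.nilpotent_groupI[of "\<lambda>i. K i \<inter> H" n])
    show "commutator (G\<lparr>carrier := H\<rparr>) g h \<in> K i \<inter> H"
      if "g \<in> K (Suc i) \<inter> H" "h \<in> carrier (G\<lparr>carrier := H\<rparr>)" for g h i
      using that assms(1,3) by (simp add: subgroup_carrier_update subgroup_commutator)
  qed (use assms in auto)
qed

lemma nilpotent_subgroupE:
  assumes "subgroup H G" "nilpotent_group (G\<lparr>carrier := H\<rparr>)"
  obtains K n where "K 0 = {\<one>}" "K n = H" "\<And>i. subgroup (K i) G"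
    "\<And>i. K i \<subseteq> K (Suc i)" "\<And>i. K i \<subseteq> H"
    "\<And>i g h. \<lbrakk>g \<in> K (Suc i); h \<in> H\<rbrakk> \<Longrightarrow> commutator G g h \<in> K i"
proof -
  interpret H: group "G\<lparr>carrier := H\<rparr>" by (rule subgroup_carrier_update[OF assms(1)])
  obtain K n where K: "K 0 = {\<one>\<^bsub>G\<lparr>carrier := H\<rparr>\<^esub>}" "K n = carrier (G\<lparr>carrier := H\<rparr>)"
    "\<And>i. subgroup (K i) (G\<lparr>carrier := H\<rparr>)" "\<And>i. K i \<subseteq> K (Suc i)"
    "\<And>i g h. \<lbrakk>g \<in> K (Suc i); h \<in> carrier (G\<lparr>carrier := H\<rparr>)\<rbrakk>
      \<Longrightarrow> commutator (G\<lparr>carrier := H\<rparr>) g h \<in> K i"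
    using H.nilpotent_groupE[OF assms(2)] by blast
  have sub: "K i \<subseteq> H" for i using subgroup.subset[OF K(3)] by simp
  show thesis
  proof (rule that)
    show "commutator G g h \<in> K i" if "g \<in> K (Suc i)" "h \<in> H" for i g h
    proof -
      have "g \<in> H" using that(1) sub by blast
      then show ?thesis
        using K(5)[of g i h] that subgroup_carrier_update(4)[OF assms(1) _ that(2)] by simp
    qed
    show "subgroup (K i) G" for i using incl_subgroup[OF assms(1) K(3)] .
    show "K 0 = {\<one>}" "K n = H" using K(1,2) by simp_all
    show "K i \<subseteq> K (Suc i)" "K i \<subseteq> H" for i by (rule K(4) sub)+
  qed
qed

lemma nilpotent_subgroup:
  assumes "subgroup H G" "subgroup L G" "L \<subseteq> H" "nilpotent_group (G\<lparr>carrier := H\<rparr>)"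
  shows "nilpotent_group (G\<lparr>carrier := L\<rparr>)"
proof -
  obtain K n where K: "K 0 = {\<one>}" "K n = H"
    "\<And>i. subgroup (K i) G" "\<And>i. K i \<subseteq> K (Suc i)" "\<And>i. K i \<subseteq> H"
    "\<And>i g h. \<lbrakk>g \<in> K (Suc i); h \<in> H\<rbrakk> \<Longrightarrow> commutator G g h \<in> K i"
    by (rule nilpotent_subgroupE[OF assms(1,4)]) (rule that)
  show ?thesis
    by (rule nilpotent_subgroupI[OF assms(2), of K n]) (use assms(3) K(1,2,6) in auto)
qed

text \<open>
  Otherwise take the first term of the central series not contained in \<open>L\<close>: its commutators with
  \<open>L\<close> fall into the previous term, hence into \<open>L\<close>, so it normalises \<open>L\<close>.
\<close>

lemma nilpotent_normalizer_grows:
  assumes "subgroup H G" "nilpotent_group (G\<lparr>carrier := H\<rparr>)" "subgroup L G" "L \<subseteq> H"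
    and self_normalizing: "\<And>x. \<lbrakk>x \<in> H; \<And>l. l \<in> L \<Longrightarrow> conjugate G x l \<in> L\<rbrakk> \<Longrightarrow> x \<in> L"
  shows "L = H"
proof -
  interpret L: subgroup L G by fact
  obtain K n where K: "K 0 = {\<one>}" "K n = H"
    "\<And>i. subgroup (K i) G" "\<And>i. K i \<subseteq> K (Suc i)" "\<And>i. K i \<subseteq> H"
    "\<And>i g h. \<lbrakk>g \<in> K (Suc i); h \<in> H\<rbrakk> \<Longrightarrow> commutator G g h \<in> K i"
    by (rule nilpotent_subgroupE[OF assms(1,2)]) (rule that)
  have "K i \<subseteq> L" for i
  proof (induction i)
    case 0 then show ?case using K by simp
  next
    case (Suc i)
    show ?case
    proof
      fix x assume x: "x \<in> K (Suc i)"
      then have xH: "x \<in> H" using K(5) by blast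
      have xG: "x \<in> carrier G" using xH assms(1) by (meson subgroup.mem_carrier)
      show "x \<in> L"
      proof (rule self_normalizing[OF xH])
        fix l assume l: "l \<in> L"
        have "conjugate G x l = commutator G x l \<otimes> l"
          using xG l by (simp add: commutator_def conjugate_def m_assoc)
        moreover have "commutator G x l \<in> L" using K(6)[OF x] l assms(4) Suc by blast
        ultimately show "conjugate G x l \<in> L" using l by simp
      qed
    qed
  qed
  then show ?thesis using K(2) assms(4) by blast
qed

lemma pow_mult_commute_factor:
  assumes "x \<in> carrier G" "y \<in> carrier G" "z \<in> carrier G"
    and "\<And>g. g \<in> carrier G \<Longrightarrow> z \<otimes> g = g \<otimes> z" and "x \<otimes> y = z \<otimes> y \<otimes> x"
  shows "x [^] (n::nat) \<otimes> y = z [^] n \<otimes> y \<otimes> x [^] n"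
proof (induction n)
  case 0 then show ?case using assms by simp
next
  case (Suc n)
  have "x [^] Suc n \<otimes> y = (x [^] n \<otimes> z) \<otimes> (y \<otimes> x)"
    using assms(1-3,5) by (simp add: m_assoc)
  also have "x [^] n \<otimes> z = z \<otimes> x [^] n" using assms(1,4) by simp
  also have "z \<otimes> x [^] n \<otimes> (y \<otimes> x) = z \<otimes> (x [^] n \<otimes> y) \<otimes> x"
    using assms(1-3) by (simp add: m_assoc)
  also have "\<dots> = (z \<otimes> z [^] n) \<otimes> y \<otimes> (x [^] n \<otimes> x)"
    unfolding Suc using assms(1-3) by (simp add: m_assoc)
  also have "z \<otimes> z [^] n = z [^] Suc n" using assms(3) nat_pow_Suc2 by simp
  finally show ?case using assms by simp
qed

text \<open>
  A central commutator is multiplicative in each argument: \<open>x\<^sup>n y = z\<^sup>n y x\<^sup>n\<close> gives \<open>z\<^sup>n = \<one>\<close>, and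
  the symmetric argument gives \<open>z\<^sup>m = \<one>\<close>.
\<close>

lemma central_commutator_eq_one:
  assumes xyz: "x \<in> carrier G" "y \<in> carrier G" "z \<in> carrier G"
    and central: "\<And>g. g \<in> carrier G \<Longrightarrow> z \<otimes> g = g \<otimes> z" and "x \<otimes> y = z \<otimes> y \<otimes> x"
    and pow: "x [^] (n::nat) = \<one>" "y [^] (m::nat) = \<one>" "coprime n m"
  shows "z = \<one>"
proof (rule pow_coprime_eq_one[OF xyz(3) _ _ pow(3)])
  show "z [^] n = \<one>"
    using pow_mult_commute_factor[OF xyz central assms(5), of n] pow(1) xyz
    by simp
  have "y \<otimes> x = inv z \<otimes> x \<otimes> y"
    using assms(5) xyz by (simp add: m_assoc)
  moreover have "inv z \<otimes> g = g \<otimes> inv z" if "g \<in> carrier G" for g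
    using commute_inv[OF xyz(3) that central[OF that]] .
  ultimately have "y [^] m \<otimes> x = inv z [^] m \<otimes> x \<otimes> y [^] m"
    using xyz by (intro pow_mult_commute_factor) auto
  then have "inv z [^] m = \<one>" using pow(2) xyz by simp
  then show "z [^] m = \<one>" using xyz by (simp add: nat_pow_inv)
qed

text \<open>
  If the commutator of \<open>x\<close> and \<open>y\<close> lies in some term of the upper central series, it is central
  modulo the term before, hence trivial there. So it descends through the series to \<open>\<one>\<close>.
\<close>

lemma nilpotent_coprime_commute:
  assumes "nilpotent_group G" "x \<in> carrier G" "y \<in> carrier G"
    and "x [^] (n::nat) = \<one>" "y [^] (m::nat) = \<one>" "coprime n m"
  shows "x \<otimes> y = y \<otimes> x"
proof -
  have step: "commutator G x y \<in> upper_central_series G i"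
    if z: "commutator G x y \<in> upper_central_series G (Suc i)" for i
  proof -
    let ?U = "upper_central_series G i" and ?z = "commutator G x y"
    interpret U: normal ?U G by (rule upper_central_series_normal)
    interpret Q: group "G Mod ?U" by (rule U.factorgroup_is_group)
    have zc: "?z \<in> carrier G" using assms by simp
    have Qc: "?U #> g \<in> carrier (G Mod ?U)" if "g \<in> carrier G" for g
      using that by (auto simp: carrier_FactGroup)
    have "?U #> ?z = \<one>\<^bsub>G Mod ?U\<^esub>"
    proof (rule Q.central_commutator_eq_one[of "?U #> x" "?U #> y" "?U #> ?z" n m])
      show "(?U #> ?z) \<otimes>\<^bsub>G Mod ?U\<^esub> g = g \<otimes>\<^bsub>G Mod ?U\<^esub> (?U #> ?z)" if "g \<in> carrier (G Mod ?U)" for g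
        using z that by (simp add: group_center_def)
      show "(?U #> x) \<otimes>\<^bsub>G Mod ?U\<^esub> (?U #> y)
          = (?U #> ?z) \<otimes>\<^bsub>G Mod ?U\<^esub> (?U #> y) \<otimes>\<^bsub>G Mod ?U\<^esub> (?U #> x)"
        using assms(2,3) by (simp add: U.rcos_sum flip: commutator_mult)
    qed (use assms Qc zc U.FactGroup_pow in \<open>simp_all add: U.subset\<close>)
    then show ?thesis using coset_join1[OF _ zc U.subgroup_axioms] by simp
  qed
  obtain c where c: "upper_central_series G c = carrier G"
    using assms(1) by (auto simp: nilpotent_group_def)
  have "commutator G x y \<in> upper_central_series G i \<Longrightarrow> commutator G x y \<in> upper_central_series G 0" for i
    by (induction i) (use step in blast)+
  from this[of c] have "commutator G x y = \<one>" using assms c by simp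
  then show ?thesis using assms by (simp add: commutator_eq_one_iff)
qed

text \<open>
  The class equation: conjugacy orbits have \<open>p\<close>-power size.
\<close>

lemma p_group_center_nontrivial:
  assumes "prime p" "order G = p ^ k" "k > 0"
  obtains z where "z \<in> carrier G" "z \<noteq> \<one>" "\<And>g. g \<in> carrier G \<Longrightarrow> z \<otimes> g = g \<otimes> z"
proof (rule ccontr)
  note witness = that
  assume no: "\<not> thesis"
  define act where "act = (\<lambda>g. \<lambda>h\<in>carrier G. g \<otimes> h \<otimes> inv g)"
  interpret A: group_action G "carrier G" act
    unfolding act_def by (rule action_by_conjugation)
  let ?O = "orbits G (carrier G) act"
  have fin: "finite (carrier G)"
    using assms by (metis card.infinite order_def power_not_zero prime_gt_0_nat less_numeral_extra(3))
  have orbit_carrier: "orbit G act x \<subseteq> carrier G" if "x \<in> carrier G" for x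
    using that by (auto simp: orbit_def act_def)
  \<comment> \<open>With a trivial centre, the identity would be the only element with a one-point orbit, and the
    class equation would make \<open>p ^ k\<close> congruent to 1 modulo \<open>p\<close>.\<close>
  have orbit_one: "orbit G act \<one> = {\<one>}"
    by (auto simp: orbit_def act_def intro!: exI[of _ \<one>])
  have dvd: "p dvd card (orbit G act x)" if x: "x \<in> carrier G" "x \<noteq> \<one>" for x
  proof -
    have "card (orbit G act x) dvd p ^ k"
      using A.orbit_stabilizer_theorem[OF x(1)] assms(2) by (metis dvd_triv_left)
    then obtain i where i: "card (orbit G act x) = p ^ i"
      using divides_primepow_nat[OF assms(1)] by blast
    have "i \<noteq> 0"
    proof
      assume "i = 0"
      then obtain y where y: "orbit G act x = {y}" using i by (auto simp: card_1_singleton_iff)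
      have mem: "g \<otimes> x \<otimes> inv g \<in> orbit G act x" if "g \<in> carrier G" for g
        using that x by (auto simp: orbit_def act_def)
      from mem[of \<one>] y x have "y = x" by simp
      then have "g \<otimes> x \<otimes> inv g = x" if "g \<in> carrier G" for g using mem[OF that] y by simp
      then have "x \<otimes> g = g \<otimes> x" if "g \<in> carrier G" for g
        using that x by (metis inv_solve_right' m_closed)
      with no witness[OF x] show False by simp
    qed
    then show ?thesis using i by simp
  qed
  have "card (carrier G) = sum card ?O"
    using A.disjoint_sum[OF fin, of "\<lambda>_. 1 :: nat"] by simp
  moreover have "{\<one>} \<in> ?O"
    using orbit_one by (force simp: orbits_def)
  moreover have "finite ?O"
    using fin by (simp add: orbits_def)
  ultimately have "card (carrier G) = 1 + sum card (?O - {{\<one>}})"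
    by (simp add: sum.remove)
  moreover have "p dvd sum card (?O - {{\<one>}})"
  proof (rule dvd_sum)
    fix X assume "X \<in> ?O - {{\<one>}}"
    then obtain x where "x \<in> carrier G" "X = orbit G act x" "X \<noteq> {\<one>}" by (auto simp: orbits_def)
    then show "p dvd card X" using dvd orbit_one by blast
  qed
  moreover have "p dvd card (carrier G)" using assms by (simp add: order_def)
  ultimately have "p dvd 1" by (metis dvd_add_left_iff)
  then show False using assms(1) by simp
qed

text \<open>
  As long as the upper central series has not reached the group, the quotient by its current term is
  a nontrivial \<open>p\<close>-group, whose centre enlarges that term.
\<close>

lemma p_group_nilpotent:
  assumes "prime p" "order G = p ^ k"
  shows "nilpotent_group G"
proof -
  let ?Z = "upper_central_series G"
  have fin: "finite (carrier G)"
    using assms by (metis card.infinite order_def power_not_zero prime_gt_0_nat less_numeral_extra(3))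
  have grow: "\<exists>g \<in> ?Z (Suc i). g \<notin> ?Z i"
    if ne: "?Z i \<noteq> carrier G" for i
  proof -
    let ?U = "?Z i"
    interpret U: normal ?U G by (rule upper_central_series_normal)
    interpret Q: group "G Mod ?U" by (rule U.factorgroup_is_group)
    have "order (G Mod ?U) * card ?U = p ^ k"
      using lagrange[OF U.subgroup_axioms] assms by (simp add: order_def FactGroup_def)
    moreover have "order (G Mod ?U) \<noteq> 1"
    proof
      assume "order (G Mod ?U) = 1"
      then have "card ?U = order G" using calculation assms by simp
      then show False using ne U.subset fin by (metis card_subset_eq order_def)
    qed
    ultimately obtain j where j: "order (G Mod ?U) = p ^ j" "j > 0"
      using divides_primepow_nat[OF assms(1)] by (metis dvd_triv_left gr0I power_0)
    obtain Z where Z: "Z \<in> carrier (G Mod ?U)" "Z \<noteq> \<one>\<^bsub>G Mod ?U\<^esub>"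
      "\<And>X. X \<in> carrier (G Mod ?U) \<Longrightarrow> Z \<otimes>\<^bsub>G Mod ?U\<^esub> X = X \<otimes>\<^bsub>G Mod ?U\<^esub> Z"
      using Q.p_group_center_nontrivial[OF assms(1) j] by blast
    then obtain g where g: "g \<in> carrier G" "Z = ?U #> g" by (auto simp: carrier_FactGroup)
    have "?U #> g \<in> group_center (G Mod ?U)"
      unfolding group_center_def using Z g by blast
    then have "g \<in> ?Z (Suc i)" using g by simp
    moreover have "g \<notin> ?U" using Z g coset_join2[OF g(1) U.subgroup_axioms] by auto
    ultimately show ?thesis by blast
  qed
  have sub: "?Z i \<subseteq> carrier G" for i
    using normal_imp_subgroup[OF upper_central_series_normal] by (rule subgroup.subset)
  have "?Z i = carrier G \<or> i < card (?Z i)" for i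
  proof (induction i)
    case 0 then show ?case by simp
  next
    case (Suc i)
    show ?case
    proof (cases "?Z i = carrier G")
      case True then show ?thesis using upper_central_series_mono sub by blast
    next
      case False
      then have "?Z i \<subset> ?Z (Suc i)"
        using grow upper_central_series_mono by blast
      then have "card (?Z i) < card (?Z (Suc i))"
        using sub fin by (meson finite_subset psubset_card_mono)
      then show ?thesis using Suc False by simp
    qed
  qed
  from this[of "order G"] have "?Z (order G) = carrier G"
    using sub fin card_mono[OF fin sub] by (metis order_def leD)
  then show ?thesis unfolding nilpotent_group_def by auto
qed

end

section \<open>Hall subgroups of finite nilpotent groups\<close>

lemma prime_factors_disjoint_coprime:
  fixes n m :: nat
  assumes "n > 0" "m > 0" "prime_factors n \<inter> prime_factors m = {}"
  shows "coprime n m"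
proof (rule ccontr)
  assume "\<not> coprime n m"
  then obtain p where "prime p" "p dvd gcd n m"
    by (metis coprime_iff_gcd_eq_1 prime_factor_nat)
  then show False using assms by (auto simp: in_prime_factors_iff)
qed

lemma prime_factors_split:
  fixes n :: nat
  assumes "n > 0"
  shows "\<exists>s t. n = s * t \<and> prime_factors s \<subseteq> S \<and> prime_factors t \<subseteq> - S"
  using assms
proof (induction n rule: less_induct)
  case (less n)
  show ?case
  proof (cases "n = 1")
    case True
    then have "n = 1 * 1 \<and> prime_factors (1::nat) \<subseteq> S \<and> prime_factors (1::nat) \<subseteq> - S" by simp
    then show ?thesis by blast
  next
    case False
    then obtain p where p: "prime p" "p dvd n" using prime_factor_nat by blast
    then obtain m where m: "n = p * m" by blast
    have "m > 0" "m < n" using less.prems prime_gt_1_nat[OF p(1)] m by auto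
    then obtain s t where st: "m = s * t" "prime_factors s \<subseteq> S" "prime_factors t \<subseteq> - S"
      using less.IH by blast
    have nz: "s \<noteq> 0" "t \<noteq> 0" "p \<noteq> 0" using \<open>m > 0\<close> st p by auto
    have eqs: "prime_factors (p * s) = insert p (prime_factors s)"
      "prime_factors (p * t) = insert p (prime_factors t)"
      using nz p by (simp_all add: prime_factors_product prime_prime_factors)
    show ?thesis
    proof (cases "p \<in> S")
      case True
      have "n = (p * s) * t \<and> prime_factors (p * s) \<subseteq> S \<and> prime_factors t \<subseteq> - S"
        using m st eqs(1) True by simp
      then show ?thesis by blast
    next
      case False
      have "n = s * (p * t) \<and> prime_factors s \<subseteq> S \<and> prime_factors (p * t) \<subseteq> - S"
        using m st eqs(2) False by simp
      then show ?thesis by blast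
    qed
  qed
qed

text \<open>
  The elements whose order involves only primes in \<open>S\<close>. Asking for some exponent instead of the
  order makes the notion pass to homomorphic images at once.
\<close>

definition pi_elements :: "('a, 'b) monoid_scheme \<Rightarrow> nat set \<Rightarrow> 'a set"
  where "pi_elements G S =
    {x \<in> carrier G. \<exists>n > 0. x [^]\<^bsub>G\<^esub> (n::nat) = \<one>\<^bsub>G\<^esub> \<and> prime_factors n \<subseteq> S}"

context group
begin

lemma pi_elementsI:
  "\<lbrakk>x \<in> carrier G; n > 0; x [^] (n::nat) = \<one>; prime_factors n \<subseteq> S\<rbrakk> \<Longrightarrow> x \<in> pi_elements G S"
  by (auto simp: pi_elements_def)

lemma pi_elementsE:
  assumes "x \<in> pi_elements G S"
  obtains n :: nat where "x \<in> carrier G" "n > 0" "x [^] n = \<one>" "prime_factors n \<subseteq> S"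
  using assms by (auto simp: pi_elements_def)

lemma pi_elements_carrier: "pi_elements G S \<subseteq> carrier G"
  by (auto simp: pi_elements_def)

lemma pi_elements_mono: "S \<subseteq> T \<Longrightarrow> pi_elements G S \<subseteq> pi_elements G T"
  by (fastforce simp: pi_elements_def)

lemma one_in_pi_elements: "\<one> \<in> pi_elements G S"
  by (rule pi_elementsI[of _ 1]) auto

lemma pi_elements_disjoint:
  assumes "x \<in> pi_elements G S" "x \<in> pi_elements G T" "S \<inter> T = {}"
  shows "x = \<one>"
proof -
  obtain n :: nat where n: "x \<in> carrier G" "n > 0" "x [^] n = \<one>" "prime_factors n \<subseteq> S"
    using assms(1) by (rule pi_elementsE)
  obtain m :: nat where m: "m > 0" "x [^] m = \<one>" "prime_factors m \<subseteq> T"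
    using assms(2) by (rule pi_elementsE)
  have "coprime n m" using n m assms(3) by (intro prime_factors_disjoint_coprime) auto
  then show ?thesis using pow_coprime_eq_one n m by blast
qed

lemma nilpotent_pi_elements_commute:
  assumes "nilpotent_group G" "x \<in> pi_elements G S" "y \<in> pi_elements G T" "S \<inter> T = {}"
  shows "x \<otimes> y = y \<otimes> x"
proof -
  obtain n :: nat where n: "x \<in> carrier G" "n > 0" "x [^] n = \<one>" "prime_factors n \<subseteq> S"
    using assms(2) by (rule pi_elementsE)
  obtain m :: nat where m: "y \<in> carrier G" "m > 0" "y [^] m = \<one>" "prime_factors m \<subseteq> T"
    using assms(3) by (rule pi_elementsE)
  have "coprime n m" using n m assms(4) by (intro prime_factors_disjoint_coprime) auto
  then show ?thesis using nilpotent_coprime_commute[OF assms(1) n(1) m(1) n(3) m(3)] by blast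
qed

lemma pi_elements_conjugate:
  assumes "x \<in> pi_elements G S" "g \<in> carrier G"
  shows "conjugate G g x \<in> pi_elements G S"
proof -
  obtain n :: nat where n: "x \<in> carrier G" "n > 0" "x [^] n = \<one>" "prime_factors n \<subseteq> S"
    using assms(1) by (rule pi_elementsE)
  have "conjugate G g x [^] n = \<one>" using n assms(2) by (simp flip: conjugate_pow)
  then show ?thesis using n assms(2) by (intro pi_elementsI[of _ n]) auto
qed

lemma pi_elements_mult:
  assumes "x \<in> pi_elements G S" "y \<in> pi_elements G T" "x \<otimes> y = y \<otimes> x"
  shows "x \<otimes> y \<in> pi_elements G (S \<union> T)"
proof -
  obtain n :: nat where n: "x \<in> carrier G" "n > 0" "x [^] n = \<one>" "prime_factors n \<subseteq> S"
    using assms(1) by (rule pi_elementsE)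
  obtain m :: nat where m: "y \<in> carrier G" "m > 0" "y [^] m = \<one>" "prime_factors m \<subseteq> T"
    using assms(2) by (rule pi_elementsE)
  have "(x \<otimes> y) [^] (n * m) = x [^] (n * m) \<otimes> y [^] (m * n)"
    using pow_mult_distrib[OF assms(3) n(1) m(1), of "n * m"] by (simp add: mult.commute)
  also have "\<dots> = \<one>" using n m by (simp flip: nat_pow_pow)
  finally show ?thesis
    using n m by (intro pi_elementsI[of _ "n * m"]) (auto simp: prime_factors_product)
qed

lemma pow_card_subgroup:
  assumes "subgroup H G" "x \<in> H"
  shows "x [^] card H = \<one>"
proof -
  interpret H: group "G\<lparr>carrier := H\<rparr>" by (rule subgroup_carrier_update[OF assms(1)])
  show ?thesis
    using H.pow_order_eq_1[of x] assms(2) nat_pow_consistent[of x _ H]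
    by (simp add: order_def)
qed

text \<open>
  Lagrange's theorem in one direction, Cauchy's in the other.
\<close>

lemma subgroup_pi_elements_iff:
  assumes "finite (carrier G)" "subgroup H G"
  shows "H \<subseteq> pi_elements G S \<longleftrightarrow> prime_factors (card H) \<subseteq> S"
proof
  have "finite H" using subgroup.subset[OF assms(2)] assms(1) by (rule finite_subset)
  have "card H > 0" using subgroup.finite_imp_card_positive[OF assms(2,1)] .
  show "H \<subseteq> pi_elements G S" if "prime_factors (card H) \<subseteq> S"
    using pow_card_subgroup[OF assms(2)] \<open>card H > 0\<close> that subgroup.mem_carrier[OF assms(2)]
    by (intro subsetI pi_elementsI[of _ "card H"]) auto
  show "prime_factors (card H) \<subseteq> S" if sub: "H \<subseteq> pi_elements G S"
  proof
    fix q assume "q \<in> prime_factors (card H)"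
    then have q: "prime q" "q dvd card H" by auto
    interpret H: group "G\<lparr>carrier := H\<rparr>" by (rule subgroup_carrier_update[OF assms(2)])
    obtain m where "card H = q ^ 1 * m" using q(2) by auto
    \<comment> \<open>Sylow's theorem for the first power of \<open>q\<close> is Cauchy's theorem.\<close>
    then obtain Q where Q: "subgroup Q (G\<lparr>carrier := H\<rparr>)" "card Q = q ^ 1"
      using sylow_thm[OF q(1) H.group_axioms, of 1 m] \<open>finite H\<close> by (auto simp: order_def)
    have QG: "subgroup Q G" using incl_subgroup[OF assms(2) Q(1)] .
    have "\<not> Q \<subseteq> {\<one>}"
      using Q(2) q(1) card_mono[of "{\<one>}" Q] by (auto simp: prime_nat_iff)
    then obtain x where x: "x \<in> Q" "x \<noteq> \<one>" by blast
    have "x [^] q = \<one>" using pow_card_subgroup[OF QG x(1)] Q(2) by simp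
    then have "x \<in> pi_elements G {q}"
      using x(1) QG q(1) by (intro pi_elementsI[of _ q])
        (auto simp: prime_gt_0_nat prime_prime_factors dest: subgroup.mem_carrier)
    moreover have "x \<in> pi_elements G S"
      using sub x(1) subgroup.subset[OF Q(1)] by auto
    ultimately have "S \<inter> {q} \<noteq> {}" using pi_elements_disjoint x(2) by blast
    then show "q \<in> S" by blast
  qed
qed

text \<open>
  Both factors are powers of \<open>x\<close>, with exponents supplied by Bezout's identity for the \<open>S\<close>-part and
  the \<open>S\<close>-free part of the group order.
\<close>

lemma pi_elements_decompose:
  assumes "finite (carrier G)" "x \<in> carrier G"
  obtains u v where "u \<in> pi_elements G S" "v \<in> pi_elements G (- S)" "x = u \<otimes> v" "u \<otimes> v = v \<otimes> u"
proof -
  have "order G > 0" using assms(1) by (simp add: order_gt_0_iff_finite)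
  then obtain s t where st: "order G = s * t" "prime_factors s \<subseteq> S" "prime_factors t \<subseteq> - S"
    using prime_factors_split by blast
  have pos: "s > 0" "t > 0" using st(1) \<open>order G > 0\<close> by auto
  have "coprime s t" using st pos by (intro prime_factors_disjoint_coprime) auto
  then obtain i j where ij: "i * int s + j * int t = 1"
    by (metis bezout_int coprime_iff_gcd_eq_1 coprime_int_iff)
  let ?u = "x [^] (j * int t)" and ?v = "x [^] (i * int s)"
  have one: "x [^] (int s * int t) = \<one>"
    using pow_order_eq_1[OF assms(2)] st(1) by (metis int_pow_int of_nat_mult)
  have "?u [^] s = (x [^] (int s * int t)) [^] j"
    using assms(2) by (simp add: int_pow_pow ac_simps flip: int_pow_int)
  then have u: "?u [^] s = \<one>" using one by simp
  have "?v [^] t = (x [^] (int s * int t)) [^] i"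
    using assms(2) by (simp add: int_pow_pow ac_simps flip: int_pow_int)
  then have v: "?v [^] t = \<one>" using one by simp
  show thesis
  proof
    show "?u \<in> pi_elements G S" using pi_elementsI[OF _ pos(1) u st(2)] assms(2) by simp
    show "?v \<in> pi_elements G (- S)" using pi_elementsI[OF _ pos(2) v st(3)] assms(2) by simp
    show "x = ?u \<otimes> ?v" using assms(2) ij by (simp add: int_pow_mult add.commute flip: int_pow_mult)
    show "?u \<otimes> ?v = ?v \<otimes> ?u" using assms(2) by (simp add: add.commute flip: int_pow_mult)
  qed
qed

text \<open>
  In the quotient of the normaliser of \<open>P\<close> by \<open>P\<close>, the order of the image of \<open>y\<close> is a power of \<open>p\<close>
  and divides a number prime to \<open>p\<close>.
\<close>

lemma sylow_absorbs_normalizing: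
  assumes "finite (carrier G)" "prime p" "sylow_subgroup p P G"
    and y: "y \<in> pi_elements G {p}" and norm: "\<And>x. x \<in> P \<Longrightarrow> conjugate G y x \<in> P"
  shows "y \<in> P"
proof -
  have P: "subgroup P G" "card P = p ^ multiplicity p (order G)"
    using assms(3) by (auto simp: sylow_subgroup_def)
  have PG: "P \<subseteq> carrier G" using P(1) by (rule subgroup.subset)
  obtain n :: nat where n: "y \<in> carrier G" "n > 0" "y [^] n = \<one>" "prime_factors n \<subseteq> {p}"
    using y by (rule pi_elementsE)
  define N where "N = normalizer G P"
  have N: "subgroup N G" unfolding N_def using assms(1) PG by (rule subgroup_normalizer)
  have N_iff: "x \<in> N \<longleftrightarrow> x \<in> carrier G \<and> (\<forall>h\<in>P. conjugate G x h \<in> P)" for x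
    unfolding N_def by (rule normalizer_iff[OF assms(1) PG])
  have yN: "y \<in> N" using n norm by (simp add: N_iff)
  have PN: "P \<subseteq> N" using PG subgroup_conjugate[OF P(1)] by (auto simp: N_iff)
  let ?N = "G\<lparr>carrier := N\<rparr>"
  interpret N: group "?N" by (rule subgroup_carrier_update[OF N])
  have "P \<lhd> ?N"
    unfolding N.normal_inv_iff
  proof
    show "subgroup P ?N" using subgroup_incl[OF P(1) N PN] .
    have "conjugate ?N x h \<in> P" if "x \<in> N" "h \<in> P" for x h
      using that PN N_iff subgroup_carrier_update(3)[OF N, of x h] by auto
    then show "\<forall>x\<in>carrier ?N. \<forall>h\<in>P. x \<otimes>\<^bsub>?N\<^esub> h
        \<otimes>\<^bsub>?N\<^esub> inv\<^bsub>?N\<^esub> x \<in> P"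
      by (simp add: conjugate_def)
  qed
  then interpret P: normal P "?N" .
  let ?Q = "?N Mod P"
  interpret Q: group ?Q by (rule P.factorgroup_is_group)
  have ord: "order ?Q * card P = card N"
    using N.lagrange[OF P.subgroup_axioms] by (simp add: order_def FactGroup_def)
  have Npos: "card N > 0" using subgroup.finite_imp_card_positive[OF N assms(1)] .
  have dvd: "card N dvd order G" using lagrange[OF N] by (metis dvd_triv_right)
  have ord_pos: "order G > 0" using assms(1) by (simp add: order_gt_0_iff_finite)
  have "\<not> p dvd order ?Q"
  proof
    assume "p dvd order ?Q"
    then have "p ^ Suc (multiplicity p (order G)) dvd card N"
      unfolding ord[symmetric] P(2) power_Suc by (intro mult_dvd_mono) auto
    then have "p ^ Suc (multiplicity p (order G)) dvd order G" using dvd by (rule dvd_trans)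
    then have "Suc (multiplicity p (order G)) \<le> multiplicity p (order G)"
      using ord_pos assms(2) by (intro multiplicity_geI) (auto simp: prime_nat_iff)
    then show False by simp
  qed
  then have "coprime (order ?Q) n"
    using n(2,4) ord Npos by (intro prime_factors_disjoint_coprime) (auto intro: Nat.gr0I)
  moreover have yc: "P #>\<^bsub>?N\<^esub> y \<in> carrier ?Q"
    using yN by (auto simp: carrier_FactGroup)
  moreover have "(P #>\<^bsub>?N\<^esub> y) [^]\<^bsub>?Q\<^esub> order ?Q = \<one>\<^bsub>?Q\<^esub>"
    using Q.pow_order_eq_1[OF yc] .
  moreover have "(P #>\<^bsub>?N\<^esub> y) [^]\<^bsub>?Q\<^esub> n = \<one>\<^bsub>?Q\<^esub>"
    using P.FactGroup_pow[of y n] yN n(3) N.coset_mult_one[OF P.subset]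
    by (simp add: nat_pow_consistent[symmetric])
  ultimately have "P #>\<^bsub>?N\<^esub> y = P"
    using Q.pow_coprime_eq_one[OF yc] by simp
  then show "y \<in> P" using N.coset_join1[OF _ _ P.subgroup_axioms] yN by simp
qed

text \<open>
  Each term of the central series normalises \<open>P\<close>. For \<open>g\<close> one step further up and \<open>x \<in> P\<close>, the
  conjugate of \<open>x\<close> by \<open>g\<close> is \<open>x\<close> times a commutator from the term below. So it is a
  \<open>p\<close>-element that normalises \<open>P\<close>, and such elements lie in \<open>P\<close>. Once \<open>P\<close> is normalised by
  everything, it absorbs all \<open>p\<close>-elements.
\<close>

lemma nilpotent_sylow:
  assumes "finite (carrier G)" "nilpotent_group G" "prime p" "sylow_subgroup p P G"
  shows "P = pi_elements G {p}"
proof -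
  have P: "subgroup P G" "card P = p ^ multiplicity p (order G)"
    using assms(4) by (auto simp: sylow_subgroup_def)
  have PG: "P \<subseteq> carrier G" using P(1) by (rule subgroup.subset)
  have "prime_factors (card P) \<subseteq> {p}"
  proof
    fix q assume "q \<in> prime_factors (card P)"
    then have "prime q" "q dvd p ^ multiplicity p (order G)" unfolding P(2) by auto
    then show "q \<in> {p}" using assms(3) prime_dvd_power primes_dvd_imp_eq by blast
  qed
  then have sub: "P \<subseteq> pi_elements G {p}"
    by (rule iffD2[OF subgroup_pi_elements_iff[OF assms(1) P(1)]])
  obtain K n where K: "K 0 = {\<one>}" "K n = carrier G" "\<And>i. subgroup (K i) G"
    "\<And>i. K i \<subseteq> K (Suc i)"
    "\<And>i g h. \<lbrakk>g \<in> K (Suc i); h \<in> carrier G\<rbrakk> \<Longrightarrow> commutator G g h \<in> K i"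
    using assms(2) by (rule nilpotent_groupE) (rule that)
  have KG: "K i \<subseteq> carrier G" for i using K(3) by (rule subgroup.subset)
  have norm: "\<forall>g\<in>K i. \<forall>x\<in>P. conjugate G g x \<in> P" for i
  proof (induction i)
    case 0 then show ?case using K(1) PG by auto
  next
    case (Suc i)
    show ?case
    proof (intro ballI)
      fix g x assume g: "g \<in> K (Suc i)" and x: "x \<in> P"
      have gG: "g \<in> carrier G" and xG: "x \<in> carrier G" using g x KG PG by blast+
      let ?z = "commutator G g x"
      have z: "?z \<in> K i" using K(5)[OF g xG] .
      have eq: "conjugate G g x = ?z \<otimes> x"
        using gG xG by (simp add: commutator_def conjugate_def m_assoc)
      show "conjugate G g x \<in> P"
      proof (rule sylow_absorbs_normalizing[OF assms(1,3,4)])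
        show "conjugate G g x \<in> pi_elements G {p}"
          using pi_elements_conjugate sub x gG by blast
        show "conjugate G (conjugate G g x) w \<in> P" if "w \<in> P" for w
        proof -
          have "conjugate G (?z \<otimes> x) w = conjugate G ?z (conjugate G x w)"
            using gG xG that PG by (intro conjugate_conjugate) auto
          then show ?thesis
            using eq Suc z subgroup_conjugate[OF P(1) x that] by simp
        qed
      qed
    qed
  qed
  have "pi_elements G {p} \<subseteq> P"
    using sylow_absorbs_normalizing[OF assms(1,3,4)] norm[of n] K(2) pi_elements_carrier
    by (metis subsetD subsetI)
  then show ?thesis using sub by blast
qed

lemma nilpotent_sylow_pi_elements:
  assumes "finite (carrier G)" "nilpotent_group G" "prime p"
  shows "sylow_subgroup p (pi_elements G {p}) G"
proof -
  obtain m where "order G = p ^ multiplicity p (order G) * m"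
    using multiplicity_dvd by (metis dvd_def)
  then obtain P where "subgroup P G" "card P = p ^ multiplicity p (order G)"
    using sylow_thm[OF assms(3) group_axioms _ assms(1)] by metis
  then have "sylow_subgroup p P G" by (simp add: sylow_subgroup_def)
  then show ?thesis using nilpotent_sylow[OF assms] by simp
qed

lemma pi_elements_Int:
  assumes "x \<in> pi_elements G S" "x \<in> pi_elements G T"
  shows "x \<in> pi_elements G (S \<inter> T)"
proof -
  obtain n :: nat where n: "x \<in> carrier G" "n > 0" "x [^] n = \<one>" "prime_factors n \<subseteq> S"
    using assms(1) by (rule pi_elementsE)
  obtain m :: nat where m: "m > 0" "x [^] m = \<one>" "prime_factors m \<subseteq> T"
    using assms(2) by (rule pi_elementsE)
  have dvd: "ord x dvd n" "ord x dvd m" using n m by (simp_all add: pow_eq_id)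
  then have "prime_factors (ord x) \<subseteq> S \<inter> T"
    using n(2,4) m(1,3) dvd_prime_factors[of n "ord x"] dvd_prime_factors[of m "ord x"] by auto
  moreover have "ord x > 0" using dvd(1) n(2) by (auto intro: Nat.gr0I)
  ultimately show ?thesis using n(1) by (intro pi_elementsI[of _ "ord x"]) auto
qed

lemma pi_elements_inv: "x \<in> pi_elements G S \<Longrightarrow> inv x \<in> pi_elements G S"
  by (erule pi_elementsE) (auto simp: nat_pow_inv intro: pi_elementsI)

lemma pi_elements_factor:
  assumes "u \<in> pi_elements G S" "v \<in> pi_elements G T" "u \<otimes> v = v \<otimes> u"
    and "u \<otimes> v \<in> pi_elements G T'"
  shows "u \<in> pi_elements G (T \<union> T')"
proof -
  have c: "u \<in> carrier G" "v \<in> carrier G" using assms pi_elements_carrier by blast+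
  have "v \<otimes> (u \<otimes> v) = (u \<otimes> v) \<otimes> v" using assms(3) m_assoc[OF c(2,1,2)] by simp
  then have "inv v \<otimes> (u \<otimes> v) = (u \<otimes> v) \<otimes> inv v" using c by (intro commute_inv) simp_all
  then have "inv v \<otimes> (u \<otimes> v) \<in> pi_elements G (T \<union> T')"
    by (rule pi_elements_mult[OF pi_elements_inv[OF assms(2)] assms(4)])
  then show ?thesis using assms(3) c by simp
qed

text \<open>
  Elements of coprime order commute, so the \<open>S\<close>-elements can be assembled one prime at a time; this
  is how facts about Sylow subgroups are carried over to Hall subgroups.
\<close>

lemma nilpotent_pi_elements_insert:
  assumes "finite (carrier G)" "nilpotent_group G" "q \<notin> F"
  shows "pi_elements G (insert q F) = {u \<otimes> v | u v. u \<in> pi_elements G F \<and> v \<in> pi_elements G {q}}"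
proof (intro equalityI subsetI)
  fix x assume x: "x \<in> pi_elements G (insert q F)"
  then have xG: "x \<in> carrier G" using pi_elements_carrier by blast
  obtain u v where uv: "u \<in> pi_elements G F" "v \<in> pi_elements G (- F)" "x = u \<otimes> v" "u \<otimes> v = v \<otimes> u"
    using pi_elements_decompose[OF assms(1) xG] .
  have "v \<in> pi_elements G (F \<union> insert q F)"
    by (rule pi_elements_factor[OF uv(2,1) uv(4)[symmetric]]) (use x uv(3,4) in simp)
  then have "v \<in> pi_elements G ((F \<union> insert q F) \<inter> - F)"
    using uv(2) pi_elements_Int by simp
  moreover have "(F \<union> insert q F) \<inter> - F = {q}" using assms(3) by blast
  ultimately show "x \<in> {u \<otimes> v | u v. u \<in> pi_elements G F \<and> v \<in> pi_elements G {q}}"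
    using uv(1,3) by auto
next
  fix x assume "x \<in> {u \<otimes> v | u v. u \<in> pi_elements G F \<and> v \<in> pi_elements G {q}}"
  then obtain u v where uv: "x = u \<otimes> v" "u \<in> pi_elements G F" "v \<in> pi_elements G {q}" by blast
  have "u \<otimes> v = v \<otimes> u"
    using nilpotent_pi_elements_commute[OF assms(2) uv(2,3)] assms(3) by blast
  then have "u \<otimes> v \<in> pi_elements G (F \<union> {q})" by (rule pi_elements_mult[OF uv(2,3)])
  then show "x \<in> pi_elements G (insert q F)" using uv(1) by simp
qed

lemma pi_elements_Int_primes:
  assumes "finite (carrier G)"
  shows "pi_elements G (S \<inter> prime_factors (order G)) = pi_elements G S"
proof
  show "pi_elements G (S \<inter> prime_factors (order G)) \<subseteq> pi_elements G S"
    by (rule pi_elements_mono) blast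
  have "order G > 0" using assms by (simp add: order_gt_0_iff_finite)
  then have "x \<in> pi_elements G (prime_factors (order G))" if "x \<in> carrier G" for x
    using pi_elementsI[OF that _ pow_order_eq_1[OF that]] by blast
  then show "pi_elements G S \<subseteq> pi_elements G (S \<inter> prime_factors (order G))"
    using pi_elements_Int pi_elements_carrier by blast
qed

lemma pi_elements_nonprime:
  assumes "\<not> prime q"
  shows "pi_elements G {q} = {\<one>}"
proof -
  have "x = \<one>" if "x \<in> pi_elements G {q}" for x
  proof -
    obtain n :: nat where n: "x \<in> carrier G" "n > 0" "x [^] n = \<one>" "prime_factors n \<subseteq> {q}"
      using \<open>x \<in> pi_elements G {q}\<close> by (rule pi_elementsE)
    then have "prime_factors n = {}" using assms by (auto simp: in_prime_factors_iff)
    then have "n = 1" using n(2) by (simp add: prime_factorization_empty_iff)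
    then show ?thesis using n by simp
  qed
  then show ?thesis using one_in_pi_elements by blast
qed

lemma subgroup_commuting_product:
  assumes "subgroup H G" "subgroup K G" and comm: "\<And>h k. \<lbrakk>h \<in> H; k \<in> K\<rbrakk> \<Longrightarrow> h \<otimes> k = k \<otimes> h"
  shows "subgroup {h \<otimes> k | h k. h \<in> H \<and> k \<in> K} G"
proof -
  interpret H: subgroup H G by fact
  interpret K: subgroup K G by fact
  show ?thesis
  proof (rule subgroupI)
    show "{h \<otimes> k | h k. h \<in> H \<and> k \<in> K} \<noteq> {}" using H.one_closed K.one_closed by blast
  next
    fix a assume "a \<in> {h \<otimes> k | h k. h \<in> H \<and> k \<in> K}"
    then obtain h k where hk: "a = h \<otimes> k" "h \<in> H" "k \<in> K" by blast
    then have "inv a = inv h \<otimes> inv k"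
      using comm[of "inv h" "inv k"] by (simp add: inv_mult_group)
    then show "inv a \<in> {h \<otimes> k | h k. h \<in> H \<and> k \<in> K}" using hk by blast
  next
    fix a b assume "a \<in> {h \<otimes> k | h k. h \<in> H \<and> k \<in> K}" "b \<in> {h \<otimes> k | h k. h \<in> H \<and> k \<in> K}"
    then obtain h k h' k' where hk: "a = h \<otimes> k" "h \<in> H" "k \<in> K" "b = h' \<otimes> k'" "h' \<in> H" "k' \<in> K"
      by blast
    have "a \<otimes> b = h \<otimes> (k \<otimes> h') \<otimes> k'" using hk by (simp add: m_assoc)
    also have "k \<otimes> h' = h' \<otimes> k" using comm[OF hk(5,3)] by (rule sym)
    also have "h \<otimes> (h' \<otimes> k) \<otimes> k' = (h \<otimes> h') \<otimes> (k \<otimes> k')" using hk by (simp add: m_assoc)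
    finally show "a \<otimes> b \<in> {h \<otimes> k | h k. h \<in> H \<and> k \<in> K}" using hk by blast
  qed auto
qed

lemma nilpotent_subgroup_pi_elements:
  assumes "finite (carrier G)" "nilpotent_group G"
  shows "subgroup (pi_elements G S) G"
proof -
  have "subgroup (pi_elements G F) G" if "finite F" for F
    using that
  proof (induction F rule: finite_induct)
    case empty
    have "pi_elements G {} = {\<one>}"
      using pi_elements_disjoint one_in_pi_elements by blast
    then show ?case using triv_subgroup by simp
  next
    case (insert q F)
    have Q: "subgroup (pi_elements G {q}) G"
    proof (cases "prime q")
      case True
      then show ?thesis
        using nilpotent_sylow_pi_elements[OF assms] by (simp add: sylow_subgroup_def)
    qed (simp add: pi_elements_nonprime triv_subgroup)
    have comm: "u \<otimes> v = v \<otimes> u" if "u \<in> pi_elements G F" "v \<in> pi_elements G {q}" for u v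
      using nilpotent_pi_elements_commute[OF assms(2) that] insert.hyps by blast
    then show ?case
      unfolding nilpotent_pi_elements_insert[OF assms insert.hyps(2)]
      by (rule subgroup_commuting_product[OF insert.IH Q])
  qed
  from this[of "S \<inter> prime_factors (order G)"] show ?thesis
    using pi_elements_Int_primes[OF assms(1)] by simp
qed

section \<open>Products, images and preimages of nilpotent groups\<close>

lemma nilpotent_commuting_product:
  assumes "subgroup P G" "subgroup Q G" and comm: "\<And>u v. \<lbrakk>u \<in> P; v \<in> Q\<rbrakk> \<Longrightarrow> u \<otimes> v = v \<otimes> u"
    and "nilpotent_group (G\<lparr>carrier := P\<rparr>)" "nilpotent_group (G\<lparr>carrier := Q\<rparr>)"
  shows "nilpotent_group (G\<lparr>carrier := {u \<otimes> v | u v. u \<in> P \<and> v \<in> Q}\<rparr>)"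
proof -
  interpret P: subgroup P G by fact
  interpret Q: subgroup Q G by fact
  obtain K n where K: "K 0 = {\<one>}" "K n = P" "\<And>i. subgroup (K i) G" "\<And>i. K i \<subseteq> K (Suc i)"
    "\<And>i. K i \<subseteq> P" "\<And>i g h. \<lbrakk>g \<in> K (Suc i); h \<in> P\<rbrakk> \<Longrightarrow> commutator G g h \<in> K i"
    by (rule nilpotent_subgroupE[OF assms(1,4)]) (rule that)
  obtain L m where L: "L 0 = {\<one>}" "L m = Q" "\<And>i. subgroup (L i) G" "\<And>i. L i \<subseteq> L (Suc i)"
    "\<And>i. L i \<subseteq> Q" "\<And>i g h. \<lbrakk>g \<in> L (Suc i); h \<in> Q\<rbrakk> \<Longrightarrow> commutator G g h \<in> L i"
    by (rule nilpotent_subgroupE[OF assms(2,5)]) (rule that)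
  have top: "K (max n m) = P" "L (max n m) = Q"
    using lift_Suc_mono_le[of K n "max n m"] lift_Suc_mono_le[of L m "max n m"] K(2,4,5) L(2,4,5)
    by (metis max.cobounded1 subset_antisym, metis max.cobounded2 subset_antisym)
  show ?thesis
  proof (rule nilpotent_subgroupI[of _ "\<lambda>i. {u \<otimes> v | u v. u \<in> K i \<and> v \<in> L i}" "max n m"])
    show "subgroup {u \<otimes> v | u v. u \<in> P \<and> v \<in> Q} G"
      by (rule subgroup_commuting_product[OF assms(1,2) comm])
    show "{u \<otimes> v | u v. u \<in> K 0 \<and> v \<in> L 0} \<subseteq> {\<one>}" using K(1) L(1) by auto
    show "{u \<otimes> v | u v. u \<in> P \<and> v \<in> Q} \<subseteq> {u \<otimes> v | u v. u \<in> K (max n m) \<and> v \<in> L (max n m)}"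
      unfolding top by (rule subset_refl)
  next
    fix i g h
    assume "g \<in> {u \<otimes> v | u v. u \<in> K (Suc i) \<and> v \<in> L (Suc i)}" "h \<in> {u \<otimes> v | u v. u \<in> P \<and> v \<in> Q}"
    then obtain u v u' v' where g: "g = u \<otimes> v" "u \<in> K (Suc i)" "v \<in> L (Suc i)"
      and h: "h = u' \<otimes> v'" "u' \<in> P" "v' \<in> Q" by blast
    have uv: "u \<in> P" "v \<in> Q" using g K(5) L(5) by blast+
    have swap: "x \<otimes> (y \<otimes> z) = y \<otimes> (x \<otimes> z)" if "x \<in> Q" "y \<in> P" "z \<in> carrier G" for x y z
      using comm[OF that(2,1)] that P.mem_carrier Q.mem_carrier by (simp flip: m_assoc)
    have "commutator G g h = u \<otimes> (v \<otimes> (u' \<otimes> (v' \<otimes> (inv v \<otimes> (inv u \<otimes> (inv v' \<otimes> inv u'))))))"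
      unfolding commutator_def g h using uv h(2,3) by (simp add: m_assoc inv_mult_group)
    also have "inv v' \<otimes> inv u' = inv u' \<otimes> inv v'"
      using comm[of "inv u'" "inv v'"] h(2,3) by simp
    also have "u \<otimes> (v \<otimes> (u' \<otimes> (v' \<otimes> (inv v \<otimes> (inv u \<otimes> (inv u' \<otimes> inv v'))))))
        = (u \<otimes> u' \<otimes> inv u \<otimes> inv u') \<otimes> (v \<otimes> v' \<otimes> inv v \<otimes> inv v')"
      using uv h(2,3) by (simp add: m_assoc swap[of v u'] swap[of v "inv u"] swap[of v "inv u'"]
        swap[of v' "inv u"] swap[of v' "inv u'"] swap[of "inv v" "inv u"] swap[of "inv v" "inv u'"])
    finally have "commutator G g h = commutator G u u' \<otimes> commutator G v v'"
      by (simp add: commutator_def)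
    then show "commutator G g h \<in> {u \<otimes> v | u v. u \<in> K i \<and> v \<in> L i}"
      using K(6)[OF g(2) h(2)] L(6)[OF g(3) h(3)] by blast
  qed
qed

lemma nilpotent_subgroup_p_group:
  assumes "finite (carrier G)" "prime p" "subgroup P G" "P \<subseteq> pi_elements G {p}"
  shows "nilpotent_group (G\<lparr>carrier := P\<rparr>)"
proof -
  interpret P: group "G\<lparr>carrier := P\<rparr>" by (rule subgroup_carrier_update[OF assms(3)])
  have pos: "card P > 0" using subgroup.finite_imp_card_positive[OF assms(3,1)] .
  have sub: "prime_factors (card P) \<subseteq> {p}"
    by (rule iffD1[OF subgroup_pi_elements_iff[OF assms(1,3)] assms(4)])
  have "card P = p ^ multiplicity p (card P)"
  proof (cases "p \<in> prime_factors (card P)")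
    case True
    then have eq: "prime_factors (card P) = {p}" using sub by blast
    have "card P = (\<Prod>q\<in>prime_factors (card P). q ^ multiplicity q (card P))"
      by (rule prime_factorization_nat[OF pos])
    also have "\<dots> = (\<Prod>q\<in>{p}. q ^ multiplicity q (card P))" by (simp only: eq)
    finally show ?thesis by simp
  next
    case False
    then have "prime_factors (card P) = {}" using sub by blast
    then have "card P = 1" using pos by (simp add: prime_factorization_empty_iff)
    then show ?thesis by simp
  qed
  then show ?thesis by (intro P.p_group_nilpotent[OF assms(2)]) (simp add: order_def)
qed

end

context group_hom
begin

lemma hom_pi_elements: "x \<in> pi_elements G S \<Longrightarrow> h x \<in> pi_elements H S"
  by (auto simp: pi_elements_def simp flip: hom_nat_pow)

lemma hom_commutator:
  "\<lbrakk>x \<in> carrier G; y \<in> carrier G\<rbrakk> \<Longrightarrow> h (commutator G x y) = commutator H (h x) (h y)"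
  by (simp add: commutator_def)

lemma hom_conjugate:
  "\<lbrakk>x \<in> carrier G; y \<in> carrier G\<rbrakk> \<Longrightarrow> h (conjugate G x y) = conjugate H (h x) (h y)"
  by (simp add: conjugate_def)

lemma nilpotent_image:
  assumes "subgroup L G" "nilpotent_group (G\<lparr>carrier := L\<rparr>)"
  shows "nilpotent_group (H\<lparr>carrier := h ` L\<rparr>)"
proof -
  obtain K n where K: "K 0 = {\<one>}" "K n = L" "\<And>i. subgroup (K i) G" "\<And>i. K i \<subseteq> K (Suc i)"
    "\<And>i. K i \<subseteq> L" "\<And>i x y. \<lbrakk>x \<in> K (Suc i); y \<in> L\<rbrakk> \<Longrightarrow> commutator G x y \<in> K i"
    by (rule G.nilpotent_subgroupE[OF assms]) (rule that)
  show ?thesis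
  proof (rule H.nilpotent_subgroupI[of _ "\<lambda>i. h ` K i" n])
    show "subgroup (h ` L) H" by (rule subgroup_img_is_subgroup[OF assms(1)])
    show "commutator H x y \<in> h ` K i" if xy: "x \<in> h ` K (Suc i)" "y \<in> h ` L" for i x y
    proof -
      obtain a b where ab: "a \<in> K (Suc i)" "x = h a" "b \<in> L" "y = h b" using xy by blast
      have "a \<in> carrier G" "b \<in> carrier G"
        using ab K(5) assms(1) subgroup.mem_carrier by fast+
      then show ?thesis using K(6)[OF ab(1,3)] ab hom_commutator by (metis imageI)
    qed
  qed (use K(1,2) in auto)
qed

lemma nilpotent_if_inj_image:
  assumes "subgroup L G" "inj_on h L" "nilpotent_group (H\<lparr>carrier := h ` L\<rparr>)"
  shows "nilpotent_group (G\<lparr>carrier := L\<rparr>)"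
proof -
  have sub: "subgroup (h ` L) H" by (rule subgroup_img_is_subgroup[OF assms(1)])
  obtain K n where K: "K 0 = {\<one>\<^bsub>H\<^esub>}" "K n = h ` L" "\<And>i. subgroup (K i) H" "\<And>i. K i \<subseteq> K (Suc i)"
    "\<And>i. K i \<subseteq> h ` L" "\<And>i x y. \<lbrakk>x \<in> K (Suc i); y \<in> h ` L\<rbrakk> \<Longrightarrow> commutator H x y \<in> K i"
    by (rule H.nilpotent_subgroupE[OF sub assms(3)]) (rule that)
  show ?thesis
  proof (rule G.nilpotent_subgroupI[OF assms(1), of "\<lambda>i. {x \<in> L. h x \<in> K i}" n])
    have "x = \<one>" if "x \<in> L" "h x = \<one>\<^bsub>H\<^esub>" for x
      using inj_onD[OF assms(2), of x \<one>] that subgroup.one_closed[OF assms(1)] by simp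
    then show "{x \<in> L. h x \<in> K 0} \<subseteq> {\<one>}" using K(1) by blast
    show "commutator G x y \<in> {x \<in> L. h x \<in> K i}"
      if xy: "x \<in> {x \<in> L. h x \<in> K (Suc i)}" "x \<in> L" "y \<in> L" for i x y
    proof -
      have "x \<in> carrier G" "y \<in> carrier G" using xy assms(1) subgroup.mem_carrier by fast+
      then show ?thesis
        using xy K(6)[of "h x" i "h y"] hom_commutator G.subgroup_commutator[OF assms(1)] by simp
    qed
    show "L \<subseteq> {x \<in> L. h x \<in> K n}" using K(2) by blast
  qed
qed

end

section \<open>Cocycles of coprime order\<close>

text \<open>
  Averaging: the product \<open>s\<close> of all values of \<open>\<delta>\<close> satisfies \<open>s = \<delta> h [^] |H| \<otimes> act h s\<close>, and \<open>|H|\<close> can be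
  divided out because it is prime to \<open>|G|\<close>. As each \<open>act h\<close> is merely an endomorphism,
  this covers cocycles twisted by an endomorphism of \<open>H\<close>. The lemma yields the conjugacy of
  complements of \<open>G\<close> as well as the lifting of \<open>H\<close>-fixed points from a quotient by \<open>G\<close>.
\<close>

lemma (in comm_group) cocycle_is_coboundary:
  fixes H (structure) and act :: "'h \<Rightarrow> 'a \<Rightarrow> 'a"
  assumes "group H" "finite (carrier H)" "finite (carrier G)" "coprime (order H) (order G)"
    and act: "\<And>h. h \<in> carrier H \<Longrightarrow> act h \<in> hom G G"
    and \<delta>: "\<And>h. h \<in> carrier H \<Longrightarrow> \<delta> h \<in> carrier G"
    and cocycle: "\<And>h k. \<lbrakk>h \<in> carrier H; k \<in> carrier H\<rbrakk> \<Longrightarrow> \<delta> (h \<otimes>\<^bsub>H\<^esub> k) = \<delta> h \<otimes>\<^bsub>G\<^esub> act h (\<delta> k)"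
  obtains a where "a \<in> carrier G" "\<And>h. h \<in> carrier H \<Longrightarrow> \<delta> h \<otimes>\<^bsub>G\<^esub> act h a = a"
proof -
  interpret H: group H by fact
  define s where "s = finprod G \<delta> (carrier H)"
  have sG: "s \<in> carrier G" unfolding s_def using \<delta> by (intro finprod_closed) auto
  have sum: "s = \<delta> h [^]\<^bsub>G\<^esub> order H \<otimes>\<^bsub>G\<^esub> act h s" if h: "h \<in> carrier H" for h
  proof -
    have "group_hom G G (act h)" using act[OF h] by unfold_locales
    interpret A: group_hom G G "act h" by fact
    have act_prod: "act h (finprod G \<delta> X) = finprod G (\<lambda>k. act h (\<delta> k)) X"
      if "finite X" "X \<subseteq> carrier H" for X
      using that
    proof (induction X rule: finite_induct)
      case empty then show ?case by simp
    next
      case (insert x F)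
      have d: "\<delta> \<in> F \<rightarrow> carrier G" "\<delta> x \<in> carrier G" using insert.prems \<delta> by auto
      have "act h (finprod G \<delta> (insert x F)) = act h (\<delta> x) \<otimes>\<^bsub>G\<^esub> act h (finprod G \<delta> F)"
        using insert.hyps d by simp
      also have "\<dots> = finprod G (\<lambda>k. act h (\<delta> k)) (insert x F)"
        using insert d by (subst finprod_insert) (auto simp: subset_iff \<delta>)
      finally show ?case .
    qed
    have "s = finprod G (\<lambda>k. \<delta> (h \<otimes>\<^bsub>H\<^esub> k)) (carrier H)"
      unfolding s_def using finprod_reindex[of \<delta> "\<lambda>k. h \<otimes>\<^bsub>H\<^esub> k" "carrier H"]
      by (simp add: H.surj_const_mult[OF h] H.inj_on_cmult[OF h] \<delta> Pi_def)
    also have "\<dots> = finprod G (\<lambda>k. \<delta> h \<otimes>\<^bsub>G\<^esub> act h (\<delta> k)) (carrier H)"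
      using cocycle[OF h] \<delta> h by (intro finprod_cong') auto
    also have "\<dots> = finprod G (\<lambda>k. \<delta> h) (carrier H) \<otimes>\<^bsub>G\<^esub> finprod G (\<lambda>k. act h (\<delta> k)) (carrier H)"
      using \<delta> h by (intro finprod_multf) auto
    also have "finprod G (\<lambda>k. \<delta> h) (carrier H) = \<delta> h [^]\<^bsub>G\<^esub> order H"
      using \<delta>[OF h] by (simp add: finprod_const order_def)
    also have "finprod G (\<lambda>k. act h (\<delta> k)) (carrier H) = act h s"
      unfolding s_def using act_prod[OF assms(2)] by simp
    finally show ?thesis .
  qed
  obtain i j where ij: "i * int (order H) + j * int (order G) = 1"
    using assms(4) by (metis bezout_int coprime_iff_gcd_eq_1 coprime_int_iff)
  have inv_order: "x [^]\<^bsub>G\<^esub> (i * int (order H)) = x" if x: "x \<in> carrier G" for x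
  proof -
    have "x [^]\<^bsub>G\<^esub> (int (order G) * j) = \<one>\<^bsub>G\<^esub>"
      using pow_order_eq_1[OF x] x by (simp add: int_pow_int flip: int_pow_pow)
    then have "x [^]\<^bsub>G\<^esub> (i * int (order H)) = x [^]\<^bsub>G\<^esub> (i * int (order H) + j * int (order G))"
      using x by (simp add: int_pow_mult mult.commute)
    then show ?thesis using ij x by simp
  qed
  \<comment> \<open>Since \<open>i\<close> inverts \<open>order H\<close> modulo \<open>order G\<close>, the power \<open>s [^] i\<close> is the average of the cocycle.\<close>
  have "\<delta> h \<otimes>\<^bsub>G\<^esub> act h (s [^]\<^bsub>G\<^esub> i) = s [^]\<^bsub>G\<^esub> i" if h: "h \<in> carrier H" for h
  proof -
    have "group_hom G G (act h)" using act[OF h] by unfold_locales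
    interpret A: group_hom G G "act h" by fact
    have "s [^]\<^bsub>G\<^esub> i = (\<delta> h [^]\<^bsub>G\<^esub> order H) [^]\<^bsub>G\<^esub> i \<otimes>\<^bsub>G\<^esub> act h s [^]\<^bsub>G\<^esub> i"
      using sum[OF h] \<delta>[OF h] sG by (metis A.hom_closed int_pow_distrib nat_pow_closed)
    also have "(\<delta> h [^]\<^bsub>G\<^esub> order H) [^]\<^bsub>G\<^esub> i = \<delta> h"
      using inv_order[OF \<delta>[OF h]] \<delta>[OF h] by (simp add: int_pow_pow mult.commute flip: int_pow_int)
    also have "act h s [^]\<^bsub>G\<^esub> i = act h (s [^]\<^bsub>G\<^esub> i)" using sG by (simp add: A.hom_int_pow)
    finally show ?thesis by simp
  qed
  then show thesis using that[of "s [^]\<^bsub>G\<^esub> i"] sG by simp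
qed

section \<open>Skew braces, ideals and the socle\<close>

text \<open>
  The map \<open>\<lambda>\<^sub>a\<close> without the restriction to the carrier, which is only in the way in calculations.
\<close>

definition lam :: "('a, 'b) ring_scheme \<Rightarrow> 'a \<Rightarrow> 'a \<Rightarrow> 'a"
  where "lam B a b = (\<ominus>\<^bsub>B\<^esub> a) \<oplus>\<^bsub>B\<^esub> (a \<otimes>\<^bsub>B\<^esub> b)"

sublocale skew_brace \<subseteq> group B
  by (rule mult_group)

sublocale skew_brace \<subseteq> add: group "add_monoid B"
  rewrites "carrier (add_monoid B) = carrier B"
    and "mult (add_monoid B) = add B"
    and "one (add_monoid B) = zero B"
    and "m_inv (add_monoid B) = a_inv B"
  using add_group by (simp_all add: a_inv_def)

context skew_brace
begin

lemma lambda_map_eq: "b \<in> carrier B \<Longrightarrow> lambda_map B a b = lam B a b"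
  by (simp add: lambda_map_def lam_def)

lemma zero_eq_one: "\<zero> = \<one>"
proof -
  have "\<one> \<otimes> (\<zero> \<oplus> \<zero>) = ((\<one> \<otimes> \<zero>) \<ominus> \<one>) \<oplus> (\<one> \<otimes> \<zero>)"
    by (rule brace_law) simp_all
  then have "\<ominus> \<one> = \<zero>" by (simp add: a_minus_def)
  then show ?thesis by (metis add.inv_inv add.inv_one one_closed)
qed

lemma lam_closed [simp]: "\<lbrakk>a \<in> carrier B; b \<in> carrier B\<rbrakk> \<Longrightarrow> lam B a b \<in> carrier B"
  by (simp add: lam_def)

lemma mult_eq: "\<lbrakk>a \<in> carrier B; b \<in> carrier B\<rbrakk> \<Longrightarrow> a \<otimes> b = a \<oplus> lam B a b"
  by (simp add: lam_def)

lemma lam_add: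
  "\<lbrakk>a \<in> carrier B; b \<in> carrier B; c \<in> carrier B\<rbrakk> \<Longrightarrow> lam B a (b \<oplus> c) = lam B a b \<oplus> lam B a c"
  by (simp add: lam_def brace_law a_minus_def add.m_assoc)

lemma lam_lam:
  assumes "a \<in> carrier B" "b \<in> carrier B" "c \<in> carrier B"
  shows "lam B (a \<otimes> b) c = lam B a (lam B b c)"
proof -
  have "(a \<otimes> b) \<oplus> lam B (a \<otimes> b) c = a \<otimes> (b \<otimes> c)"
    using assms by (simp add: mult_eq[symmetric] m_assoc)
  also have "\<dots> = a \<oplus> lam B a (b \<oplus> lam B b c)" using assms by (simp add: mult_eq)
  also have "\<dots> = (a \<oplus> lam B a b) \<oplus> lam B a (lam B b c)"
    using assms by (simp add: lam_add add.m_assoc)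
  also have "a \<oplus> lam B a b = a \<otimes> b" using assms by (simp add: mult_eq)
  finally show ?thesis using assms by simp
qed

lemma lam_one [simp]: "a \<in> carrier B \<Longrightarrow> lam B \<one> a = a"
  by (simp add: lam_def flip: zero_eq_one)

lemma lam_zero [simp]: "a \<in> carrier B \<Longrightarrow> lam B a \<zero> = \<zero>"
  by (simp add: lam_def zero_eq_one)

lemma lam_inv_lam [simp]: "\<lbrakk>a \<in> carrier B; b \<in> carrier B\<rbrakk> \<Longrightarrow> lam B (inv a) (lam B a b) = b"
  by (simp flip: lam_lam)

lemma lam_lam_inv [simp]: "\<lbrakk>a \<in> carrier B; b \<in> carrier B\<rbrakk> \<Longrightarrow> lam B a (lam B (inv a) b) = b"
  by (simp flip: lam_lam)

lemma lam_hom: "a \<in> carrier B \<Longrightarrow> lam B a \<in> hom (add_monoid B) (add_monoid B)"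
  by (simp add: hom_def lam_add)

lemma lam_group_hom: "a \<in> carrier B \<Longrightarrow> group_hom (add_monoid B) (add_monoid B) (lam B a)"
  by (simp add: group_hom_def group_hom_axioms_def lam_hom add_group)

lemma lam_minus: "\<lbrakk>a \<in> carrier B; b \<in> carrier B\<rbrakk> \<Longrightarrow> lam B a (\<ominus> b) = \<ominus> lam B a b"
  using group_hom.hom_inv[OF lam_group_hom, of a b] by (simp add: a_inv_def)

lemma inv_eq_minus_lam: "a \<in> carrier B \<Longrightarrow> inv a = \<ominus> lam B (inv a) a"
  by (metis add.inv_equality inv_closed l_inv lam_closed mult_eq zero_eq_one)

lemma conjugate_eq_lam:
  assumes "a \<in> carrier B" "b \<in> carrier B"
  shows "conjugate B a b \<otimes> a = a \<oplus> lam B a b"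
  using assms by (simp add: conjugate_def m_assoc flip: mult_eq)

lemma subbraceI:
  assumes "subgroup L (add_monoid B)"
    and lam: "\<And>a b. \<lbrakk>a \<in> L; b \<in> L\<rbrakk> \<Longrightarrow> lam B a b \<in> L"
    and lam_inv: "\<And>a b. \<lbrakk>a \<in> L; b \<in> L\<rbrakk> \<Longrightarrow> lam B (inv a) b \<in> L"
  shows "subbrace L B"
proof -
  interpret L: subgroup L "add_monoid B" by fact
  have LB: "L \<subseteq> carrier B" using L.subset by simp
  have "subgroup L B"
  proof (rule subgroupI)
    show "L \<noteq> {}" using L.one_closed by auto
    show "inv a \<in> L" if "a \<in> L" for a
    proof -
      have "\<ominus> lam B (inv a) a \<in> L"
        using L.m_inv_closed[OF lam_inv[OF that that]] by (simp add: a_inv_def)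
      moreover have "inv a = \<ominus> lam B (inv a) a" using inv_eq_minus_lam that LB by blast
      ultimately show ?thesis by simp
    qed
    show "a \<otimes> b \<in> L" if "a \<in> L" "b \<in> L" for a b
    proof -
      have "a \<otimes> b = a \<oplus> lam B a b" using that LB by (intro mult_eq) auto
      then show ?thesis using L.m_closed[OF that(1) lam[OF that]] by simp
    qed
  qed (rule LB)
  then show ?thesis using assms(1) by (simp add: subbrace_def)
qed

lemma subbraceD:
  assumes "subbrace C B"
  shows "subgroup C B" "subgroup C (add_monoid B)" "C \<subseteq> carrier B"
    and "\<zero> \<in> C" "\<one> \<in> C"
    and "\<And>a b. \<lbrakk>a \<in> C; b \<in> C\<rbrakk> \<Longrightarrow> a \<oplus> b \<in> C"
    and "\<And>a. a \<in> C \<Longrightarrow> \<ominus> a \<in> C"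
    and "\<And>a b. \<lbrakk>a \<in> C; b \<in> C\<rbrakk> \<Longrightarrow> a \<otimes> b \<in> C"
    and "\<And>a. a \<in> C \<Longrightarrow> inv a \<in> C"
    and "\<And>a b. \<lbrakk>a \<in> C; b \<in> C\<rbrakk> \<Longrightarrow> lam B a b \<in> C"
proof -
  show 1: "subgroup C B" and 2: "subgroup C (add_monoid B)" using assms by (auto simp: subbrace_def)
  interpret M: subgroup C B by fact
  interpret A: subgroup C "add_monoid B" by fact
  show "C \<subseteq> carrier B" by (rule M.subset)
  show "\<zero> \<in> C" using A.one_closed by simp
  show "\<one> \<in> C" by simp
  show plus: "a \<oplus> b \<in> C" if "a \<in> C" "b \<in> C" for a b using A.m_closed[OF that] by simp
  show minus: "\<ominus> a \<in> C" if "a \<in> C" for a using A.m_inv_closed[OF that] by (simp add: a_inv_def)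
  show "a \<otimes> b \<in> C" if "a \<in> C" "b \<in> C" for a b using that by simp
  show "inv a \<in> C" if "a \<in> C" for a using that by simp
  show "lam B a b \<in> C" if "a \<in> C" "b \<in> C" for a b
    unfolding lam_def using that by (intro plus minus) auto
qed

lemma subbrace_minus_carrier_update:
  assumes "subbrace C B" "a \<in> C"
  shows "\<ominus>\<^bsub>B\<lparr>carrier := C\<rparr>\<^esub> a = \<ominus> a"
proof -
  have "add_monoid (B\<lparr>carrier := C\<rparr>) = (add_monoid B)\<lparr>carrier := C\<rparr>" by simp
  then show ?thesis
    using group.subgroup_carrier_update(2)[OF add_group subbraceD(2)[OF assms(1)] assms(2)]
    by (simp add: a_inv_def)
qed

lemma lam_carrier_update:
  "\<lbrakk>subbrace C B; a \<in> C\<rbrakk> \<Longrightarrow> lam (B\<lparr>carrier := C\<rparr>) a b = lam B a b"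
  by (simp add: lam_def subbrace_minus_carrier_update)

lemma subbrace_is_skew_brace:
  assumes "subbrace C B"
  shows "skew_brace (B\<lparr>carrier := C\<rparr>)" (is "skew_brace ?C")
proof (rule skew_brace.intro)
  have "add_monoid ?C = (add_monoid B)\<lparr>carrier := C\<rparr>" by simp
  then show "group (add_monoid ?C)"
    using group.subgroup_carrier_update(1)[OF add_group subbraceD(2)[OF assms]] by simp
  show "group ?C" by (rule subgroup_carrier_update(1)[OF subbraceD(1)[OF assms]])
next
  fix a b c assume "a \<in> carrier ?C" "b \<in> carrier ?C" "c \<in> carrier ?C"
  then have abc: "a \<in> C" "b \<in> C" "c \<in> C" by simp_all
  then have "a \<in> carrier B" "b \<in> carrier B" "c \<in> carrier B" using subbraceD(3)[OF assms] by blast+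
  then show "a \<otimes>\<^bsub>?C\<^esub> (b \<oplus>\<^bsub>?C\<^esub> c)
     = a \<otimes>\<^bsub>?C\<^esub> b \<ominus>\<^bsub>?C\<^esub> a \<oplus>\<^bsub>?C\<^esub> a \<otimes>\<^bsub>?C\<^esub> c"
    using brace_law[of a b c] subbrace_minus_carrier_update[OF assms abc(1)] by (simp add: a_minus_def)
qed

lemma brace_ideal_iff:
  "brace_ideal I B \<longleftrightarrow> subbrace I B \<and>
    (\<forall>b\<in>carrier B. \<forall>i\<in>I. lam B b i \<in> I \<and> conjugate (add_monoid B) b i \<in> I \<and> conjugate B b i \<in> I)"
proof -
  have 1: "normal I (add_monoid B) \<longleftrightarrow> (\<forall>b\<in>carrier B. \<forall>i\<in>I. conjugate (add_monoid B) b i \<in> I)"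
    if "subbrace I B"
    using subbraceD(2)[OF that] unfolding add.normal_inv_iff by (simp add: conjugate_def a_inv_def)
  have 2: "normal I B \<longleftrightarrow> (\<forall>b\<in>carrier B. \<forall>i\<in>I. conjugate B b i \<in> I)" if "subbrace I B"
    using subbraceD(1)[OF that] unfolding normal_inv_iff by (simp add: conjugate_def)
  have 3: "lambda_map B b ` I \<subseteq> I \<longleftrightarrow> (\<forall>i\<in>I. lam B b i \<in> I)" if "subbrace I B" for b
  proof -
    have "lambda_map B b ` I = lam B b ` I"
      using subbraceD(3)[OF that] by (intro image_cong lambda_map_eq) auto
    then show ?thesis by auto
  qed
  show ?thesis
  proof (cases "subbrace I B")
    case True
    then show ?thesis unfolding brace_ideal_def by (simp only: 1 2 3 simp_thms) auto
  next
    case False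
    then show ?thesis unfolding brace_ideal_def by simp
  qed
qed

lemma socle_iff:
  "b \<in> brace_socle B \<longleftrightarrow> b \<in> carrier B \<and> (\<forall>c\<in>carrier B. lam B b c = c \<and> b \<oplus> c = c \<oplus> b)"
proof -
  have "lambda_map B b = (\<lambda>x\<in>carrier B. x) \<longleftrightarrow> (\<forall>c\<in>carrier B. lam B b c = c)"
    unfolding lambda_map_def lam_def by (auto simp: restrict_def fun_eq_iff)
  then show ?thesis
    by (auto simp: brace_socle_def kernel_def AutoGroup_def BijGroup_def group_center_def)
qed

lemma center_iff:
  "b \<in> brace_center B \<longleftrightarrow> b \<in> brace_socle B \<and> (\<forall>c\<in>carrier B. b \<otimes> c = c \<otimes> b)"
  by (auto simp: brace_center_def group_center_def socle_iff)

lemma socle_mult: "\<lbrakk>a \<in> brace_socle B; c \<in> carrier B\<rbrakk> \<Longrightarrow> a \<otimes> c = a \<oplus> c"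
  by (simp add: socle_iff mult_eq)

lemma socle_inv: "a \<in> brace_socle B \<Longrightarrow> inv a = \<ominus> a"
  using inv_eq_minus_lam[of a] lam_inv_lam[of a a] by (simp add: socle_iff)

text \<open>
  Let \<open>d = a b a\<inverse>\<close>. As \<open>\<lambda>\<^sub>b\<close> is the identity, so is \<open>\<lambda>\<^sub>d\<close>, whence \<open>d + a = d a = a b = a + \<lambda>\<^sub>a(b)\<close>;
  and \<open>\<lambda>\<^sub>a(b)\<close> is additively central because \<open>b\<close> is. So on the socle the lambda action and
  conjugation are the same action.
\<close>

lemma socle_conjugate:
  assumes "a \<in> carrier B" "b \<in> brace_socle B"
  shows "conjugate B a b = lam B a b"
proof -
  have b: "b \<in> carrier B" "\<And>c. c \<in> carrier B \<Longrightarrow> lam B b c = c" "\<And>c. c \<in> carrier B \<Longrightarrow> b \<oplus> c = c \<oplus> b"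
    using assms(2) by (auto simp: socle_iff)
  let ?d = "conjugate B a b"
  have "lam B ?d c = c" if "c \<in> carrier B" for c
    using assms(1) b that by (simp add: conjugate_def lam_lam)
  then have "?d \<oplus> a = ?d \<otimes> a" using assms(1) b by (simp add: mult_eq)
  also have "\<dots> = a \<oplus> lam B a b" by (rule conjugate_eq_lam[OF assms(1) b(1)])
  also have "\<dots> = lam B a (lam B (inv a) a \<oplus> b)" using assms(1) b(1) by (simp add: lam_add)
  also have "\<dots> = lam B a (b \<oplus> lam B (inv a) a)" using assms(1) b(3) by simp
  also have "\<dots> = lam B a b \<oplus> a" using assms(1) b(1) by (simp add: lam_add)
  finally show ?thesis using assms(1) b by simp
qed

lemma lam_socle:
  assumes "a \<in> carrier B" "b \<in> brace_socle B"
  shows "lam B a b \<in> brace_socle B"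
proof -
  have b: "b \<in> carrier B" "\<And>c. c \<in> carrier B \<Longrightarrow> lam B b c = c" "\<And>c. c \<in> carrier B \<Longrightarrow> b \<oplus> c = c \<oplus> b"
    using assms(2) by (auto simp: socle_iff)
  have "lam B (lam B a b) c = c" if "c \<in> carrier B" for c
    unfolding socle_conjugate[OF assms, symmetric]
    using assms(1) b that by (simp add: conjugate_def lam_lam)
  moreover have "lam B a b \<oplus> c = c \<oplus> lam B a b" if c: "c \<in> carrier B" for c
  proof -
    have "lam B a b \<oplus> c = lam B a (b \<oplus> lam B (inv a) c)"
      using assms(1) b(1) c by (simp add: lam_add)
    also have "\<dots> = lam B a (lam B (inv a) c \<oplus> b)" using assms(1) b(3) c by simp
    also have "\<dots> = c \<oplus> lam B a b" using assms(1) b(1) c by (simp add: lam_add)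
    finally show ?thesis .
  qed
  ultimately show ?thesis using assms(1) b(1) by (simp add: socle_iff)
qed

lemma socle_subgroup: "subgroup (brace_socle B) (add_monoid B)"
proof (rule add.subgroupI)
  show "brace_socle B \<subseteq> carrier B" by (auto simp: socle_iff)
  have "lam B \<zero> c = c" if "c \<in> carrier B" for c using that by (simp add: zero_eq_one)
  then have "\<zero> \<in> brace_socle B" by (simp add: socle_iff)
  then show "brace_socle B \<noteq> {}" by blast
  show "\<ominus> a \<in> brace_socle B" if a: "a \<in> brace_socle B" for a
  proof -
    have ac: "a \<in> carrier B" "\<And>c. c \<in> carrier B \<Longrightarrow> lam B a c = c" "\<And>c. c \<in> carrier B \<Longrightarrow> a \<oplus> c = c \<oplus> a"
      using a by (auto simp: socle_iff)
    have "lam B (inv a) c = c" if "c \<in> carrier B" for c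
      using lam_inv_lam[OF ac(1) that] ac(2)[OF that] by simp
    moreover have "\<ominus> a \<oplus> c = c \<oplus> \<ominus> a" if "c \<in> carrier B" for c
      using add.commute_inv[OF ac(1) that ac(3)[OF that]] .
    ultimately show ?thesis
      using socle_inv[OF a] ac(1) by (simp add: socle_iff)
  qed
  show "a \<oplus> b \<in> brace_socle B" if a: "a \<in> brace_socle B" and b: "b \<in> brace_socle B" for a b
  proof -
    have ab: "a \<in> carrier B" "b \<in> carrier B" using a b by (simp_all add: socle_iff)
    have "lam B (a \<oplus> b) c = c" if "c \<in> carrier B" for c
      using a b ab that by (simp add: lam_lam flip: socle_mult[OF a ab(2)]) (simp add: socle_iff)
    moreover have "a \<oplus> b \<oplus> c = c \<oplus> (a \<oplus> b)" if c: "c \<in> carrier B" for c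
    proof -
      have ac: "a \<oplus> c = c \<oplus> a" and bc: "b \<oplus> c = c \<oplus> b"
        using a b c unfolding socle_iff by blast+
      have "a \<oplus> b \<oplus> c = a \<oplus> (b \<oplus> c)" using ab c by (simp add: add.m_assoc)
      also have "\<dots> = (a \<oplus> c) \<oplus> b" unfolding bc using ab c by (simp add: add.m_assoc)
      also note ac
      finally show ?thesis using ab c by (simp add: add.m_assoc)
    qed
    ultimately show ?thesis using ab by (simp add: socle_iff)
  qed
qed

lemma socle_ideal: "brace_ideal (brace_socle B) B"
proof -
  have sub: "brace_socle B \<subseteq> carrier B" by (auto simp: socle_iff)
  have "subbrace (brace_socle B) B"
    using socle_subgroup by (rule subbraceI) (use lam_socle sub in auto)
  moreover have "conjugate (add_monoid B) b i = i" if "b \<in> carrier B" "i \<in> brace_socle B" for b i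
    using that unfolding socle_iff by (subst add.conjugate_eq_iff_commute) (auto simp: eq_commute)
  ultimately show ?thesis
    unfolding brace_ideal_iff using lam_socle socle_conjugate by simp
qed

lemma center_ideal: "brace_ideal (brace_center B) B"
proof -
  have ZS: "a \<in> brace_socle B" if "a \<in> brace_center B" for a using that by (simp add: center_iff)
  have ZB: "a \<in> carrier B" if "a \<in> brace_center B" for a using ZS[OF that] by (simp add: socle_iff)
  have lam: "lam B b a = a" if "b \<in> carrier B" "a \<in> brace_center B" for a b
  proof -
    have "conjugate B b a = a"
      using that ZB[OF that(2)] unfolding center_iff
      by (subst conjugate_eq_iff_commute) (auto simp: eq_commute)
    then show ?thesis using socle_conjugate[OF that(1) ZS[OF that(2)]] by simp
  qed
  have "subgroup (group_center B) B"
  proof (rule subgroupI)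
    show "group_center B \<noteq> {}" using one_closed by (force simp: group_center_def)
    show "inv a \<in> group_center B" if "a \<in> group_center B" for a
      using that commute_inv by (auto simp: group_center_def)
    show "a \<otimes> b \<in> group_center B" if "a \<in> group_center B" "b \<in> group_center B" for a b
    proof -
      have ab: "a \<in> carrier B" "b \<in> carrier B" using that by (simp_all add: group_center_def)
      have "a \<otimes> b \<otimes> g = g \<otimes> (a \<otimes> b)" if g: "g \<in> carrier B" for g
      proof -
        have ag: "a \<otimes> g = g \<otimes> a" and bg: "b \<otimes> g = g \<otimes> b"
          using \<open>a \<in> group_center B\<close> \<open>b \<in> group_center B\<close> g by (simp_all add: group_center_def)
        have "a \<otimes> b \<otimes> g = a \<otimes> (b \<otimes> g)" using ab g by (simp add: m_assoc)
        also have "\<dots> = (a \<otimes> g) \<otimes> b" unfolding bg using ab g by (simp add: m_assoc)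
        also note ag
        finally show ?thesis using ab g by (simp add: m_assoc)
      qed
      then show ?thesis using ab by (simp add: group_center_def)
    qed
  qed (auto simp: group_center_def)
  moreover have "subgroup (brace_socle B) B" using socle_ideal by (auto simp: brace_ideal_def subbrace_def)
  ultimately have mult: "subgroup (brace_center B) B"
    unfolding brace_center_def by (rule subgroups_Inter_pair[rotated])
  have "subgroup (brace_center B) (add_monoid B)"
  proof (rule add.subgroupI)
    show "brace_center B \<subseteq> carrier B" using ZB by auto
    show "brace_center B \<noteq> {}" using subgroup.one_closed[OF mult] by blast
    show "\<ominus> a \<in> brace_center B" if "a \<in> brace_center B" for a
      using subgroup.m_inv_closed[OF mult that] socle_inv[OF ZS[OF that]] by simp
    show "a \<oplus> b \<in> brace_center B" if "a \<in> brace_center B" "b \<in> brace_center B" for a b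
      using subgroup.m_closed[OF mult that] socle_mult[OF ZS[OF that(1)] ZB[OF that(2)]] by simp
  qed
  then have "subbrace (brace_center B) B" using mult by (simp add: subbrace_def)
  moreover have "conjugate (add_monoid B) b i = i" if "b \<in> carrier B" "i \<in> brace_center B" for b i
    using ZS[OF that(2)] that(1) unfolding socle_iff
    by (subst add.conjugate_eq_iff_commute) (auto simp: eq_commute)
  ultimately show ?thesis
    unfolding brace_ideal_iff using lam socle_conjugate ZS by simp
qed

text \<open>
  \<open>b I = b + \<lambda>\<^sub>b(I) = b + I\<close>, and normality turns left cosets into right ones.
\<close>

lemma ideal_coset_eq:
  assumes "brace_ideal I B" "b \<in> carrier B"
  shows "I #> b = I #>\<^bsub>add_monoid B\<^esub> b"
proof -
  have sb: "subbrace I B"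
    and cl: "\<And>b i. \<lbrakk>b \<in> carrier B; i \<in> I\<rbrakk> \<Longrightarrow> lam B b i \<in> I"
      "\<And>b i. \<lbrakk>b \<in> carrier B; i \<in> I\<rbrakk> \<Longrightarrow> conjugate (add_monoid B) b i \<in> I"
      "\<And>b i. \<lbrakk>b \<in> carrier B; i \<in> I\<rbrakk> \<Longrightarrow> conjugate B b i \<in> I"
    using assms(1) by (auto simp: brace_ideal_iff)
  have IB: "i \<in> carrier B" if "i \<in> I" for i using subbraceD(3)[OF sb] that by blast
  have "x \<in> I #> b" if "x \<in> I #>\<^bsub>add_monoid B\<^esub> b" for x
  proof -
    obtain i where i: "i \<in> I" "x = i \<oplus> b" using \<open>x \<in> I #>\<^bsub>add_monoid B\<^esub> b\<close> by (auto simp: r_coset_def)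
    let ?j = "lam B (inv b) (conjugate (add_monoid B) (\<ominus> b) i)"
    have j: "?j \<in> I" using i(1) assms(2) cl by simp
    have "b \<otimes> ?j = b \<oplus> conjugate (add_monoid B) (\<ominus> b) i"
      using assms(2) IB[OF i(1)] IB[OF j] add.conjugate_closed[of "\<ominus> b" i] by (simp add: mult_eq)
    also have "\<dots> = x"
      using assms(2) IB[OF i(1)] i(2) by (simp add: conjugate_def add.m_assoc flip: a_inv_def)
    finally have "x = b \<otimes> ?j" by simp
    also have "\<dots> = conjugate B b ?j \<otimes> b"
      using assms(2) IB[OF j] by (simp add: conjugate_def m_assoc)
    finally show ?thesis using cl(3)[OF assms(2) j] by (auto simp: r_coset_def)
  qed
  moreover have "x \<in> I #>\<^bsub>add_monoid B\<^esub> b" if "x \<in> I #> b" for x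
  proof -
    obtain i where i: "i \<in> I" "x = i \<otimes> b" using \<open>x \<in> I #> b\<close> by (auto simp: r_coset_def)
    let ?j = "lam B b (conjugate B (inv b) i)"
    have j: "?j \<in> I" using i(1) assms(2) cl by simp
    have "x = b \<otimes> conjugate B (inv b) i"
      using assms(2) IB[OF i(1)] i(2) by (simp add: conjugate_def m_assoc)
    also have "\<dots> = b \<oplus> ?j" using assms(2) IB[OF i(1)] by (simp add: mult_eq)
    also have "\<dots> = conjugate (add_monoid B) b ?j \<oplus> b"
      using assms(2) IB[OF j] by (simp add: conjugate_def add.m_assoc flip: a_inv_def)
    finally show ?thesis using cl(2)[OF assms(2) j] by (auto simp: r_coset_def)
  qed
  ultimately show ?thesis by blast
qed

end

section \<open>Epimorphisms and quotients of skew braces\<close>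

lemma (in group_hom) subgroup_preimage:
  assumes "subgroup J H"
  shows "subgroup {x \<in> carrier G. h x \<in> J} G"
proof (rule G.subgroupI)
  show "{x \<in> carrier G. h x \<in> J} \<noteq> {}"
    using subgroup.one_closed[OF assms] hom_one G.one_closed by (metis (mono_tags) empty_iff mem_Collect_eq)
  show "inv a \<in> {x \<in> carrier G. h x \<in> J}" if "a \<in> {x \<in> carrier G. h x \<in> J}" for a
    using that subgroup.m_inv_closed[OF assms, of "h a"] by simp
  show "a \<otimes> b \<in> {x \<in> carrier G. h x \<in> J}"
    if "a \<in> {x \<in> carrier G. h x \<in> J}" "b \<in> {x \<in> carrier G. h x \<in> J}" for a b
    using that subgroup.m_closed[OF assms, of "h a" "h b"] by simp
qed blast

locale brace_epi = B: skew_brace B + Q: skew_brace Q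
  for B :: "('a, 'b) ring_scheme" (structure) and Q :: "('c, 'd) ring_scheme" +
  fixes f :: "'a \<Rightarrow> 'c"
  assumes mult_hom: "f \<in> hom B Q"
    and add_hom: "f \<in> hom (add_monoid B) (add_monoid Q)"
    and surj: "f ` carrier B = carrier Q"

sublocale brace_epi \<subseteq> mult: group_hom B Q f
  using mult_hom by unfold_locales

sublocale brace_epi \<subseteq> add: group_hom "add_monoid B" "add_monoid Q" f
  using add_hom B.add_group Q.add_group
  by (simp add: group_hom_def group_hom_axioms_def)

context brace_epi
begin

lemma f_closed: "a \<in> carrier B \<Longrightarrow> f a \<in> carrier Q"
  using surj by blast

lemma f_add: "\<lbrakk>a \<in> carrier B; b \<in> carrier B\<rbrakk> \<Longrightarrow> f (a \<oplus> b) = f a \<oplus>\<^bsub>Q\<^esub> f b"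
  using add.hom_mult by simp

lemma f_minus: "a \<in> carrier B \<Longrightarrow> f (\<ominus> a) = \<ominus>\<^bsub>Q\<^esub> f a"
  using add.hom_inv by (simp add: a_inv_def)

lemma f_zero: "f \<zero> = \<zero>\<^bsub>Q\<^esub>"
  using add.hom_one by simp

lemma f_lam: "\<lbrakk>a \<in> carrier B; b \<in> carrier B\<rbrakk> \<Longrightarrow> f (lam B a b) = lam Q (f a) (f b)"
  by (simp add: lam_def f_add f_minus)

lemma subbrace_preimage:
  assumes "subbrace J Q"
  shows "subbrace {b \<in> carrier B. f b \<in> J} B"
  using mult.subgroup_preimage[OF Q.subbraceD(1)[OF assms]]
    add.subgroup_preimage[OF Q.subbraceD(2)[OF assms]] by (simp add: subbrace_def)

lemma subbrace_image:
  assumes "subbrace C B"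
  shows "subbrace (f ` C) Q"
  using mult.subgroup_img_is_subgroup[OF B.subbraceD(1)[OF assms]]
    add.subgroup_img_is_subgroup[OF B.subbraceD(2)[OF assms]] by (simp add: subbrace_def)

lemma ideal_preimage:
  assumes "brace_ideal J Q"
  shows "brace_ideal {b \<in> carrier B. f b \<in> J} B"
proof -
  have "subbrace J Q" using assms by (simp add: Q.brace_ideal_iff)
  then show ?thesis
    using assms subbrace_preimage unfolding B.brace_ideal_iff Q.brace_ideal_iff
    using B.add.conjugate_closed add.hom_conjugate
    by (simp add: f_closed f_lam mult.hom_conjugate add.hom_conjugate)
qed

end

section \<open>The socle series and the central series\<close>

text \<open>
  The preimages in \<open>B\<close> of the socle and of the centre of \<open>B / I\<close>.
\<close>

definition socle_mod :: "('a, 'b) ring_scheme \<Rightarrow> 'a set \<Rightarrow> 'a set"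
  where "socle_mod B I = {b \<in> carrier B. \<forall>c\<in>carrier B.
    lam B b c \<oplus>\<^bsub>B\<^esub> \<ominus>\<^bsub>B\<^esub> c \<in> I \<and> commutator (add_monoid B) b c \<in> I}"

definition center_mod :: "('a, 'b) ring_scheme \<Rightarrow> 'a set \<Rightarrow> 'a set"
  where "center_mod B I = {b \<in> socle_mod B I. \<forall>c\<in>carrier B. commutator B b c \<in> I}"

text \<open>
  So the entry \<open>{\<zero>}\<close> at index 0 fits the recursion that the series obey from index 1 onwards.
\<close>

lemma (in skew_brace) socle_eq_socle_mod: "brace_socle B = socle_mod B {\<zero>}"
proof -
  have "lam B b c \<oplus> \<ominus> c = \<zero> \<longleftrightarrow> lam B b c = c" if "b \<in> carrier B" "c \<in> carrier B" for b c
    using that by (metis add.inv_solve_right' add.l_one add.one_closed lam_closed)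
  moreover have "commutator (add_monoid B) b c = \<zero> \<longleftrightarrow> b \<oplus> c = c \<oplus> b"
    if "b \<in> carrier B" "c \<in> carrier B" for b c
    using add.commutator_eq_one_iff[OF that] .
  ultimately show ?thesis by (auto simp: socle_iff socle_mod_def)
qed

lemma (in skew_brace) center_eq_center_mod: "brace_center B = center_mod B {\<zero>}"
proof -
  have "commutator B b c = \<zero> \<longleftrightarrow> b \<otimes> c = c \<otimes> b"
    if "b \<in> carrier B" "c \<in> carrier B" for b c
    using commutator_eq_one_iff[OF that] by (simp add: zero_eq_one)
  then show ?thesis by (auto simp: center_iff socle_eq_socle_mod center_mod_def socle_mod_def)
qed

context brace_epi
begin

text \<open>
  Conditions stated through \<open>\<lambda>\<close> and commutators pull back along an epimorphism; applied to \<open>B \<rightarrow> B / I\<close>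
  this describes the preimage of the socle of \<open>B / I\<close> by elements of \<open>B\<close>.
\<close>

lemma preimage_socle_mod: "{b \<in> carrier B. f b \<in> socle_mod Q J} = socle_mod B {b \<in> carrier B. f b \<in> J}"
proof -
  have 1: "lam Q (f b) (f c) \<oplus>\<^bsub>Q\<^esub> \<ominus>\<^bsub>Q\<^esub> f c = f (lam B b c \<oplus> \<ominus> c)"
    "commutator (add_monoid Q) (f b) (f c) = f (commutator (add_monoid B) b c)"
    if "b \<in> carrier B" "c \<in> carrier B" for b c
    using that add.hom_commutator by (simp_all add: f_lam f_add f_minus)
  have 2: "f b \<in> socle_mod Q J \<longleftrightarrow> (\<forall>c\<in>carrier B.
      f (lam B b c \<oplus> \<ominus> c) \<in> J \<and> f (commutator (add_monoid B) b c) \<in> J)"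
    if b: "b \<in> carrier B" for b
  proof -
    have "f b \<in> socle_mod Q J \<longleftrightarrow> (\<forall>q\<in>f ` carrier B.
        lam Q (f b) q \<oplus>\<^bsub>Q\<^esub> \<ominus>\<^bsub>Q\<^esub> q \<in> J \<and> commutator (add_monoid Q) (f b) q \<in> J)"
      unfolding surj socle_mod_def using f_closed[OF b] by simp
    then show ?thesis using 1[OF b] by simp
  qed
  have 3: "b \<in> socle_mod B {b \<in> carrier B. f b \<in> J} \<longleftrightarrow> (\<forall>c\<in>carrier B.
      f (lam B b c \<oplus> \<ominus> c) \<in> J \<and> f (commutator (add_monoid B) b c) \<in> J)"
    if b: "b \<in> carrier B" for b
    unfolding socle_mod_def using b B.add.commutator_closed[OF b] by simp
  show ?thesis using 2 3 by (auto simp: socle_mod_def[of B])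
qed

lemma preimage_center_mod: "{b \<in> carrier B. f b \<in> center_mod Q J} = center_mod B {b \<in> carrier B. f b \<in> J}"
proof -
  have 1: "(\<forall>q\<in>carrier Q. commutator Q (f b) q \<in> J) \<longleftrightarrow>
      (\<forall>c\<in>carrier B. commutator B b c \<in> {b \<in> carrier B. f b \<in> J})"
    if "b \<in> carrier B" for b
    unfolding surj[symmetric] using that by (simp add: mult.hom_commutator)
  have "{b \<in> carrier B. f b \<in> center_mod Q J}
      = {b \<in> {b \<in> carrier B. f b \<in> socle_mod Q J}. \<forall>q\<in>carrier Q. commutator Q (f b) q \<in> J}"
    unfolding center_mod_def by blast
  also have "\<dots> = center_mod B {b \<in> carrier B. f b \<in> J}"
    unfolding preimage_socle_mod center_mod_def using 1 by (auto simp: socle_mod_def)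
  finally show ?thesis .
qed

end

context skew_brace
begin

lemma brace_image:
  fixes Q :: "('c, 'd) ring_scheme"
  assumes "f \<in> hom B Q" "f \<in> hom (add_monoid B) (add_monoid Q)" "f ` carrier B = carrier Q"
    and "\<one>\<^bsub>Q\<^esub> = f \<one>" "\<zero>\<^bsub>Q\<^esub> = f \<zero>"
  shows "brace_epi B Q f"
proof -
  have "group (Q\<lparr>carrier := f ` carrier B, one := f \<one>\<rparr>)" by (rule hom_imp_img_group[OF assms(1)])
  moreover have "Q\<lparr>carrier := f ` carrier B, one := f \<one>\<rparr> = Q"
    unfolding assms(3) assms(4)[symmetric] by simp
  ultimately have Q: "group Q" by simp
  have "group ((add_monoid Q)\<lparr>carrier := f ` carrier B, one := f \<zero>\<rparr>)"
    using add.hom_imp_img_group[OF assms(2)] by simp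
  moreover have "(add_monoid Q)\<lparr>carrier := f ` carrier B, one := f \<zero>\<rparr> = add_monoid Q"
    unfolding assms(3) assms(5)[symmetric] by simp
  ultimately have addQ: "group (add_monoid Q)" by simp
  interpret addf: group_hom "add_monoid B" "add_monoid Q" f
    using assms(2) add_group addQ by (simp add: group_hom_def group_hom_axioms_def)
  have fm: "f (\<ominus> a) = \<ominus>\<^bsub>Q\<^esub> f a" if "a \<in> carrier B" for a
    using addf.hom_inv[of a] that by (simp add: a_inv_def)
  have fa: "f (a \<oplus> b) = f a \<oplus>\<^bsub>Q\<^esub> f b" if "a \<in> carrier B" "b \<in> carrier B" for a b
    using addf.hom_mult[of a b] that by simp
  have ft: "f (a \<otimes> b) = f a \<otimes>\<^bsub>Q\<^esub> f b" if "a \<in> carrier B" "b \<in> carrier B" for a b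
    using hom_mult[OF assms(1) that] .
  have "skew_brace Q"
  proof (rule skew_brace.intro[OF addQ Q])
    fix x y z assume "x \<in> carrier Q" "y \<in> carrier Q" "z \<in> carrier Q"
    then obtain a b c where abc: "a \<in> carrier B" "b \<in> carrier B" "c \<in> carrier B" "x = f a" "y = f b" "z = f c"
      unfolding assms(3)[symmetric] by blast
    have "f (a \<otimes> (b \<oplus> c)) = f ((a \<otimes> b \<oplus> \<ominus> a) \<oplus> a \<otimes> c)"
      using brace_law[OF abc(1-3)] by (simp add: a_minus_def)
    then show "x \<otimes>\<^bsub>Q\<^esub> (y \<oplus>\<^bsub>Q\<^esub> z) = x \<otimes>\<^bsub>Q\<^esub> y \<ominus>\<^bsub>Q\<^esub> x \<oplus>\<^bsub>Q\<^esub> x \<otimes>\<^bsub>Q\<^esub> z"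
      using abc by (simp add: fa ft fm a_minus_def)
  qed
  then show ?thesis
    using assms(1-3) skew_brace_axioms by (simp add: brace_epi_def brace_epi_axioms_def)
qed

lemma ideal_normal:
  assumes "brace_ideal I B"
  shows "I \<lhd> B" "I \<lhd> add_monoid B" "I \<subseteq> carrier B"
  using assms subbraceD(3) by (auto simp: brace_ideal_def)

lemma coset_mult:
  "\<lbrakk>brace_ideal I B; a \<in> carrier B; b \<in> carrier B\<rbrakk> \<Longrightarrow> (I #> a) <#> (I #> b) = I #> a \<otimes> b"
  by (rule normal.rcos_sum[OF ideal_normal(1)])

lemma coset_set_add:
  assumes "brace_ideal I B" "a \<in> carrier B" "b \<in> carrier B"
  shows "set_add B (I #> a) (I #> b) = I #> a \<oplus> b"
  using normal.rcos_sum[OF ideal_normal(2)[OF assms(1)], of a b] assms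
  by (simp add: set_add_def ideal_coset_eq)

lemma coset_eq_ideal_iff:
  assumes "brace_ideal I B" "b \<in> carrier B"
  shows "I #> b = I \<longleftrightarrow> b \<in> I"
  using coset_join1[OF _ assms(2)] coset_join2[OF assms(2)] ideal_normal(1)[OF assms(1)]
  by (meson normal_imp_subgroup)

lemma brace_epi_quotient:
  assumes "brace_ideal I B"
  shows "brace_epi B (brace_quotient B I) (\<lambda>b. I #> b)"
proof (rule brace_image)
  show "(\<lambda>b. I #> b) \<in> hom B (brace_quotient B I)"
    using coset_mult[OF assms] by (auto simp: hom_def brace_quotient_def RCOSETS_def)
  show "(\<lambda>b. I #> b) \<in> hom (add_monoid B) (add_monoid (brace_quotient B I))"
    using coset_set_add[OF assms] by (auto simp: hom_def brace_quotient_def RCOSETS_def)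
  show "(\<lambda>b. I #> b) ` carrier B = carrier (brace_quotient B I)"
    by (auto simp: brace_quotient_def RCOSETS_def)
  show "\<one>\<^bsub>brace_quotient B I\<^esub> = I #> \<one>"
    using ideal_normal(3)[OF assms] by (simp add: brace_quotient_def)
  then show "\<zero>\<^bsub>brace_quotient B I\<^esub> = I #> \<zero>"
    by (simp add: brace_quotient_def zero_eq_one)
qed

text \<open>
  Replacing each coset by a chosen representative models \<open>B / I\<close> on the type of \<open>B\<close>, so that an
  induction over skew braces of one type can pass to quotients.
\<close>

lemma quotient_on_same_type:
  fixes I :: "'a set"
  assumes "brace_ideal I B"
  obtains Q :: "('a, 'b) ring_scheme" and f
  where "brace_epi B Q f" "\<And>b. b \<in> carrier B \<Longrightarrow> f b = \<zero>\<^bsub>Q\<^esub> \<longleftrightarrow> b \<in> I"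
proof -
  have I: "subgroup I B" using ideal_normal(1)[OF assms] by (rule normal_imp_subgroup)
  define f where "f b = (SOME x. x \<in> I #> b)" for b
  have f_in: "f b \<in> I #> b" if "b \<in> carrier B" for b
    unfolding f_def by (rule someI[of _ b]) (rule rcos_self[OF that I])
  have f_carrier: "f b \<in> carrier B" if "b \<in> carrier B" for b
    using f_in[OF that] r_coset_subset_G[OF subgroup.subset[OF I] that] by blast
  have coset_f: "I #> f b = I #> b" if "b \<in> carrier B" for b
    using repr_independence[OF f_in[OF that] that I] by simp
  have f_cong: "f a = f b" if "I #> a = I #> b" for a b
    unfolding f_def using that by simp
  have f_eq_iff: "f a = f b \<longleftrightarrow> I #> a = I #> b" if "a \<in> carrier B" "b \<in> carrier B" for a b
    using f_cong coset_f that by metis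
  define Q where "Q = B\<lparr>carrier := f ` carrier B, mult := \<lambda>x y. f (x \<otimes> y), one := f \<one>,
    zero := f \<zero>, add := \<lambda>x y. f (x \<oplus> y)\<rparr>"
  have "brace_epi B Q f"
  proof (rule brace_image)
    have "f (a \<otimes> b) = f (f a \<otimes> f b)" if "a \<in> carrier B" "b \<in> carrier B" for a b
      using that coset_f f_carrier by (intro f_cong) (simp flip: coset_mult[OF assms])
    then show "f \<in> hom B Q" by (auto simp: hom_def Q_def)
    have "f (a \<oplus> b) = f (f a \<oplus> f b)" if "a \<in> carrier B" "b \<in> carrier B" for a b
      using that coset_f f_carrier by (intro f_cong) (simp flip: coset_set_add[OF assms])
    then show "f \<in> hom (add_monoid B) (add_monoid Q)" by (auto simp: hom_def Q_def)
  qed (simp_all add: Q_def)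
  moreover have "f b = \<zero>\<^bsub>Q\<^esub> \<longleftrightarrow> b \<in> I" if "b \<in> carrier B" for b
    using f_eq_iff[OF that, of \<zero>] coset_eq_ideal_iff[OF assms that]
      coset_mult_one[OF subgroup.subset[OF I]] by (simp add: Q_def zero_eq_one)
  ultimately show thesis by (rule that)
qed

lemma zero_ideal: "brace_ideal {\<zero>} B"
proof -
  have "subgroup {\<zero>} (add_monoid B)" using add.triv_subgroup by simp
  moreover have "subgroup {\<zero>} B" using triv_subgroup by (simp add: zero_eq_one)
  moreover have "conjugate (add_monoid B) b \<zero> = \<zero>" if "b \<in> carrier B" for b
    using add.conjugate_one that by simp
  ultimately show ?thesis unfolding brace_ideal_iff subbrace_def
    by (simp add: zero_eq_one) (simp flip: zero_eq_one)
qed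

lemma quotient_kernel:
  assumes "brace_ideal I B"
  shows "{b \<in> carrier B. I #> b \<in> {\<zero>\<^bsub>brace_quotient B I\<^esub>}} = I"
  using coset_eq_ideal_iff[OF assms] ideal_normal(3)[OF assms] by (auto simp: brace_quotient_def)

lemma quotient_socle:
  assumes "brace_ideal I B"
  shows "{b \<in> carrier B. I #> b \<in> brace_socle (brace_quotient B I)} = socle_mod B I"
    and "brace_ideal (socle_mod B I) B"
proof -
  interpret q: brace_epi B "brace_quotient B I" "\<lambda>b. I #> b" by (rule brace_epi_quotient[OF assms])
  show 1: "{b \<in> carrier B. I #> b \<in> brace_socle (brace_quotient B I)} = socle_mod B I"
    unfolding q.Q.socle_eq_socle_mod q.preimage_socle_mod quotient_kernel[OF assms] ..
  show "brace_ideal (socle_mod B I) B"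
    using q.ideal_preimage[OF q.Q.socle_ideal] unfolding 1 .
qed

lemma quotient_center:
  assumes "brace_ideal I B"
  shows "{b \<in> carrier B. I #> b \<in> brace_center (brace_quotient B I)} = center_mod B I"
    and "brace_ideal (center_mod B I) B"
proof -
  interpret q: brace_epi B "brace_quotient B I" "\<lambda>b. I #> b" by (rule brace_epi_quotient[OF assms])
  show 1: "{b \<in> carrier B. I #> b \<in> brace_center (brace_quotient B I)} = center_mod B I"
    unfolding q.Q.center_eq_center_mod q.preimage_center_mod quotient_kernel[OF assms] ..
  show "brace_ideal (center_mod B I) B"
    using q.ideal_preimage[OF q.Q.center_ideal] unfolding 1 .
qed

lemma socle_series_ideal: "brace_ideal (socle_series B n) B"
  and socle_series_Suc: "socle_series B (Suc n) = socle_mod B (socle_series B n)"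
proof -
  have step: "socle_series B (Suc n) = socle_mod B (socle_series B n)"
    if "brace_ideal (socle_series B n) B" for n
  proof (cases n)
    case 0 then show ?thesis by (simp add: socle_eq_socle_mod)
  next
    case (Suc m)
    then show ?thesis using quotient_socle(1)[of "socle_series B (Suc m)"] that by simp
  qed
  show ideal: "brace_ideal (socle_series B n) B" for n
  proof (induction n)
    case 0 then show ?case by (simp add: zero_ideal)
  next
    case (Suc n) then show ?case unfolding step[OF Suc] by (rule quotient_socle(2))
  qed
  show "socle_series B (Suc n) = socle_mod B (socle_series B n)" by (rule step[OF ideal])
qed

lemma center_series_ideal: "brace_ideal (center_series B n) B"
  and center_series_Suc: "center_series B (Suc n) = center_mod B (center_series B n)"
proof -
  have step: "center_series B (Suc n) = center_mod B (center_series B n)"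
    if "brace_ideal (center_series B n) B" for n
  proof (cases n)
    case 0 then show ?thesis by (simp add: center_eq_center_mod)
  next
    case (Suc m)
    then show ?thesis using quotient_center(1)[of "center_series B (Suc m)"] that by simp
  qed
  show ideal: "brace_ideal (center_series B n) B" for n
  proof (induction n)
    case 0 then show ?case by (simp add: zero_ideal)
  next
    case (Suc n) then show ?case unfolding step[OF Suc] by (rule quotient_center(2))
  qed
  show "center_series B (Suc n) = center_mod B (center_series B n)" by (rule step[OF ideal])
qed

text \<open>
  That \<open>\<lambda>\<^sub>b\<close> moves every \<open>c\<close> only within its coset of \<open>I\<close> follows from
  \<open>\<lambda>\<^sub>b(c) = -b + b c\<close> by writing \<open>b c = c (c\<inverse> b c) = c + \<lambda>\<^sub>c(c\<inverse> b c)\<close>.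
\<close>

lemma ideal_mod_absorb:
  assumes "brace_ideal I B" "b \<in> I" "c \<in> carrier B"
  shows "lam B b c \<oplus> \<ominus> c \<in> I" "commutator (add_monoid B) b c \<in> I" "commutator B b c \<in> I"
proof -
  have sb: "subbrace I B"
    and cl: "\<And>b i. \<lbrakk>b \<in> carrier B; i \<in> I\<rbrakk> \<Longrightarrow> conjugate (add_monoid B) b i \<in> I"
      "\<And>b i. \<lbrakk>b \<in> carrier B; i \<in> I\<rbrakk> \<Longrightarrow> conjugate B b i \<in> I"
      "\<And>b i. \<lbrakk>b \<in> carrier B; i \<in> I\<rbrakk> \<Longrightarrow> lam B b i \<in> I"
    using assms(1) by (auto simp: brace_ideal_iff)
  have b: "b \<in> carrier B" using assms(2) subbraceD(3)[OF sb] by blast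
  have "commutator (add_monoid B) b c = b \<oplus> conjugate (add_monoid B) c (\<ominus> b)"
    using b assms(3) by (simp add: commutator_def conjugate_def add.m_assoc flip: a_inv_def)
  then show "commutator (add_monoid B) b c \<in> I"
    using cl(1)[OF assms(3) subbraceD(7)[OF sb assms(2)]] subbraceD(6)[OF sb assms(2)] by simp
  have "commutator B b c = b \<otimes> conjugate B c (inv b)"
    using b assms(3) by (simp add: commutator_def conjugate_def m_assoc)
  then show "commutator B b c \<in> I"
    using cl(2)[OF assms(3) subbraceD(9)[OF sb assms(2)]] subbraceD(8)[OF sb assms(2)] by simp
  have d: "conjugate B (inv c) b \<in> I" using cl(2)[OF _ assms(2)] assms(3) by simp
  then have dc: "conjugate B (inv c) b \<in> carrier B" using subbraceD(3)[OF sb] by blast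
  have "b \<otimes> c = c \<otimes> conjugate B (inv c) b" using b assms(3) by (simp add: conjugate_def m_assoc)
  also have "\<dots> = c \<oplus> lam B c (conjugate B (inv c) b)" using assms(3) dc by (simp add: mult_eq)
  finally have "lam B b c \<oplus> \<ominus> c
      = \<ominus> b \<oplus> conjugate (add_monoid B) c (lam B c (conjugate B (inv c) b))"
    using b assms(3) dc by (simp add: lam_def[of B b] conjugate_def[of "add_monoid B"] add.m_assoc flip: a_inv_def)
  then show "lam B b c \<oplus> \<ominus> c \<in> I"
    using cl(1)[OF assms(3) cl(3)[OF assms(3) d]] subbraceD(6,7)[OF sb] assms(2) by simp
qed

lemma ideal_subset_center_mod:
  assumes "brace_ideal I B"
  shows "I \<subseteq> center_mod B I"
proof
  fix b assume b: "b \<in> I"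
  then have "b \<in> carrier B" using ideal_normal(3)[OF assms] by blast
  then show "b \<in> center_mod B I"
    unfolding center_mod_def socle_mod_def using ideal_mod_absorb[OF assms b] by simp
qed

lemma center_series_mono:
  assumes "i \<le> j"
  shows "center_series B i \<subseteq> center_series B j"
  using ideal_subset_center_mod[OF center_series_ideal]
  by (intro lift_Suc_mono_le[OF _ assms]) (simp only: center_series_Suc)

lemma socle_series_mono:
  assumes "i \<le> j"
  shows "socle_series B i \<subseteq> socle_series B j"
proof (rule lift_Suc_mono_le[OF _ assms])
  show "socle_series B n \<subseteq> socle_series B (Suc n)" for n
    using ideal_subset_center_mod[OF socle_series_ideal]
    unfolding socle_series_Suc center_mod_def by blast
qed

lemma multipermutational_iff: "multipermutational B \<longleftrightarrow> (\<exists>n. carrier B \<subseteq> socle_series B n)"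
proof
  assume "\<exists>n. carrier B \<subseteq> socle_series B n"
  then obtain n where "carrier B \<subseteq> socle_series B n" by blast
  then have "carrier B \<subseteq> socle_series B (Suc n)" using socle_series_mono[of n "Suc n"] by simp
  then show "multipermutational B"
    unfolding multipermutational_def using ideal_normal(3)[OF socle_series_ideal]
    by (intro exI[of _ "Suc n"]) (simp del: socle_series.simps, blast)
qed (auto simp: multipermutational_def)

lemma multipermutational_subbrace:
  assumes "multipermutational B" "subbrace C B"
  shows "multipermutational (B\<lparr>carrier := C\<rparr>)"
proof -
  let ?C = "B\<lparr>carrier := C\<rparr>"
  interpret C: skew_brace "?C" by (rule subbrace_is_skew_brace[OF assms(2)])
  have addC: "add_monoid ?C = (add_monoid B)\<lparr>carrier := C\<rparr>" by simp
  have "C \<inter> socle_series B n \<subseteq> socle_series ?C n" for n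
  proof (induction n)
    case 0 then show ?case by simp
  next
    case (Suc n)
    show ?case
    proof
      fix b assume "b \<in> C \<inter> socle_series B (Suc n)"
      then have b: "b \<in> C" "b \<in> socle_mod B (socle_series B n)" unfolding socle_series_Suc by auto
      have "lam ?C b c \<oplus>\<^bsub>?C\<^esub> \<ominus>\<^bsub>?C\<^esub> c \<in> socle_series ?C n"
        "commutator (add_monoid ?C) b c \<in> socle_series ?C n"
        if c: "c \<in> C" for c
      proof -
        have cB: "c \<in> carrier B" using c subbraceD(3)[OF assms(2)] by blast
        have "lam B b c \<oplus> \<ominus> c \<in> C" using b(1) c subbraceD(6,7,10)[OF assms(2)] by simp
        moreover have "lam B b c \<oplus> \<ominus> c \<in> socle_series B n" using b(2) cB by (simp add: socle_mod_def)
        ultimately show "lam ?C b c \<oplus>\<^bsub>?C\<^esub> \<ominus>\<^bsub>?C\<^esub> c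
            \<in> socle_series ?C n"
          using Suc.IH subbrace_minus_carrier_update[OF assms(2) c] lam_carrier_update[OF assms(2) b(1)]
          by auto
        have "commutator (add_monoid ?C) b c = commutator (add_monoid B) b c"
          unfolding addC by (rule add.subgroup_carrier_update(4)[OF subbraceD(2)[OF assms(2)] b(1) c])
        moreover have "commutator (add_monoid B) b c \<in> C"
          by (rule add.subgroup_commutator[OF subbraceD(2)[OF assms(2)] b(1) c])
        moreover have "commutator (add_monoid B) b c \<in> socle_series B n"
          using b(2) cB by (simp add: socle_mod_def)
        ultimately show "commutator (add_monoid ?C) b c \<in> socle_series ?C n"
          using Suc.IH by auto
      qed
      then show "b \<in> socle_series ?C (Suc n)"
        unfolding C.socle_series_Suc socle_mod_def using b(1) by simp
    qed
  qed
  moreover obtain n where "carrier B \<subseteq> socle_series B n"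
    using assms(1) multipermutational_iff by blast
  ultimately show ?thesis
    unfolding C.multipermutational_iff using subbraceD(3)[OF assms(2)] by (intro exI[of _ n]) fastforce
qed

text \<open>
  The socle series is a central series of the additive group.
\<close>

lemma multipermutational_add_nilpotent:
  assumes "multipermutational B"
  shows "nilpotent_group (add_monoid B)"
proof -
  obtain n where "carrier B \<subseteq> socle_series B n"
    using assms multipermutational_iff by blast
  then show ?thesis
    by (intro add.nilpotent_groupI[of "socle_series B" n])
      (simp_all only: socle_series_Suc, auto simp: socle_mod_def)
qed

lemma nontrivial_socle:
  assumes "multipermutational B" "carrier B \<noteq> {\<zero>}"
  shows "brace_socle B \<noteq> {\<zero>}"
proof
  assume "brace_socle B = {\<zero>}"
  then have *: "socle_mod B {\<zero>} = {\<zero>}" by (simp add: socle_eq_socle_mod)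
  have "socle_series B n = {\<zero>}" for n
  proof (induction n)
    case (Suc n) show ?case unfolding socle_series_Suc Suc * ..
  qed simp
  then show False using assms by (auto simp: multipermutational_def)
qed

text \<open>
  Refine the socle series by a central series \<open>K\<^sub>0, \<dots>, K\<^sub>J\<close> of the multiplicative group: for an
  element of \<open>Soc\<^sub>i\<^sub>+\<^sub>1 \<inter> K\<^sub>j\<^sub>+\<^sub>1\<close>, all elements required to vanish modulo the next lower term of the
  central series of the skew brace lie in \<open>Soc\<^sub>i\<close> or in \<open>Soc\<^sub>i\<^sub>+\<^sub>1 \<inter> K\<^sub>j\<close>. Climbing lexicographically, \<open>J\<close> steps
  of the central series of the skew brace suffice for one step of the socle series.
\<close>

lemma multipermutational_nilpotent_imp_centrally_nilpotent:
  assumes "multipermutational B" "nilpotent_group B"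
  shows "centrally_nilpotent B"
proof -
  obtain K J where K: "K 0 = {\<one>}" "K J = carrier B" "\<And>i. subgroup (K i) B"
    "\<And>i. K i \<subseteq> K (Suc i)"
    "\<And>i g h. \<lbrakk>g \<in> K (Suc i); h \<in> carrier B\<rbrakk> \<Longrightarrow> commutator B g h \<in> K i"
    using assms(2) by (rule nilpotent_groupE) (rule that)
  have main: "socle_series B i \<subseteq> center_series B (i * J)" for i
  proof (induction i)
    case 0 then show ?case by simp
  next
    case (Suc i)
    have "socle_series B (Suc i) \<inter> K j \<subseteq> center_series B (i * J + j)" for j
    proof (induction j)
      case 0
      have "\<zero> \<in> center_series B (i * J + 0)"
        using center_series_ideal by (auto simp: brace_ideal_iff dest: subbraceD(4))
      then show ?case using K(1) by (auto simp: zero_eq_one)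
    next
      case (Suc j)
      show ?case
      proof
        fix b assume "b \<in> socle_series B (Suc i) \<inter> K (Suc j)"
        then have b: "b \<in> socle_series B (Suc i)" "b \<in> socle_mod B (socle_series B i)" "b \<in> K (Suc j)"
          unfolding socle_series_Suc by auto
        have sub: "socle_series B i \<subseteq> center_series B (i * J + j)"
          using \<open>socle_series B i \<subseteq> center_series B (i * J)\<close> center_series_mono[of "i * J" "i * J + j"] by auto
        have "commutator B b c \<in> center_series B (i * J + j)" if c: "c \<in> carrier B" for c
          using Suc.IH ideal_mod_absorb(3)[OF socle_series_ideal b(1) c] K(5)[OF b(3) c] by blast
        then have "b \<in> center_mod B (center_series B (i * J + j))"
          using b(2) sub unfolding center_mod_def socle_mod_def by blast
        then show "b \<in> center_series B (i * J + Suc j)"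
          unfolding add_Suc_right center_series_Suc .
      qed
    qed
    from this[of J] show ?case
      using K(2) ideal_normal(3)[OF socle_series_ideal[of "Suc i"]] by (simp add: add.commute Int_absorb2)
  qed
  obtain n where "carrier B \<subseteq> socle_series B n"
    using assms(1) multipermutational_iff by blast
  then have "carrier B \<subseteq> center_series B (Suc (n * J))"
    using main[of n] center_series_mono[of "n * J" "Suc (n * J)"] by simp
  then have "center_series B (Suc (n * J)) = carrier B"
    using ideal_normal(3)[OF center_series_ideal] by blast
  then show ?thesis unfolding centrally_nilpotent_def by (intro exI[of _ "Suc (n * J)"]) simp
qed

end

lemma (in brace_epi) multipermutational_image:
  assumes "multipermutational B"
  shows "multipermutational Q"
proof -
  have "f ` socle_series B n \<subseteq> socle_series Q n" for n
  proof (induction n)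
    case 0 then show ?case by (simp add: f_zero)
  next
    case (Suc n)
    have "b \<in> socle_mod B {b \<in> carrier B. f b \<in> socle_series Q n}"
      if "b \<in> socle_mod B (socle_series B n)" for b
      using that Suc B.ideal_normal(3)[OF B.socle_series_ideal[of n]]
      unfolding socle_mod_def by blast
    then show ?case
      unfolding B.socle_series_Suc Q.socle_series_Suc preimage_socle_mod[symmetric] by blast
  qed
  then show ?thesis
    using assms unfolding B.multipermutational_iff Q.multipermutational_iff surj[symmetric]
    by blast
qed

section \<open>Skew braces with nilpotent additive group\<close>

lemma (in group) pi_elements_carrier_update:
  assumes "subgroup H G"
  shows "pi_elements (G\<lparr>carrier := H\<rparr>) S = H \<inter> pi_elements G S"
  using subgroup.subset[OF assms] nat_pow_consistent[of _ _ H]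
  by (auto simp: pi_elements_def)

locale nilpotent_brace = skew_brace +
  assumes finite_carrier: "finite (carrier B)"
    and add_nilpotent: "nilpotent_group (add_monoid B)"
begin

abbreviation part :: "nat set \<Rightarrow> 'a set"
  where "part S \<equiv> pi_elements (add_monoid B) S"

lemma part_carrier: "part S \<subseteq> carrier B"
  using add.pi_elements_carrier by simp

lemma part_disjoint: "\<lbrakk>x \<in> part S; x \<in> part T; S \<inter> T = {}\<rbrakk> \<Longrightarrow> x = \<zero>"
  using add.pi_elements_disjoint .

lemma part_commute: "\<lbrakk>x \<in> part S; y \<in> part T; S \<inter> T = {}\<rbrakk> \<Longrightarrow> x \<oplus> y = y \<oplus> x"
  using add.nilpotent_pi_elements_commute[OF add_nilpotent] .

lemma lam_part:
  assumes "a \<in> carrier B" "b \<in> part S"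
  shows "lam B a b \<in> part S"
  using group_hom.hom_pi_elements[OF lam_group_hom[OF assms(1)] assms(2)] .

lemma part_subgroup: "subgroup (part S) (add_monoid B)"
  using add.nilpotent_subgroup_pi_elements[OF _ add_nilpotent] finite_carrier by simp

text \<open>
  The Hall subgroups of the additive group are characteristic, hence invariant under \<open>\<lambda>\<close>; and an
  additive subgroup invariant under \<open>\<lambda>\<close> is a subbrace since \<open>a b = a + \<lambda>\<^sub>a(b)\<close>.
\<close>

lemma part_subbrace: "subbrace (part S) B"
  using part_subgroup lam_part part_carrier by (intro subbraceI) (auto simp: subset_iff)

lemma subbrace_Int:
  assumes "subbrace C B" "subbrace D B"
  shows "subbrace (C \<inter> D) B"
  using assms subgroups_Inter_pair add.subgroups_Inter_pair by (simp add: subbrace_def)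

lemma subbrace_decompose:
  assumes "subbrace D B" "d \<in> D"
  obtains u v where "u \<in> D \<inter> part S" "v \<in> D \<inter> part (- S)" "d = u \<oplus> v"
proof -
  have D: "subgroup D (add_monoid B)" by (rule subbraceD(2)[OF assms(1)])
  let ?D = "(add_monoid B)\<lparr>carrier := D\<rparr>"
  interpret D: group "?D"
    by (rule add.subgroup_carrier_update(1)[OF D])
  have "finite (carrier ?D)"
    using finite_subset[OF subbraceD(3)[OF assms(1)] finite_carrier] by simp
  moreover have "d \<in> carrier ?D" using assms(2) by simp
  ultimately obtain u v where "u \<in> pi_elements ?D S"
    "v \<in> pi_elements ?D (- S)"
    "d = u \<otimes>\<^bsub>?D\<^esub> v"
    by (rule D.pi_elements_decompose)
  then show thesis
    by (intro that[of u v]) (simp_all only: add.pi_elements_carrier_update[OF D], simp_all)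
qed

lemma part_decomposition_unique:
  assumes "u \<in> part S" "v \<in> part T" "u' \<in> part S" "v' \<in> part T" "S \<inter> T = {}"
    and "u \<oplus> v = u' \<oplus> v'"
  shows "u = u'" "v = v'"
proof -
  have c: "u \<in> carrier B" "v \<in> carrier B" "u' \<in> carrier B" "v' \<in> carrier B"
    using assms part_carrier by blast+
  have "\<ominus> u' \<oplus> u = (\<ominus> u' \<oplus> (u \<oplus> v)) \<oplus> \<ominus> v" using c by (simp add: add.m_assoc)
  also have "\<dots> = v' \<oplus> \<ominus> v" unfolding assms(6) using c by (simp add: add.m_assoc)
  finally have eq: "\<ominus> u' \<oplus> u = v' \<oplus> \<ominus> v" .
  have "\<ominus> u' \<oplus> u \<in> part S" "v' \<oplus> \<ominus> v \<in> part T"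
    using subbraceD(6,7)[OF part_subbrace] assms by simp_all
  then have 0: "\<ominus> u' \<oplus> u = \<zero>" using part_disjoint assms(5) unfolding eq by blast
  then have "u = u' \<oplus> \<zero>" using c add.r_inv_cancel[of u' u] by simp
  then show "u = u'" using c by simp
  then show "v = v'" using assms(6) c by simp
qed

text \<open>
  Which primes occur in the orders of the elements of a subgroup depends only on its cardinality, and
  a subbrace has the same cardinality in both groups.
\<close>

lemma subbrace_part_mult:
  assumes "subbrace X B" "X \<subseteq> part S"
  shows "X \<subseteq> pi_elements B S"
  using assms(2) finite_carrier subbraceD(1,2)[OF assms(1)]
    subgroup_pi_elements_iff[OF finite_carrier subbraceD(1)[OF assms(1)]]
    add.subgroup_pi_elements_iff[OF _ subbraceD(2)[OF assms(1)]] by simp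

lemma part_mult: "part S \<subseteq> pi_elements B S"
  by (rule subbrace_part_mult[OF part_subbrace subset_refl])

text \<open>
  Elements of coprime order commute for both operations. Then \<open>u + \<lambda>\<^sub>u(v) = u v = v u = \<lambda>\<^sub>v(u) + v\<close>,
  and the two additive decompositions must agree.
\<close>

lemma nilpotent_subbrace_parts:
  assumes "subbrace C B" "nilpotent_group (B\<lparr>carrier := C\<rparr>)"
    and u: "u \<in> C \<inter> part S" and v: "v \<in> C \<inter> part T" and disj: "S \<inter> T = {}"
  shows "u \<otimes> v = v \<otimes> u" "lam B u v = v"
proof -
  have C: "subgroup C B" by (rule subbraceD(1)[OF assms(1)])
  interpret C: group "B\<lparr>carrier := C\<rparr>" by (rule subgroup_carrier_update(1)[OF C])
  have "u \<in> pi_elements (B\<lparr>carrier := C\<rparr>) S" "v \<in> pi_elements (B\<lparr>carrier := C\<rparr>) T"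
    using u v part_mult unfolding pi_elements_carrier_update[OF C] by blast+
  then show comm: "u \<otimes> v = v \<otimes> u"
    using C.nilpotent_pi_elements_commute[OF assms(2) _ _ disj] by simp
  have c: "u \<in> carrier B" "v \<in> carrier B" using u v part_carrier by blast+
  have l: "lam B v u \<in> part S" "lam B u v \<in> part T" using lam_part c u v by simp_all
  have "u \<oplus> lam B u v = v \<oplus> lam B v u" using comm c by (simp add: mult_eq)
  also have "\<dots> = lam B v u \<oplus> v" using part_commute[OF l(1) _ disj] v by simp
  finally show "lam B u v = v"
    using part_decomposition_unique(2)[of u S "lam B u v" T "lam B v u" v] u v l disj by simp
qed

end

section \<open>Factoring out a primary part of the socle\<close>

definition self_normalising :: "'a set \<Rightarrow> ('a, 'b) monoid_scheme \<Rightarrow> bool"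
  where "self_normalising C G \<longleftrightarrow>
    (\<forall>x\<in>carrier G. (\<forall>c\<in>C. conjugate G x c \<in> C) \<longrightarrow> x \<in> C)"

lemma (in group) carter_subgroup_iff:
  assumes "finite (carrier G)"
  shows "carter_subgroup C G \<longleftrightarrow>
    subgroup C G \<and> nilpotent_group (G\<lparr>carrier := C\<rparr>) \<and> self_normalising C G"
proof -
  have "normalizer G C = C \<longleftrightarrow> self_normalising C G" if C: "subgroup C G"
  proof -
    have "C \<subseteq> normalizer G C"
      using subgroup_conjugate[OF C] subgroup.subset[OF C]
      by (auto simp: normalizer_iff[OF assms subgroup.subset[OF C]])
    then have "normalizer G C = C \<longleftrightarrow> normalizer G C \<subseteq> C" by blast
    also have "\<dots> \<longleftrightarrow> self_normalising C G"
      by (auto simp: normalizer_iff[OF assms subgroup.subset[OF C]] self_normalising_def)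
    finally show ?thesis .
  qed
  then show ?thesis unfolding carter_subgroup_def by blast
qed

text \<open>
  One induction step: \<open>f\<close> models the quotient by an ideal \<open>A\<close> that is a \<open>p\<close>-group inside the socle. There
  the additive and the multiplicative structure coincide, and \<open>B\<close> acts on \<open>A\<close> by \<open>\<lambda>\<close>, which is
  the same as by conjugation.
\<close>

locale socle_quotient = brace_epi B Q f + B: nilpotent_brace B + Q: nilpotent_brace Q
  for B :: "('a, 'b) ring_scheme" (structure) and Q :: "('c, 'd) ring_scheme" and f +
  fixes A p
  assumes kernel: "A = {b \<in> carrier B. f b = \<zero>\<^bsub>Q\<^esub>}"
    and kernel_socle: "A \<subseteq> brace_socle B"
    and kernel_part: "A \<subseteq> B.part {p}"
    and prime_p: "prime p"
begin

abbreviation part :: "nat set \<Rightarrow> 'a set"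
  where "part S \<equiv> pi_elements (add_monoid B) S"

lemma A_ideal: "brace_ideal A B"
proof -
  have "brace_ideal {b \<in> carrier B. f b \<in> {\<zero>\<^bsub>Q\<^esub>}} B" by (rule ideal_preimage[OF Q.zero_ideal])
  then show ?thesis unfolding kernel by simp
qed

lemma A_closed:
  shows "A \<subseteq> carrier B" "subbrace A B" "\<And>b a. \<lbrakk>b \<in> carrier B; a \<in> A\<rbrakk> \<Longrightarrow> lam B b a \<in> A"
  using A_ideal B.ideal_normal(3) by (auto simp: B.brace_ideal_iff)

lemma A_add_commute: "\<lbrakk>a \<in> A; b \<in> carrier B\<rbrakk> \<Longrightarrow> a \<oplus> b = b \<oplus> a"
  using kernel_socle by (auto simp: B.socle_iff)

lemma f_part: "b \<in> part S \<Longrightarrow> f b \<in> Q.part S"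
  using add.hom_pi_elements .

lemma f_eq_iff_A:
  assumes "a \<in> carrier B" "b \<in> carrier B"
  shows "f a = f b \<longleftrightarrow> \<ominus> b \<oplus> a \<in> A"
proof
  assume "f a = f b"
  then show "\<ominus> b \<oplus> a \<in> A" using assms f_closed by (simp add: kernel f_add f_minus)
next
  assume "\<ominus> b \<oplus> a \<in> A"
  then have "f b \<oplus>\<^bsub>Q\<^esub> f (\<ominus> b \<oplus> a) = f b" using assms f_closed by (simp add: kernel)
  then show "f a = f b" using assms f_closed by (simp add: f_add f_minus)
qed

text \<open>
  The kernel is a \<open>p\<close>-group, so \<open>f\<close> loses nothing on the \<open>p'\<close>-part.
\<close>

lemma f_eq_part_imp_eq:
  assumes "a \<in> part (- {p})" "b \<in> part (- {p})" "f a = f b"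
  shows "a = b"
proof -
  have c: "a \<in> carrier B" "b \<in> carrier B" using assms B.part_carrier by blast+
  have "\<ominus> b \<oplus> a \<in> part {p}" using f_eq_iff_A[OF c] assms(3) kernel_part by blast
  moreover have "\<ominus> b \<oplus> a \<in> part (- {p})"
    using B.subbraceD(6,7)[OF B.part_subbrace] assms by simp
  ultimately have "\<ominus> b \<oplus> a = \<zero>" by (rule B.part_disjoint) simp
  then show ?thesis using c B.add.r_inv_cancel[of b a] by simp
qed

text \<open>
  The map \<open>\<phi>\<close> is the identity when the lemma serves to find fixed points, and an endomorphism
  induced by conjugation when it serves to conjugate complements.
\<close>

lemma cocycle_trivial:
  assumes "subbrace H B" "H \<subseteq> part (- {p})"
    and \<phi>: "\<And>h. h \<in> H \<Longrightarrow> \<phi> h \<in> carrier B"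
    and \<delta>: "\<And>h. h \<in> H \<Longrightarrow> \<delta> h \<in> A"
    and cocycle: "\<And>h k. \<lbrakk>h \<in> H; k \<in> H\<rbrakk> \<Longrightarrow> \<delta> (h \<otimes> k) = \<delta> h \<oplus> lam B (\<phi> h) (\<delta> k)"
  obtains a where "a \<in> A" "\<And>h. h \<in> H \<Longrightarrow> \<delta> h \<oplus> lam B (\<phi> h) a = a"
proof -
  let ?A = "(add_monoid B)\<lparr>carrier := A\<rparr>" and ?H = "B\<lparr>carrier := H\<rparr>"
  have A: "subgroup A (add_monoid B)" by (rule B.subbraceD(2)[OF A_closed(2)])
  have H: "subgroup H B" "subgroup H (add_monoid B)" using B.subbraceD(1,2)[OF assms(1)] .
  interpret A: group ?A by (rule B.add.subgroup_carrier_update(1)[OF A])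
  interpret A: comm_group ?A
    by (rule A.group_comm_groupI) (use A_add_commute A_closed(1) in auto)
  have fin: "finite (carrier (add_monoid B))" using B.finite_carrier by simp
  have "prime_factors (card A) \<subseteq> {p}"
    using B.add.subgroup_pi_elements_iff[OF _ A] kernel_part fin by simp
  moreover have "prime_factors (card H) \<subseteq> - {p}"
    using B.add.subgroup_pi_elements_iff[OF _ H(2)] assms(2) fin by simp
  moreover have "card A > 0" "card H > 0"
    using subgroup.finite_imp_card_positive[OF A] subgroup.finite_imp_card_positive[OF H(2)] fin by simp_all
  ultimately have coprime: "coprime (order ?H) (order ?A)"
    by (intro prime_factors_disjoint_coprime) (auto simp: order_def)
  have "finite A" "finite H"
    using A_closed(1) B.subbraceD(3)[OF assms(1)] B.finite_carrier finite_subset by blast+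
  then have fins: "finite (carrier ?H)" "finite (carrier ?A)" by simp_all
  have act: "lam B (\<phi> h) \<in> hom ?A ?A" if "h \<in> carrier ?H" for h
    using that A_closed(1,3) \<phi> by (auto simp: hom_def B.lam_add subset_iff)
  obtain a where "a \<in> carrier ?A" "\<And>h. h \<in> carrier ?H \<Longrightarrow> \<delta> h \<otimes>\<^bsub>?A\<^esub> lam B (\<phi> h) a = a"
    using A.cocycle_is_coboundary[OF B.subgroup_carrier_update(1)[OF H(1)] fins coprime act,
        of "\<lambda>h. h" \<delta>] \<delta> cocycle by auto
  then show thesis using that by simp
qed

end

section \<open>Lifting a Carter subgroup\<close>

locale nilpotent_in_quotient = socle_quotient +
  fixes E
  assumes E_subbrace: "subbrace E Q"
    and E_nilpotent: "nilpotent_group (Q\<lparr>carrier := E\<rparr>)"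
begin

text \<open>
  With \<open>lift\<close> the full preimage of \<open>E\<close> and \<open>hall\<close> its Hall \<open>p'\<close>-subgroup, the normaliser of \<open>hall\<close> in
  \<open>lift\<close> is going to be the Carter subgroup of \<open>B\<close> above \<open>E\<close>, and it is \<open>fixed\<close> times \<open>hall\<close>.
\<close>

definition lift :: "'a set" where "lift = {b \<in> carrier B. f b \<in> E}"

definition hall :: "'a set" where "hall = lift \<inter> part (- {p})"

definition fixed :: "'a set" where "fixed = {u \<in> lift \<inter> part {p}. \<forall>h\<in>hall. lam B h u = u}"

definition hall_norm :: "'a set" where "hall_norm = {d \<in> lift. \<forall>h\<in>hall. conjugate B d h \<in> hall}"

lemma lift_subbrace: "subbrace lift B"
  unfolding lift_def by (rule subbrace_preimage[OF E_subbrace])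

lemma hall_subbrace: "subbrace hall B"
  unfolding hall_def by (rule B.subbrace_Int[OF lift_subbrace B.part_subbrace])

lemma lift_carrier: "lift \<subseteq> carrier B" and hall_carrier: "hall \<subseteq> carrier B"
  using B.subbraceD(3) lift_subbrace hall_subbrace by blast+

lemma A_subset_lift: "A \<subseteq> lift"
  using Q.subbraceD(4)[OF E_subbrace] by (auto simp: lift_def kernel)

lemma f_lift: "f ` lift = E"
  using surj Q.subbraceD(3)[OF E_subbrace] by (auto simp: lift_def)

lemma fixed_props:
  assumes "u \<in> fixed"
  shows "u \<in> lift" "u \<in> part {p}" "u \<in> carrier B" "\<And>h. h \<in> hall \<Longrightarrow> lam B h u = u"
  using assms lift_carrier by (auto simp: fixed_def)

lemma hall_props:
  assumes "h \<in> hall"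
  shows "h \<in> lift" "h \<in> part (- {p})" "h \<in> carrier B"
  using assms lift_carrier by (auto simp: hall_def)

text \<open>
  Modulo \<open>A\<close> the two parts act trivially on each other, since \<open>E\<close> is nilpotent. On \<open>hall\<close> the map \<open>f\<close> is
  injective, so there the action is trivial outright; on the \<open>p\<close>-part it is trivial modulo \<open>A\<close>.
\<close>

lemma p_part_fixes_hall:
  assumes "u \<in> lift \<inter> part {p}" "h \<in> hall"
  shows "lam B u h = h" and "f (lam B h u) = f u"
proof -
  have c: "u \<in> carrier B" "h \<in> carrier B" using assms lift_carrier hall_props by blast+
  have fu: "f u \<in> E \<inter> Q.part {p}" and fh: "f h \<in> E \<inter> Q.part (- {p})"
    using assms hall_props f_part by (auto simp: lift_def)
  have "f (lam B u h) = f h"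
    using Q.nilpotent_subbrace_parts(2)[OF E_subbrace E_nilpotent fu fh] c by (simp add: f_lam)
  then show "lam B u h = h"
    using f_eq_part_imp_eq[of "lam B u h" h] B.lam_part[OF c(1)] hall_props(2)[OF assms(2)] by blast
  show "f (lam B h u) = f u"
    using Q.nilpotent_subbrace_parts(2)[OF E_subbrace E_nilpotent fh fu] c by (simp add: f_lam)
qed

lemma p_part_mult_hall:
  assumes "u \<in> lift \<inter> part {p}" "h \<in> hall"
  shows "u \<otimes> h = u \<oplus> h"
  using p_part_fixes_hall(1)[OF assms] assms lift_carrier hall_props by (simp add: B.mult_eq subset_iff)

lemma fixed_hall_commute:
  assumes "u \<in> fixed" "h \<in> hall"
  shows "u \<otimes> h = h \<otimes> u"
proof -
  have "u \<otimes> h = u \<oplus> h" using p_part_mult_hall fixed_props[OF assms(1)] assms(2) by blast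
  also have "\<dots> = h \<oplus> u"
    using B.part_commute[OF fixed_props(2)[OF assms(1)] hall_props(2)[OF assms(2)]] by blast
  also have "\<dots> = h \<otimes> u" using fixed_props[OF assms(1)] hall_props[OF assms(2)] assms(2)
    by (simp add: B.mult_eq)
  finally show ?thesis .
qed

text \<open>
  For \<open>u\<close> in \<open>fixed\<close>, \<open>\<lambda>\<^sub>u\<close> commutes with each \<open>\<lambda>\<^sub>h\<close> because \<open>u\<close> commutes with \<open>h\<close>; so it preserves the
  common fixed points.
\<close>

lemma fixed_subbrace: "subbrace fixed B"
proof (rule B.subbraceI)
  have P: "subbrace (lift \<inter> part {p}) B" by (rule B.subbrace_Int[OF lift_subbrace B.part_subbrace])
  note P = B.subbraceD[OF P]
  show "subgroup fixed (add_monoid B)"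
  proof (rule B.add.subgroupI)
    show "fixed \<subseteq> carrier B" using fixed_props(3) by blast
    have "\<zero> \<in> fixed" using P(4) hall_props by (simp add: fixed_def)
    then show "fixed \<noteq> {}" by blast
    show "\<ominus> u \<in> fixed" if u: "u \<in> fixed" for u
      using P(7) fixed_props[OF u] hall_props(3) by (simp add: fixed_def B.lam_minus)
    show "u \<oplus> v \<in> fixed" if u: "u \<in> fixed" and v: "v \<in> fixed" for u v
      using P(6) fixed_props[OF u] fixed_props[OF v] hall_props(3) by (simp add: fixed_def B.lam_add)
  qed
  have lam_fixed: "lam B u v \<in> fixed" if u: "u \<in> lift \<inter> part {p}" and v: "v \<in> fixed"
    and comm: "\<And>h. h \<in> hall \<Longrightarrow> u \<otimes> h = h \<otimes> u" for u v
  proof -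
    have uB: "u \<in> carrier B" using u lift_carrier by blast
    have "lam B h (lam B u v) = lam B u v" if h: "h \<in> hall" for h
    proof -
      have "lam B h (lam B u v) = lam B (u \<otimes> h) v"
        using comm[OF h] uB hall_props(3)[OF h] fixed_props(3)[OF v] by (simp add: B.lam_lam)
      also have "\<dots> = lam B u v"
        using uB hall_props(3)[OF h] fixed_props(3)[OF v] fixed_props(4)[OF v h] by (simp add: B.lam_lam)
      finally show ?thesis .
    qed
    then show ?thesis using P(10)[OF u] fixed_props[OF v] by (simp add: fixed_def)
  qed
  show "lam B u v \<in> fixed" if "u \<in> fixed" "v \<in> fixed" for u v
    using lam_fixed[OF _ that(2)] fixed_props(1,2)[OF that(1)] fixed_hall_commute[OF that(1)] by blast
  show "lam B (inv u) v \<in> fixed" if u: "u \<in> fixed" and v: "v \<in> fixed" for u v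
  proof (rule lam_fixed[OF _ v])
    show "inv u \<in> lift \<inter> part {p}" using P(9) fixed_props(1,2)[OF u] by blast
    show "inv u \<otimes> h = h \<otimes> inv u" if "h \<in> hall" for h
      using B.commute_inv[OF fixed_props(3)[OF u] hall_props(3)[OF that] fixed_hall_commute[OF u that]] .
  qed
qed

lemma decompose_lift:
  assumes "d \<in> lift"
  obtains u k where "u \<in> lift \<inter> part {p}" "k \<in> hall" "d = u \<oplus> k" "d = u \<otimes> k"
proof -
  obtain u k where uk: "u \<in> lift \<inter> part {p}" "k \<in> lift \<inter> part (- {p})" "d = u \<oplus> k"
    using B.subbrace_decompose[OF lift_subbrace assms] .
  then have "k \<in> hall" by (simp add: hall_def)
  then show thesis using that[OF uk(1) _ uk(3)] p_part_mult_hall[OF uk(1)] uk(3) by simp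
qed

text \<open>
  If a \<open>p\<close>-element \<open>u\<close> conjugates \<open>h\<close> into \<open>h' \<in> hall\<close>, then \<open>u + h = u h = h' u = \<lambda>\<^sub>h\<^sub>'(u) + h'\<close>, and
  uniqueness of the additive decomposition yields \<open>h = h'\<close> and \<open>\<lambda>\<^sub>h(u) = u\<close>.
\<close>

lemma hall_norm_eq_mult: "hall_norm = {u \<otimes> k | u k. u \<in> fixed \<and> k \<in> hall}"
proof (intro equalityI subsetI)
  fix d assume d: "d \<in> hall_norm"
  then have dD: "d \<in> lift" and dn: "\<And>h. h \<in> hall \<Longrightarrow> conjugate B d h \<in> hall" by (auto simp: hall_norm_def)
  obtain u k where uk: "u \<in> lift \<inter> part {p}" "k \<in> hall" "d = u \<otimes> k" using decompose_lift[OF dD] .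
  have c: "u \<in> carrier B" "k \<in> carrier B" using uk lift_carrier hall_carrier by blast+
  have hall: "subgroup hall B" by (rule B.subbraceD(1)[OF hall_subbrace])
  have "lam B h u = u" if h: "h \<in> hall" for h
  proof -
    have hB: "h \<in> carrier B" using hall_props(3)[OF h] .
    have kH: "conjugate B (inv k) h \<in> hall"
      using B.subgroup_conjugate[OF hall _ h] subgroup.m_inv_closed[OF hall uk(2)] by blast
    have "conjugate B d (conjugate B (inv k) h) = conjugate B u h"
      using c hB by (simp add: uk(3) conjugate_def B.m_assoc B.inv_mult_group)
    then have h': "conjugate B u h \<in> hall" using dn[OF kH] by simp
    let ?h = "conjugate B u h"
    have "u \<oplus> h = u \<otimes> h" using p_part_mult_hall[OF uk(1) h] by simp
    also have "\<dots> = ?h \<otimes> u" using c hB by (simp add: conjugate_def B.m_assoc)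
    also have "\<dots> = ?h \<oplus> lam B ?h u" using c hall_props(3)[OF h'] by (simp add: B.mult_eq)
    also have "\<dots> = lam B ?h u \<oplus> ?h"
      using B.part_commute[OF hall_props(2)[OF h'] B.lam_part[of ?h u "{p}"]] hall_props(3)[OF h'] uk(1)
      by simp
    finally have eq: "u \<oplus> h = lam B ?h u \<oplus> ?h" .
    have lu: "lam B ?h u \<in> part {p}" using B.lam_part hall_props(3)[OF h'] uk(1) by blast
    note uniq = B.part_decomposition_unique[OF _ hall_props(2)[OF h] lu hall_props(2)[OF h'] _ eq]
    have "u = lam B ?h u" "h = ?h" using uniq uk(1) by simp_all
    then show ?thesis by simp
  qed
  then have "u \<in> fixed" using uk(1) by (simp add: fixed_def)
  then show "d \<in> {u \<otimes> k | u k. u \<in> fixed \<and> k \<in> hall}" using uk by blast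
next
  fix d assume "d \<in> {u \<otimes> k | u k. u \<in> fixed \<and> k \<in> hall}"
  then obtain u k where uk: "u \<in> fixed" "k \<in> hall" "d = u \<otimes> k" by blast
  have hall: "subgroup hall B" by (rule B.subbraceD(1)[OF hall_subbrace])
  have "conjugate B d h \<in> hall" if h: "h \<in> hall" for h
  proof -
    have kh: "conjugate B k h \<in> hall" by (rule B.subgroup_conjugate[OF hall uk(2) h])
    have "conjugate B d h = conjugate B u (conjugate B k h)"
      unfolding uk(3) using fixed_props(3)[OF uk(1)] hall_props(3)[OF uk(2)] hall_props(3)[OF h]
      by (rule B.conjugate_conjugate)
    also have "\<dots> = conjugate B k h"
      using fixed_hall_commute[OF uk(1) kh] fixed_props(3)[OF uk(1)] hall_props(3)[OF kh]
      by (simp add: B.conjugate_eq_iff_commute)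
    finally show ?thesis using kh by simp
  qed
  moreover have "d \<in> lift" using uk fixed_props(1) hall_props(1) B.subbraceD(8)[OF lift_subbrace] by simp
  ultimately show "d \<in> hall_norm" by (simp add: hall_norm_def)
qed

text \<open>
  The additive description is what makes the multiplicative normaliser closed under addition.
\<close>

lemma hall_norm_eq_add: "hall_norm = {u \<oplus> k | u k. u \<in> fixed \<and> k \<in> hall}"
proof -
  have "u \<otimes> k = u \<oplus> k" if "u \<in> fixed" "k \<in> hall" for u k
    using p_part_mult_hall that fixed_props by blast
  then show ?thesis unfolding hall_norm_eq_mult by (intro Collect_cong) metis
qed

lemma hall_norm_subbrace: "subbrace hall_norm B"
proof -
  have "subgroup hall_norm B"
    unfolding hall_norm_eq_mult
    by (rule B.subgroup_commuting_product[OF B.subbraceD(1)[OF fixed_subbrace]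
          B.subbraceD(1)[OF hall_subbrace] fixed_hall_commute])
  moreover have "subgroup hall_norm (add_monoid B)"
    unfolding hall_norm_eq_add
    by (rule B.add.subgroup_commuting_product[OF B.subbraceD(2)[OF fixed_subbrace]
          B.subbraceD(2)[OF hall_subbrace]])
      (use B.part_commute fixed_props(2) hall_props(2) in blast)
  ultimately show ?thesis by (simp add: subbrace_def)
qed

text \<open>
  A product of two commuting nilpotent groups: \<open>fixed\<close> is a \<open>p\<close>-group, and \<open>hall\<close> embeds into \<open>E\<close>.
\<close>

lemma hall_norm_nilpotent: "nilpotent_group (B\<lparr>carrier := hall_norm\<rparr>)"
proof -
  have hall: "subgroup hall B" and fixed: "subgroup fixed B"
    using B.subbraceD(1) hall_subbrace fixed_subbrace by blast+
  have "fixed \<subseteq> pi_elements B {p}"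
    using fixed_props(2) by (intro B.subbrace_part_mult[OF fixed_subbrace]) blast
  then have "nilpotent_group (B\<lparr>carrier := fixed\<rparr>)"
    by (rule B.nilpotent_subgroup_p_group[OF B.finite_carrier prime_p fixed])
  moreover have "nilpotent_group (B\<lparr>carrier := hall\<rparr>)"
  proof (rule mult.nilpotent_if_inj_image[OF hall])
    show "inj_on f hall" using f_eq_part_imp_eq hall_props(2) by (meson inj_onI)
    show "nilpotent_group (Q\<lparr>carrier := f ` hall\<rparr>)"
    proof (rule Q.nilpotent_subgroup[OF _ _ _ E_nilpotent])
      show "subgroup E Q" by (rule Q.subbraceD(1)[OF E_subbrace])
      show "subgroup (f ` hall) Q" by (rule mult.subgroup_img_is_subgroup[OF hall])
      show "f ` hall \<subseteq> E" using hall_props(1) by (auto simp: lift_def)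
    qed
  qed
  ultimately show ?thesis
    unfolding hall_norm_eq_mult using fixed_hall_commute
    by (intro B.nilpotent_commuting_product[OF fixed hall])
qed

text \<open>
  Passing to the normaliser loses nothing modulo \<open>A\<close>: for a \<open>p\<close>-element \<open>u\<close>, the coset of \<open>u\<close> modulo \<open>A\<close>
  is fixed by \<open>hall\<close>, and since \<open>hall\<close> has order prime to \<open>p\<close> it contains a fixed point.
\<close>

lemma f_hall_norm: "f ` hall_norm = E"
proof
  show "f ` hall_norm \<subseteq> E" by (auto simp: hall_norm_def lift_def)
  show "E \<subseteq> f ` hall_norm"
  proof
    fix e assume "e \<in> E"
    then obtain d where d: "d \<in> lift" "e = f d" using f_lift by blast
    obtain u k where uk: "u \<in> lift \<inter> part {p}" "k \<in> hall" "d = u \<oplus> k" using decompose_lift[OF d(1)] .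
    have uB: "u \<in> carrier B" using uk lift_carrier by blast
    have hall_mult: "h \<otimes> k \<in> hall" if "h \<in> hall" "k \<in> hall" for h k
      using that B.subbraceD(8)[OF hall_subbrace] by blast
    have \<delta>: "\<ominus> u \<oplus> lam B h u \<in> A" if h: "h \<in> hall" for h
      using p_part_fixes_hall(2)[OF uk(1) h] f_eq_iff_A[of "lam B h u" u] uB hall_props(3)[OF h] by simp
    \<comment> \<open>The deviation of \<open>u\<close> from being fixed is a cocycle; bounding it by \<open>a\<close> makes \<open>u + a\<close> fixed.\<close>
    have cocycle: "\<ominus> u \<oplus> lam B (h \<otimes> k) u = (\<ominus> u \<oplus> lam B h u) \<oplus> lam B h (\<ominus> u \<oplus> lam B k u)"
      if "h \<in> hall" "k \<in> hall" for h k
      using uB hall_props(3)[OF that(1)] hall_props(3)[OF that(2)]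
      by (simp add: B.lam_lam B.lam_add B.lam_minus B.add.m_assoc)
    obtain a where a: "a \<in> A" "\<And>h. h \<in> hall \<Longrightarrow> \<ominus> u \<oplus> lam B h u \<oplus> lam B h a = a"
      using cocycle_trivial[of hall "\<lambda>h. h" "\<lambda>h. \<ominus> u \<oplus> lam B h u"] hall_subbrace hall_props \<delta> cocycle
      by blast
    have aB: "a \<in> carrier B" using a(1) A_closed(1) by blast
    have "lam B h (u \<oplus> a) = u \<oplus> a" if h: "h \<in> hall" for h
    proof -
      have "lam B h (u \<oplus> a) = u \<oplus> (\<ominus> u \<oplus> lam B h u \<oplus> lam B h a)"
        using uB aB hall_props(3)[OF h] by (simp add: B.lam_add B.add.m_assoc)
      then show ?thesis using a(2)[OF h] by simp
    qed
    moreover have "u \<oplus> a \<in> lift \<inter> part {p}"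
      using uk(1) a(1) A_subset_lift kernel_part B.subbraceD(6)[OF lift_subbrace]
        B.subbraceD(6)[OF B.part_subbrace] by blast
    ultimately have "u \<oplus> a \<in> fixed" by (simp add: fixed_def)
    then have "(u \<oplus> a) \<oplus> k \<in> hall_norm" using uk(2) unfolding hall_norm_eq_add by blast
    moreover have "f ((u \<oplus> a) \<oplus> k) = f d"
      using uB aB a(1) hall_props(3)[OF uk(2)] f_closed by (simp add: f_add uk(3) kernel)
    ultimately show "e \<in> f ` hall_norm" using d(2) by (metis imageI)
  qed
qed

text \<open>
  Anything normalising \<open>hall_norm\<close> normalises its image \<open>E\<close> and so lies in \<open>lift\<close>; it also
  normalises \<open>hall\<close>, which consists of the \<open>p'\<close>-elements of \<open>hall_norm\<close>.
\<close>

lemma hall_norm_self_normalising: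
  assumes "self_normalising E Q"
  shows "self_normalising hall_norm B"
  unfolding self_normalising_def
proof (intro ballI impI)
  fix x assume x: "x \<in> carrier B" and norm: "\<forall>c\<in>hall_norm. conjugate B x c \<in> hall_norm"
  have CB: "hall_norm \<subseteq> carrier B" by (rule B.subbraceD(3)[OF hall_norm_subbrace])
  have "conjugate Q (f x) e \<in> E" if "e \<in> E" for e
  proof -
    have "e \<in> f ` hall_norm" unfolding f_hall_norm by (rule that)
    then obtain c where c: "c \<in> hall_norm" "e = f c" by blast
    have "conjugate Q (f x) e = f (conjugate B x c)"
      unfolding c(2) using mult.hom_conjugate[OF x subsetD[OF CB c(1)]] by simp
    moreover have "f (conjugate B x c) \<in> f ` hall_norm" using norm c(1) by blast
    ultimately show ?thesis by (simp add: f_hall_norm)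
  qed
  then have "f x \<in> E" using assms f_closed[OF x] by (simp add: self_normalising_def)
  then have xD: "x \<in> lift" using x by (simp add: lift_def)
  have "conjugate B x h \<in> hall" if h: "h \<in> hall" for h
  proof -
    have "h = \<one> \<otimes> h" using hall_props(3)[OF h] by simp
    then have "h \<in> hall_norm" using h B.subbraceD(5)[OF fixed_subbrace] unfolding hall_norm_eq_mult by blast
    then have "conjugate B x h \<in> hall_norm" using norm by blast
    then obtain u k where uk: "u \<in> fixed" "k \<in> hall" "conjugate B x h = u \<otimes> k" unfolding hall_norm_eq_mult by blast
    have c: "u \<in> carrier B" "k \<in> carrier B" using fixed_props(3)[OF uk(1)] hall_props(3)[OF uk(2)] .
    have "h \<in> pi_elements B (- {p})" using hall_props(2)[OF h] B.part_mult by blast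
    then have 1: "u \<otimes> k \<in> pi_elements B (- {p})"
      unfolding uk(3)[symmetric] using B.pi_elements_conjugate x by blast
    have kp: "k \<in> pi_elements B (- {p})" and up: "u \<in> pi_elements B {p}"
      using hall_props(2)[OF uk(2)] fixed_props(2)[OF uk(1)] B.part_mult by blast+
    have "u \<in> pi_elements B (- {p} \<union> - {p})"
      by (rule B.pi_elements_factor[OF up kp fixed_hall_commute[OF uk(1,2)] 1])
    then have "u = \<one>" using B.pi_elements_disjoint[OF up] by simp
    then show ?thesis using uk c by simp
  qed
  then show "x \<in> hall_norm" using xD by (simp add: hall_norm_def)
qed

end

section \<open>Projecting a Carter subgroup\<close>

definition subbrace_carter :: "('a, 'b) ring_scheme \<Rightarrow> 'a set \<Rightarrow> bool"
  where "subbrace_carter B C \<longleftrightarrow>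
    subbrace C B \<and> nilpotent_group (B\<lparr>carrier := C\<rparr>) \<and> self_normalising C B"

context nilpotent_in_quotient
begin

lemma hall_norm_eq_Int: "hall_norm = lift \<inter> normalizer B hall"
  using lift_carrier B.normalizer_iff[OF B.finite_carrier hall_carrier] by (auto simp: hall_norm_def)

lemma hall_norm_carter:
  assumes "self_normalising E Q"
  shows "subbrace_carter B hall_norm"
  using hall_norm_subbrace hall_norm_nilpotent hall_norm_self_normalising[OF assms]
  by (simp add: subbrace_carter_def)

lemma lift_conjugate:
  assumes "x \<in> carrier B" "\<forall>e\<in>E. conjugate Q (f x) e \<in> E" "d \<in> lift"
  shows "conjugate B x d \<in> lift"
proof -
  have "d \<in> carrier B" "f d \<in> E" using assms(3) by (simp_all add: lift_def)
  then show ?thesis using assms(1,2) by (simp add: lift_def mult.hom_conjugate)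
qed

text \<open>
  If \<open>f x\<close> normalises \<open>E\<close>, then \<open>x\<close> moves \<open>hall\<close> to another complement of \<open>A\<close> in \<open>A hall\<close>. The two are
  conjugate under \<open>A\<close>, so \<open>x\<close> may be changed by an element of \<open>A\<close> to an element \<open>y\<close> that normalises
  \<open>hall\<close>. As \<open>y\<close> also normalises \<open>lift\<close>, it normalises \<open>hall_norm\<close>, so it lies in it.
\<close>

lemma self_normalising_descends:
  assumes "self_normalising hall_norm B"
  shows "self_normalising E Q"
  unfolding self_normalising_def
proof (intro ballI impI)
  fix q assume "q \<in> carrier Q" and norm: "\<forall>e\<in>E. conjugate Q q e \<in> E"
  then obtain x where x: "x \<in> carrier B" "q = f x" using surj by blast
  have hall: "subgroup hall B" by (rule B.subbraceD(1)[OF hall_subbrace])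
  \<comment> \<open>The image of the conjugate in the nilpotent group \<open>E\<close> has order prime to \<open>p\<close>, so the image of its
    \<open>p\<close>-part is trivial.\<close>
  have split: "\<exists>u k. u \<in> A \<and> k \<in> hall \<and> conjugate B x h = u \<oplus> k" if h: "h \<in> hall" for h
  proof -
    have hB: "h \<in> carrier B" using hall_props(3)[OF h] .
    have "conjugate B x h \<in> lift" using lift_conjugate[OF x(1) norm[unfolded x(2)] hall_props(1)[OF h]] .
    then obtain u k where uk: "u \<in> lift \<inter> part {p}" "k \<in> hall" "conjugate B x h = u \<oplus> k" "conjugate B x h = u \<otimes> k"
      by (rule decompose_lift)
    have c: "u \<in> carrier B" "k \<in> carrier B" using uk lift_carrier hall_carrier by blast+
    have fu: "f u \<in> E \<inter> Q.part {p}" and fk: "f k \<in> E \<inter> Q.part (- {p})"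
      using uk(1) hall_props[OF uk(2)] f_part by (auto simp: lift_def)
    have comm: "f u \<otimes>\<^bsub>Q\<^esub> f k = f k \<otimes>\<^bsub>Q\<^esub> f u"
      using Q.nilpotent_subbrace_parts(1)[OF E_subbrace E_nilpotent fu fk] by simp
    have "h \<in> pi_elements B (- {p})" using hall_props(2)[OF h] B.part_mult by blast
    then have "conjugate B x h \<in> pi_elements B (- {p})" using B.pi_elements_conjugate x(1) by blast
    then have "f (u \<otimes> k) \<in> pi_elements Q (- {p})" unfolding uk(4) by (rule mult.hom_pi_elements)
    then have 1: "f u \<otimes>\<^bsub>Q\<^esub> f k \<in> pi_elements Q (- {p})" using c by simp
    have kp: "f k \<in> pi_elements Q (- {p})" and up: "f u \<in> pi_elements Q {p}"
      using fu fk Q.part_mult by blast+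
    have "f u \<in> pi_elements Q (- {p} \<union> - {p})"
      by (rule Q.pi_elements_factor[OF up kp comm 1])
    then have "f u = \<one>\<^bsub>Q\<^esub>" using Q.pi_elements_disjoint[OF up] by simp
    then have "u \<in> A" using c(1) by (simp add: kernel Q.zero_eq_one)
    then show ?thesis using uk by blast
  qed
  define \<delta> where "\<delta> h = (SOME u. u \<in> A \<and> (\<exists>k. k \<in> hall \<and> conjugate B x h = u \<oplus> k))" for h
  have ex: "\<exists>k. k \<in> hall \<and> conjugate B x h = \<delta> h \<oplus> k" and \<delta>A: "\<delta> h \<in> A" if "h \<in> hall" for h
    using someI_ex[OF split[OF that, simplified]] unfolding \<delta>_def by auto
  define \<phi> where "\<phi> h = (SOME k. k \<in> hall \<and> conjugate B x h = \<delta> h \<oplus> k)" for h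
  have \<phi>hall: "\<phi> h \<in> hall" and eq: "conjugate B x h = \<delta> h \<oplus> \<phi> h" if "h \<in> hall" for h
    using someI_ex[OF ex[OF that]] unfolding \<phi>_def by auto
  have \<delta>B: "\<delta> h \<in> carrier B" if "h \<in> hall" for h using \<delta>A[OF that] A_closed(1) by blast
  have \<phi>B: "\<phi> h \<in> carrier B" if "h \<in> hall" for h using hall_props(3)[OF \<phi>hall[OF that]] .
  have A_mult: "a \<otimes> b = a \<oplus> b" if "a \<in> A" "b \<in> carrier B" for a b
    using B.socle_mult kernel_socle that by blast
  have conj_A: "b \<otimes> a = lam B b a \<otimes> b" if "b \<in> carrier B" "a \<in> A" for a b
  proof -
    have "a \<in> carrier B" using that(2) A_closed(1) by blast
    then have "b \<otimes> a = conjugate B b a \<otimes> b" using that(1) by (simp add: conjugate_def B.m_assoc)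
    then show ?thesis using B.socle_conjugate[OF that(1)] that(2) kernel_socle by auto
  qed
  have "\<delta> (h \<otimes> k) = \<delta> h \<oplus> lam B (\<phi> h) (\<delta> k)" if h: "h \<in> hall" and k: "k \<in> hall" for h k
  proof -
    let ?l = "lam B (\<phi> h) (\<delta> k)"
    have hk: "h \<otimes> k \<in> hall" using B.subbraceD(8)[OF hall_subbrace h k] .
    have lA: "?l \<in> A" using A_closed(3)[OF \<phi>B[OF h] \<delta>A[OF k]] .
    have lB: "?l \<in> carrier B" using lA A_closed(1) by blast
    have \<phi>\<phi>: "\<phi> h \<otimes> \<phi> k \<in> hall" using B.subbraceD(8)[OF hall_subbrace \<phi>hall[OF h] \<phi>hall[OF k]] .
    have "\<delta> (h \<otimes> k) \<oplus> \<phi> (h \<otimes> k) = conjugate B x h \<otimes> conjugate B x k"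
      using eq[OF hk] B.conjugate_mult[OF x(1) hall_props(3)[OF h] hall_props(3)[OF k]] by simp
    also have "\<dots> = (\<delta> h \<otimes> \<phi> h) \<otimes> (\<delta> k \<otimes> \<phi> k)"
      unfolding eq[OF h] eq[OF k] A_mult[OF \<delta>A[OF h] \<phi>B[OF h]] A_mult[OF \<delta>A[OF k] \<phi>B[OF k]] ..
    also have "\<dots> = \<delta> h \<otimes> (\<phi> h \<otimes> \<delta> k) \<otimes> \<phi> k"
      using \<delta>B \<phi>B h k by (simp add: B.m_assoc)
    also have "\<dots> = (\<delta> h \<otimes> ?l) \<otimes> (\<phi> h \<otimes> \<phi> k)"
      unfolding conj_A[OF \<phi>B[OF h] \<delta>A[OF k]] using \<delta>B \<phi>B h k lB by (simp add: B.m_assoc)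
    also have "\<delta> h \<otimes> ?l = \<delta> h \<oplus> ?l"
      by (rule A_mult[OF \<delta>A[OF h] lB])
    also have "(\<delta> h \<oplus> ?l) \<otimes> (\<phi> h \<otimes> \<phi> k) = (\<delta> h \<oplus> ?l) \<oplus> (\<phi> h \<otimes> \<phi> k)"
      using B.subbraceD(6)[OF A_closed(2) \<delta>A[OF h] lA] hall_props(3)[OF \<phi>\<phi>] by (rule A_mult)
    finally have e: "\<delta> (h \<otimes> k) \<oplus> \<phi> (h \<otimes> k) = (\<delta> h \<oplus> ?l) \<oplus> (\<phi> h \<otimes> \<phi> k)" .
    show ?thesis
      by (rule B.part_decomposition_unique(1)[OF _ hall_props(2)[OF \<phi>hall[OF hk]] _ hall_props(2)[OF \<phi>\<phi>] _ e])
        (use \<delta>A[OF hk] B.subbraceD(6)[OF A_closed(2) \<delta>A[OF h] lA] kernel_part in auto)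
  qed
  then obtain a where a: "a \<in> A" "\<And>h. h \<in> hall \<Longrightarrow> \<delta> h \<oplus> lam B (\<phi> h) a = a"
    using cocycle_trivial[of hall \<phi> \<delta>] hall_subbrace hall_props(2) \<phi>B \<delta>A by blast
  have aB: "a \<in> carrier B" using a(1) A_closed(1) by blast
  \<comment> \<open>Conjugation by \<open>a\<inverse>\<close> moves the second complement back onto \<open>hall\<close>.\<close>
  define y where "y = inv a \<otimes> x"
  have yB: "y \<in> carrier B" using aB x(1) by (simp add: y_def)
  have fy: "f y = q"
    using aB x a(1) f_closed[OF x(1)] by (simp add: y_def kernel Q.zero_eq_one)
  have "conjugate B y h \<in> hall" if h: "h \<in> hall" for h
  proof -
    have lB: "lam B (\<phi> h) a \<in> carrier B" using \<phi>B[OF h] aB by simp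
    have "conjugate B y h = conjugate B (inv a) (conjugate B x h)"
      unfolding y_def using aB x(1) hall_props(3)[OF h] by (intro B.conjugate_conjugate) simp_all
    also have "\<dots> = inv a \<otimes> (\<delta> h \<otimes> (\<phi> h \<otimes> a))"
      unfolding eq[OF h] A_mult[OF \<delta>A[OF h] \<phi>B[OF h], symmetric]
      using aB \<delta>B[OF h] \<phi>B[OF h] by (simp add: conjugate_def B.m_assoc)
    also have "\<dots> = inv a \<otimes> ((\<delta> h \<otimes> lam B (\<phi> h) a) \<otimes> \<phi> h)"
      unfolding conj_A[OF \<phi>B[OF h] a(1)] using \<delta>B[OF h] \<phi>B[OF h] lB by (simp add: B.m_assoc)
    also have "\<delta> h \<otimes> lam B (\<phi> h) a = a" using A_mult[OF \<delta>A[OF h] lB] a(2)[OF h] by simp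
    also have "inv a \<otimes> (a \<otimes> \<phi> h) = \<phi> h" using aB \<phi>B[OF h] by simp
    finally show ?thesis using \<phi>hall[OF h] by simp
  qed
  then have yN: "y \<in> normalizer B hall"
    using yB B.normalizer_iff[OF B.finite_carrier hall_carrier] by blast
  have N: "subgroup (normalizer B hall) B"
    by (rule B.subgroup_normalizer[OF B.finite_carrier hall_carrier])
  have "conjugate B y c \<in> hall_norm" if "c \<in> hall_norm" for c
    using that lift_conjugate[OF yB] norm B.subgroup_conjugate[OF N yN] unfolding hall_norm_eq_Int fy by blast
  then have "y \<in> hall_norm" using assms yB by (simp add: self_normalising_def)
  then show "q \<in> E" using fy by (auto simp: hall_norm_def lift_def)
qed

end

context socle_quotient
begin

lemma nilpotent_in_quotientI:
  assumes "subbrace E Q" "nilpotent_group (Q\<lparr>carrier := E\<rparr>)"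
  shows "nilpotent_in_quotient B Q f A p E"
  using socle_quotient_axioms assms
  by (simp add: nilpotent_in_quotient_def nilpotent_in_quotient_axioms_def)

text \<open>
  Write \<open>E = f(X)\<close>. By nilpotency of \<open>X\<close> its \<open>p\<close>-part and its \<open>p'\<close>-part act trivially on each other, and
  its \<open>p'\<close>-part is all of \<open>hall\<close>; so \<open>X \<subseteq> hall_norm\<close>. The latter is nilpotent and \<open>X\<close> is
  self-normalising, which forces equality. Hence \<open>X\<close> is determined by its image.
\<close>

lemma carter_image:
  assumes "subbrace_carter B X"
  shows "subbrace_carter Q (f ` X)" "X = nilpotent_in_quotient.hall_norm B f p (f ` X)"
proof -
  have X: "subbrace X B" "nilpotent_group (B\<lparr>carrier := X\<rparr>)" "self_normalising X B"
    using assms by (auto simp: subbrace_carter_def)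
  have E: "subbrace (f ` X) Q" by (rule subbrace_image[OF X(1)])
  have En: "nilpotent_group (Q\<lparr>carrier := f ` X\<rparr>)"
    by (rule mult.nilpotent_image[OF B.subbraceD(1)[OF X(1)] X(2)])
  interpret E: nilpotent_in_quotient B Q f A p "f ` X" by (rule nilpotent_in_quotientI[OF E En])
  have XB: "X \<subseteq> carrier B" by (rule B.subbraceD(3)[OF X(1)])
  have XD: "X \<subseteq> E.lift" using XB by (auto simp: E.lift_def)
  have HX: "h \<in> X" if h: "h \<in> E.hall" for h
  proof -
    have hB: "h \<in> carrier B" and hp: "h \<in> part (- {p})" using E.hall_props[OF h] by blast+
    obtain c where c: "c \<in> X" "f h = f c" using E.hall_props(1)[OF h] by (auto simp: E.lift_def)
    obtain u v where uv: "u \<in> X \<inter> part {p}" "v \<in> X \<inter> part (- {p})" "c = u \<oplus> v"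
      using B.subbrace_decompose[OF X(1) c(1)] .
    have uvB: "u \<in> carrier B" "v \<in> carrier B" using uv XB by blast+
    have fc: "f u \<in> carrier Q" "f v \<in> carrier Q" "f h \<in> carrier Q" using f_closed uvB hB by blast+
    have "f u \<oplus>\<^bsub>Q\<^esub> f v = \<zero>\<^bsub>Q\<^esub> \<oplus>\<^bsub>Q\<^esub> f h" using c(2) uvB fc by (simp add: uv(3) f_add)
    moreover have "\<zero>\<^bsub>Q\<^esub> \<in> Q.part {p}" using Q.add.one_in_pi_elements by simp
    ultimately have "f v = f h"
      using Q.part_decomposition_unique(2)[of "f u" "{p}" "f v" "- {p}" "\<zero>\<^bsub>Q\<^esub>" "f h"]
        f_part uv(1,2) hp by simp
    then have "v = h" using f_eq_part_imp_eq[of v h] uv(2) hp by blast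
    then show ?thesis using uv(2) by blast
  qed
  have XC: "X \<subseteq> E.hall_norm"
  proof
    fix c assume "c \<in> X"
    then obtain u v where uv: "u \<in> X \<inter> part {p}" "v \<in> X \<inter> part (- {p})" "c = u \<oplus> v"
      using B.subbrace_decompose[OF X(1)] by blast
    have "lam B h u = u" if h: "h \<in> E.hall" for h
      using B.nilpotent_subbrace_parts(2)[OF X(1,2), of h "- {p}" u "{p}"]
        HX[OF h] E.hall_props(2)[OF h] uv(1) by simp
    then have "u \<in> E.fixed" using uv(1) XD by (auto simp: E.fixed_def)
    moreover have "v \<in> E.hall" using uv(2) XD by (auto simp: E.hall_def)
    ultimately show "c \<in> E.hall_norm" unfolding E.hall_norm_eq_add uv(3) by blast
  qed
  show XC_eq: "X = E.hall_norm"
  proof (rule B.nilpotent_normalizer_grows[OF B.subbraceD(1)[OF E.hall_norm_subbrace] E.hall_norm_nilpotent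
        B.subbraceD(1)[OF X(1)] XC])
    show "x \<in> X" if "x \<in> E.hall_norm" "\<And>l. l \<in> X \<Longrightarrow> conjugate B x l \<in> X" for x
      using X(3) that B.subbraceD(3)[OF E.hall_norm_subbrace] by (auto simp: self_normalising_def)
  qed
  have "self_normalising E.hall_norm B" using X(3) XC_eq by simp
  then show "subbrace_carter Q (f ` X)"
    using E.self_normalising_descends E En by (simp add: subbrace_carter_def)
qed

lemma carter_lift:
  assumes "subbrace_carter Q E"
  shows "subbrace_carter B (nilpotent_in_quotient.hall_norm B f p E)"
proof -
  have E: "subbrace E Q" "nilpotent_group (Q\<lparr>carrier := E\<rparr>)" "self_normalising E Q"
    using assms by (auto simp: subbrace_carter_def)
  interpret E: nilpotent_in_quotient B Q f A p E by (rule nilpotent_in_quotientI[OF E(1,2)])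
  show ?thesis by (rule E.hall_norm_carter[OF E(3)])
qed

end

section \<open>The idealiser of the Sylow system\<close>

context nilpotent_brace
begin

lemma part_singleton_trivial:
  assumes "\<not> (prime q \<and> q dvd order B)"
  shows "part {q} = {\<zero>}"
proof -
  have pos: "order (add_monoid B) > 0"
    using finite_carrier one_closed by (auto simp: order_def card_gt_0_iff)
  have "{q} \<inter> prime_factors (order (add_monoid B)) = {}"
    using assms pos by (auto simp: in_prime_factors_iff order_def)
  then have "part {q} = part {}"
    using add.pi_elements_Int_primes[of "{q}"] finite_carrier by simp
  moreover have "part {} \<subseteq> {\<zero>}" using part_disjoint[of _ "{}" "{}"] by blast
  ultimately show ?thesis using add.one_in_pi_elements[of "{}"] by auto
qed

lemma sylow_system_eq: "sylow_system B = {part {q} | q. prime q \<and> q dvd order B}"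
  using add.nilpotent_sylow[OF _ add_nilpotent] add.nilpotent_sylow_pi_elements[OF _ add_nilpotent]
    finite_carrier
  by (auto simp: sylow_system_def)

text \<open>
  Quantifying over all \<open>q\<close> instead of the prime divisors of \<open>|B|\<close> is harmless, the other parts being
  trivial, and avoids comparing the orders of \<open>B\<close> and its quotients.
\<close>

lemma sylow_idealiser_iff:
  "x \<in> sylow_idealiser B \<longleftrightarrow> x \<in> carrier B \<and> (\<forall>q. \<forall>b\<in>part {q}.
    conjugate B x b \<in> part {q} \<and> conjugate (add_monoid B) x b \<in> part {q})"
proof -
  have *: "x \<in> idealiser B (part S) \<longleftrightarrow> (\<forall>b\<in>part S. conjugate B x b \<in> part S
      \<and> conjugate (add_monoid B) x b \<in> part S)" if "x \<in> carrier B" for S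
    using normalizer_iff[OF finite_carrier part_carrier, of x S]
      add.normalizer_iff[of "part S" x] finite_carrier part_carrier[of S] that
    by (auto simp: idealiser_def)
  have "(\<forall>P\<in>sylow_system B. x \<in> idealiser B P) \<longleftrightarrow> (\<forall>q. x \<in> idealiser B (part {q}))"
    if x: "x \<in> carrier B"
  proof -
    have "x \<in> idealiser B (part {q})" if "\<not> (prime q \<and> q dvd order B)" for q
    proof -
      have "conjugate B x \<zero> = \<zero>" using conjugate_one[OF x] by (simp only: zero_eq_one)
      then have "\<forall>b\<in>part {q}. conjugate B x b \<in> part {q} \<and> conjugate (add_monoid B) x b \<in> part {q}"
        unfolding part_singleton_trivial[OF that] using add.conjugate_one[OF x] by simp
      then show ?thesis by (simp only: *[OF x])
    qed
    then show ?thesis unfolding sylow_system_eq by blast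
  qed
  then show ?thesis using * by (auto simp: sylow_idealiser_def)
qed

text \<open>
  From primes to sets of primes one prime at a time, using that a sum of elements of two parts is also
  a product of such elements.
\<close>

lemma sylow_idealiser_normalises_part:
  assumes "x \<in> sylow_idealiser B" "b \<in> part S"
  shows "conjugate B x b \<in> part S"
proof -
  have x: "x \<in> carrier B" and norm: "\<And>q b. b \<in> part {q} \<Longrightarrow> conjugate B x b \<in> part {q}"
    using assms(1) by (auto simp: sylow_idealiser_iff)
  have "\<forall>b\<in>part F. conjugate B x b \<in> part F" if "finite F" for F
    using that
  proof (induction F rule: finite_induct)
    case empty
    have "part {} = {\<zero>}"
      using part_disjoint[of _ "{}" "{}"] add.one_in_pi_elements[of "{}"] by auto
    then show ?case using x by (simp add: zero_eq_one)
  next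
    case (insert q F)
    show ?case
    proof
      fix b assume "b \<in> part (insert q F)"
      then obtain u v where uv: "b = u \<oplus> v" "u \<in> part F" "v \<in> part {q}"
        using add.nilpotent_pi_elements_insert[OF _ add_nilpotent insert.hyps(2)] finite_carrier by auto
      have c: "u \<in> carrier B" "v \<in> carrier B" using uv part_carrier by blast+
      \<comment> \<open>\<open>u + v = u \<lambda>\<^bsub>u\<inverse>\<^esub>(v)\<close>\<close>
    let ?w = "lam B (inv u) v"
      have w: "?w \<in> part {q}" using lam_part uv(3) c(1) by blast
      have "conjugate B x b = conjugate B x (u \<otimes> ?w)" using c by (simp add: uv(1) mult_eq)
      also have "\<dots> = conjugate B x u \<otimes> conjugate B x ?w"
        using x c by (intro conjugate_mult) simp_all
      finally have eq: "conjugate B x b = conjugate B x u \<otimes> conjugate B x ?w" .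
      have "conjugate B x u \<in> part (insert q F)"
        using insert.IH uv(2) add.pi_elements_mono[of F "insert q F"] by blast
      moreover have "conjugate B x ?w \<in> part (insert q F)"
        using norm[OF w] add.pi_elements_mono[of "{q}" "insert q F"] by blast
      ultimately show "conjugate B x b \<in> part (insert q F)"
        unfolding eq by (rule subbraceD(8)[OF part_subbrace])
    qed
  qed
  from this[of "S \<inter> prime_factors (order (add_monoid B))"] show ?thesis
    using add.pi_elements_Int_primes[of S] finite_carrier assms(2) by simp
qed

end

lemma (in skew_brace) carrier_subbrace: "subbrace (carrier B) B"
  unfolding subbrace_def using subgroup_self add.subgroup_self by simp

text \<open>
  Split a preimage of \<open>q\<close> into an \<open>S\<close>-part and a remainder; the image of the remainder vanishes by
  uniqueness of the decomposition of \<open>q\<close>.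
\<close>

lemma (in brace_epi) part_image:
  assumes "nilpotent_brace B" "nilpotent_brace Q"
  shows "f ` pi_elements (add_monoid B) S = pi_elements (add_monoid Q) S"
proof -
  interpret s: nilpotent_brace B by fact
  interpret t: nilpotent_brace Q by fact
  show ?thesis
  proof
    show "f ` s.part S \<subseteq> t.part S" using add.hom_pi_elements by blast
    show "t.part S \<subseteq> f ` s.part S"
    proof
      fix q assume q: "q \<in> t.part S"
      then have "q \<in> carrier Q" using t.part_carrier by blast
      then obtain b where b: "b \<in> carrier B" "q = f b" using surj by blast
      obtain u v where "u \<in> carrier B \<inter> s.part S" "v \<in> carrier B \<inter> s.part (- S)"
        and eq: "b = u \<oplus> v"
        using s.subbrace_decompose[OF B.carrier_subbrace b(1)] .
      then have uv: "u \<in> s.part S" "v \<in> s.part (- S)" by simp_all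
      have c: "u \<in> carrier B" "v \<in> carrier B" using uv s.part_carrier by blast+
      have z: "\<zero>\<^bsub>Q\<^esub> \<in> t.part (- S)" using Q.add.one_in_pi_elements by simp
      have "f u \<oplus>\<^bsub>Q\<^esub> f v = q \<oplus>\<^bsub>Q\<^esub> \<zero>\<^bsub>Q\<^esub>"
        using b c f_closed by (simp add: eq f_add)
      then have "f u = q"
        using t.part_decomposition_unique(1)[OF _ _ q z, of "f u" "f v"] add.hom_pi_elements uv(1,2) by simp
      then show "q \<in> f ` s.part S" using uv(1) by blast
    qed
  qed
qed

context socle_quotient
begin

lemma f_sylow_idealiser:
  assumes "x \<in> sylow_idealiser B"
  shows "f x \<in> sylow_idealiser Q"
proof -
  have x: "x \<in> carrier B" using assms by (simp add: B.sylow_idealiser_iff)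
  have img: "f ` part S = Q.part S" for S
    by (rule part_image[OF B.nilpotent_brace_axioms Q.nilpotent_brace_axioms])
  have "conjugate Q (f x) b \<in> Q.part {q} \<and> conjugate (add_monoid Q) (f x) b \<in> Q.part {q}"
    if "b \<in> Q.part {q}" for q b
  proof -
    have "b \<in> f ` part {q}" using that by (simp only: img)
    then obtain c where c: "c \<in> part {q}" "b = f c" by blast
    then have cB: "c \<in> carrier B" using B.part_carrier by blast
    have "conjugate B x c \<in> part {q}" "conjugate (add_monoid B) x c \<in> part {q}"
      using assms c(1) by (auto simp: B.sylow_idealiser_iff)
    then have "f (conjugate B x c) \<in> Q.part {q}" "f (conjugate (add_monoid B) x c) \<in> Q.part {q}"
      using f_part by blast+
    then show ?thesis
      using mult.hom_conjugate[OF x cB] add.hom_conjugate[of x c] x cB c(2) by simp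
  qed
  then show ?thesis using f_closed[OF x] by (simp add: Q.sylow_idealiser_iff)
qed

text \<open>
  An element of the idealiser maps into \<open>E\<close>, so it lies in \<open>lift\<close>; it normalises the whole \<open>p'\<close>-part of
  \<open>B\<close>, hence also \<open>hall\<close>.
\<close>

lemma sylow_idealiser_lift:
  assumes "subbrace_carter Q E" "sylow_idealiser Q \<subseteq> E"
  shows "sylow_idealiser B \<subseteq> nilpotent_in_quotient.hall_norm B f p E"
proof
  fix x assume x: "x \<in> sylow_idealiser B"
  have E: "subbrace E Q" "nilpotent_group (Q\<lparr>carrier := E\<rparr>)"
    using assms by (auto simp: subbrace_carter_def)
  interpret E: nilpotent_in_quotient B Q f A p E by (rule nilpotent_in_quotientI[OF E])
  have "x \<in> carrier B" using x by (simp add: B.sylow_idealiser_iff)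
  then have xD: "x \<in> E.lift" using f_sylow_idealiser[OF x] assms(2) by (auto simp: E.lift_def)
  have "conjugate B x h \<in> E.hall" if h: "h \<in> E.hall" for h
    using B.sylow_idealiser_normalises_part[OF x E.hall_props(2)[OF h]]
      B.subgroup_conjugate[OF B.subbraceD(1)[OF E.lift_subbrace] xD E.hall_props(1)[OF h]]
    by (simp add: E.hall_def)
  then show "x \<in> E.hall_norm" using xD by (simp add: E.hall_norm_def)
qed

end

section \<open>Existence and uniqueness\<close>

lemma (in skew_brace) nilpotent_brace_if_multipermutational:
  "\<lbrakk>finite (carrier B); multipermutational B\<rbrakk> \<Longrightarrow> nilpotent_brace B"
  using skew_brace_axioms multipermutational_add_nilpotent
  by (simp add: nilpotent_brace_def nilpotent_brace_axioms_def)

text \<open>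
  Some Sylow subgroup of the nontrivial group \<open>Soc(B)\<close> is nontrivial; it serves as the ideal to factor
  out.
\<close>

lemma (in skew_brace) exists_socle_quotient:
  assumes "finite (carrier B)" "multipermutational B" "carrier B \<noteq> {\<zero>}"
  obtains Q :: "('a, 'b) ring_scheme" and f A p
  where "socle_quotient B Q f A p" "multipermutational Q" "finite (carrier Q)"
    "card (carrier Q) < card (carrier B)"
proof -
  let ?S = "brace_socle B"
  interpret nilpotent_brace B by (rule nilpotent_brace_if_multipermutational[OF assms(1,2)])
  have soc: "brace_ideal ?S B" by (rule socle_ideal)
  have zS: "\<zero> \<in> ?S" using soc subbraceD(4) by (auto simp: brace_ideal_iff)
  obtain s where s: "s \<in> ?S" "s \<noteq> \<zero>" using nontrivial_socle[OF assms(2,3)] zS by blast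
  have S: "subgroup ?S (add_monoid B)" by (rule socle_subgroup)
  have "\<exists>p. prime p \<and> ?S \<inter> part {p} \<noteq> {\<zero>}"
  proof (rule ccontr)
    assume no: "\<not> ?thesis"
    have fin: "finite ?S" using finite_subset[OF subgroup.subset[OF S]] assms(1) by simp
    have "card ?S \<noteq> 1" using s zS by (auto simp: card_1_singleton_iff)
    then obtain p where p: "prime p" "p dvd card ?S" using prime_factor_nat by blast
    have "card ?S > 0" using fin zS by (auto simp: card_gt_0_iff)
    then have "p \<in> prime_factors (card ?S)" using p by (auto simp: in_prime_factors_iff)
    then have "\<not> prime_factors (card ?S) \<subseteq> - {p}" by blast
    then have "\<not> ?S \<subseteq> part (- {p})"
      using add.subgroup_pi_elements_iff[OF _ S] assms(1) by simp
    then obtain b where b: "b \<in> ?S" "b \<notin> part (- {p})" by blast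
    have "subbrace ?S B" using soc by (simp add: brace_ideal_iff)
    then obtain u v where uv: "u \<in> ?S \<inter> part {p}" "v \<in> ?S \<inter> part (- {p})" "b = u \<oplus> v"
      using subbrace_decompose[OF _ b(1)] by blast
    have "u = \<zero>" using no p(1) uv(1) by blast
    then have "b = v" using uv part_carrier[of "- {p}"] by auto
    then show False using uv(2) b(2) by blast
  qed
  then obtain p where p: "prime p" "?S \<inter> part {p} \<noteq> {\<zero>}" by blast
  define A where "A = ?S \<inter> part {p}"
  have A: "brace_ideal A B"
    unfolding brace_ideal_iff
  proof (intro conjI ballI)
    show "subbrace A B"
      unfolding A_def using soc by (intro subbrace_Int part_subbrace) (simp add: brace_ideal_iff)
    fix b i assume b: "b \<in> carrier B" and i: "i \<in> A"
    have iS: "i \<in> ?S" and ic: "i \<in> carrier B" using i by (auto simp: A_def socle_iff)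
    show l: "lam B b i \<in> A" using lam_socle[OF b iS] lam_part[OF b] i by (simp add: A_def)
    then show "conjugate B b i \<in> A" by (simp add: socle_conjugate[OF b iS])
    have "b \<oplus> i = i \<oplus> b" using iS b unfolding socle_iff by force
    then have "conjugate (add_monoid B) b i = i" using add.conjugate_eq_iff_commute[OF b ic] by simp
    then show "conjugate (add_monoid B) b i \<in> A" using i by simp
  qed
  obtain Q :: "('a, 'b) ring_scheme" and f
    where Q: "brace_epi B Q f" "\<And>b. b \<in> carrier B \<Longrightarrow> f b = \<zero>\<^bsub>Q\<^esub> \<longleftrightarrow> b \<in> A"
    using quotient_on_same_type[OF A] by blast
  interpret q: brace_epi B Q f by fact
  have mpQ: "multipermutational Q" by (rule q.multipermutational_image[OF assms(2)])
  have finQ: "finite (carrier Q)" using assms(1) q.surj by (metis finite_imageI)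
  have nilQ: "nilpotent_brace Q" by (rule q.Q.nilpotent_brace_if_multipermutational[OF finQ mpQ])
  have AB: "A \<subseteq> carrier B" by (rule ideal_normal(3)[OF A])
  have sq: "socle_quotient B Q f A p"
  proof (intro socle_quotient.intro socle_quotient_axioms.intro)
    show "A = {b \<in> carrier B. f b = \<zero>\<^bsub>Q\<^esub>}" using Q(2) AB by blast
  qed (use Q(1) nilQ nilpotent_brace_axioms p(1) in \<open>auto simp: A_def\<close>)
  have "card (carrier Q) < card (carrier B)"
  proof (rule ccontr)
    assume "\<not> card (carrier Q) < card (carrier B)"
    then have "card (f ` carrier B) = card (carrier B)"
      using card_image_le[OF assms(1), of f] q.surj by simp
    then have inj: "inj_on f (carrier B)" using eq_card_imp_inj_on[OF assms(1)] by blast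
    have "\<zero> \<in> A" using subbraceD(4)[of A] A by (simp add: brace_ideal_iff)
    then obtain a where a: "a \<in> A" "a \<noteq> \<zero>" using p(2) by (auto simp: A_def)
    have aB: "a \<in> carrier B" using a(1) AB by blast
    have "f a = f \<zero>" using Q(2)[OF aB] a(1) q.f_zero by simp
    then show False using inj_onD[OF inj, of a \<zero>] aB a(2) by simp
  qed
  then show thesis using that sq mpQ finQ by blast
qed

text \<open>
  The maps \<open>X \<mapsto> f(X)\<close> and \<open>E \<mapsto> hall_norm\<close> are mutually inverse bijections between the
  subbraces of \<open>B\<close> that are Carter subgroups and those of a smaller quotient.
\<close>

theorem unique_subbrace_carter:
  fixes B :: "('a, 'b) ring_scheme"
  assumes "skew_brace B" "finite (carrier B)" "multipermutational B"
  shows "\<exists>C. subbrace_carter B C \<and> sylow_idealiser B \<subseteq> C \<and> (\<forall>X. subbrace_carter B X \<longrightarrow> X = C)"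
  using assms
proof (induction "card (carrier B)" arbitrary: B rule: less_induct)
  case less
  interpret skew_brace B by fact
  show ?case
  proof (cases "carrier B = {\<zero>\<^bsub>B\<^esub>}")
    case True
    note carrier_subbrace
    moreover have "nilpotent_group (B\<lparr>carrier := carrier B\<rparr>)"
    proof (rule nilpotent_subgroupI[OF subgroup_self, of "\<lambda>_. carrier B" 0])
      show "carrier B \<subseteq> {\<one>\<^bsub>B\<^esub>}" using True by (simp add: zero_eq_one)
    qed simp_all
    moreover have "self_normalising (carrier B) B" by (simp add: self_normalising_def)
    moreover have "X = carrier B" if "subbrace_carter B X" for X
      using that subbraceD(3,4)[of X] True by (auto simp: subbrace_carter_def)
    ultimately show ?thesis
      by (intro exI[of _ "carrier B"]) (auto simp: subbrace_carter_def sylow_idealiser_def)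
  next
    case False
    obtain Q :: "('a, 'b) ring_scheme" and f A p
      where q: "socle_quotient B Q f A p" "multipermutational Q" "finite (carrier Q)"
        "card (carrier Q) < card (carrier B)"
      using exists_socle_quotient[OF less.prems(2,3) False] .
    interpret q: socle_quotient B Q f A p by (rule q(1))
    obtain E where E: "subbrace_carter Q E" "sylow_idealiser Q \<subseteq> E"
      "\<And>X. subbrace_carter Q X \<Longrightarrow> X = E"
      using less.hyps[OF q(4) q.Q.skew_brace_axioms q(3,2)] by blast
    let ?C = "nilpotent_in_quotient.hall_norm B f p E"
    have "X = ?C" if "subbrace_carter B X" for X
      using q.carter_image[OF that] E(3) by metis
    then show ?thesis
      using q.carter_lift[OF E(1)] q.sylow_idealiser_lift[OF E(1,2)] by blast
  qed
qed

theorem theorem3: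
  fixes B :: "('a, 'b) ring_scheme"
  assumes "skew_brace B"
    and "finite (carrier B)"
    and "multipermutational B"
  shows "(\<exists>!C. carter_subgroup C B \<and> subbrace C B) \<and>
    (\<forall>C. carter_subgroup C B \<and> subbrace C B \<longrightarrow>
          carter_subbrace C B \<and> sylow_idealiser B \<subseteq> C)"
proof -
  interpret skew_brace B by fact
  have iff: "carter_subgroup C B \<and> subbrace C B \<longleftrightarrow> subbrace_carter B C" for C
    unfolding carter_subgroup_iff[OF assms(2)] subbrace_carter_def subbrace_def by blast
  obtain C where C: "subbrace_carter B C" "sylow_idealiser B \<subseteq> C"
    "\<And>X. subbrace_carter B X \<Longrightarrow> X = C"
    using unique_subbrace_carter[OF assms] by blast
  have sub: "subbrace C B" and nil: "nilpotent_group (B\<lparr>carrier := C\<rparr>)"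
    and self: "self_normalising C B"
    using C(1) by (auto simp: subbrace_carter_def)
  interpret C: skew_brace "B\<lparr>carrier := C\<rparr>" by (rule subbrace_is_skew_brace[OF sub])
  have "centrally_nilpotent (B\<lparr>carrier := C\<rparr>)"
    by (rule C.multipermutational_nilpotent_imp_centrally_nilpotent
        [OF multipermutational_subbrace[OF assms(3) sub] nil])
  moreover have "self_idealising C B"
    unfolding self_idealising_def
  proof
    assume "\<exists>D. subbrace D B \<and> C \<subset> D \<and> brace_ideal C (B\<lparr>carrier := D\<rparr>)"
    then obtain D where D: "subbrace D B" "C \<subset> D" "brace_ideal C (B\<lparr>carrier := D\<rparr>)" by blast
    interpret D: skew_brace "B\<lparr>carrier := D\<rparr>" by (rule subbrace_is_skew_brace[OF D(1)])
    have "x \<in> C" if x: "x \<in> D" for x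
    proof -
      have "conjugate B x c \<in> C" if c: "c \<in> C" for c
      proof -
        have "conjugate (B\<lparr>carrier := D\<rparr>) x c \<in> C"
          using D(3) x c by (simp add: D.brace_ideal_iff)
        then show ?thesis
          using subgroup_carrier_update(3)[OF subbraceD(1)[OF D(1)] x, of c] c D(2) by auto
      qed
      then show ?thesis using self x subbraceD(3)[OF D(1)] by (auto simp: self_normalising_def)
    qed
    then show False using D(2) by blast
  qed
  ultimately have "carter_subbrace C B" using sub by (simp add: carter_subbrace_def)
  then show ?thesis unfolding iff using C by blast
qed

end
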